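(* Let $N\geq 4$, let $\Omega\subset\mathbb{R}^N$ be an open set and let $u:\Omega\to\mathbb{R}^N$ be a Lebesgue measurable vector field satisfying $|u|=1$ a.e. in $\Omega$ together with $$v\cdot\nabla_x\chi(\cdot,\xi)=0\ \text{ in }\mathcal{D}'(\Omega)\quad\text{for every }\xi\in\mathcal{E}\text{ and every }v\in\xi^\perp,$$ and $$\partial_k u_N=\partial_N u_k\quad\text{in }\Omega\ \text{ (in the sense of distributions)},\quad k=1,\dots,N-1 .$$ Then in every ball included in $\{x\in\Omega: u(x)\neq\pm e_N\}$ there exists a stream function $\psi=\psi(\alpha,\beta)$ solving the eikonal equation in dimension $2$, $(\partial_\alpha\psi)^2+(\partial_\beta\psi)^2=1$, such that $$u(x)=\nabla_x[\psi(\alpha,\beta)]$$ where 1) either $\alpha=|x'-P'|$ and $\beta=x_N$ for some point $P'\in\mathbb{R}^{N-1}$; 2) or $\alpha=w'\cdot x'$ and $\beta=x_N$ for some vector $w'\in\mathbb{S}^{N-2}$.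
   Context: Write $x=(x',x_N)\in\mathbb{R}^N$ with $x'=(x_1,\dots,x_{N-1})\in\mathbb{R}^{N-1}$, and $e_N=(0,\dots,0,1)$. $\mathbb{S}^{d-1}$ is the unit sphere of $\mathbb{R}^d$. Set $\mathcal{E}=\{\xi\in\mathbb{S}^{N-1}:\xi_N=0\}=\mathbb{S}^{N-2}\times\{0\}$. For $\xi\in\mathbb{S}^{N-1}$, $\xi^\perp=\{v\in\mathbb{R}^N:v\cdot\xi=0\}$, and $\chi(\cdot,\xi):\Omega\to\{0,1\}$ is defined from $u$ by $\chi(x,\xi)=1$ if $u(x)\cdot\xi>0$ and $\chi(x,\xi)=0$ if $u(x)\cdot\xi\leq 0$. Here $\psi$ is a function of the two real variables $(\alpha,\beta)$; since $u$ is only measurable, the eikonal equation and the identity $u(x)=\nabla_x[\psi(\alpha(x),\beta(x))]$ are understood almost everywhere, with $\nabla\psi$ taken in the weak sense. *)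

theory Defs
  imports "HOL-Analysis.Analysis"
begin

text \<open>\<open>C_k k f\<close>: \<open>f\<close> is of class \<open>C\<^sup>k\<close>. Continuity of all directional derivatives of a differentiable
  function is the same as continuity of its derivative.\<close>

primrec C_k :: "nat \<Rightarrow> ('a::euclidean_space \<Rightarrow> real) \<Rightarrow> bool" where
  "C_k 0 f \<longleftrightarrow> continuous_on UNIV f"
| "C_k (Suc k) f \<longleftrightarrow>
     (\<forall>x. f differentiable (at x)) \<and> (\<forall>v. C_k k (\<lambda>x. frechet_derivative f (at x) v))"

definition test_functions :: "'a::euclidean_space set \<Rightarrow> ('a \<Rightarrow> real) set" where
  "test_functions U =
     {\<phi>. (\<forall>k. C_k k \<phi>) \<and> compact (closure {x. \<phi> x \<noteq> 0}) \<and> closure {x. \<phi> x \<noteq> 0} \<subseteq> U}"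

text \<open>A distribution on \<open>U\<close> is represented by a functional on all real functions, of which only
  the values on \<open>test_functions U\<close> matter; \<open>distr_eq U\<close> is equality in \<open>\<D>'(U)\<close>.\<close>

definition distr_of :: "'a::euclidean_space set \<Rightarrow> ('a \<Rightarrow> real) \<Rightarrow> ('a \<Rightarrow> real) \<Rightarrow> real" where
  "distr_of U f \<phi> = (LINT x|lebesgue_on U. f x * \<phi> x)"

definition distr_deriv ::
    "'a::euclidean_space \<Rightarrow> (('a \<Rightarrow> real) \<Rightarrow> real) \<Rightarrow> ('a \<Rightarrow> real) \<Rightarrow> real" where
  "distr_deriv v T \<phi> = - T (\<lambda>x. frechet_derivative \<phi> (at x) v)"

definition distr_eq ::
    "'a::euclidean_space set \<Rightarrow> (('a \<Rightarrow> real) \<Rightarrow> real) \<Rightarrow> (('a \<Rightarrow> real) \<Rightarrow> real) \<Rightarrow> bool" where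
  "distr_eq U S T \<longleftrightarrow> (\<forall>\<phi>\<in>test_functions U. S \<phi> = T \<phi>)"

definition loc_integrable :: "'a::euclidean_space set \<Rightarrow> ('a \<Rightarrow> real) \<Rightarrow> bool" where
  "loc_integrable U f \<longleftrightarrow> (\<forall>K. compact K \<and> K \<subseteq> U \<longrightarrow> integrable (lebesgue_on K) f)"

text \<open>\<open>has_weak_gradient U f F\<close> determines \<open>F\<close> up to a null subset of the open set \<open>U\<close>, so it
  expresses \<open>F = \<nabla>f\<close> almost everywhere in \<open>U\<close>.\<close>

definition has_weak_gradient ::
    "'a::euclidean_space set \<Rightarrow> ('a \<Rightarrow> real) \<Rightarrow> ('a \<Rightarrow> 'a) \<Rightarrow> bool" where
  "has_weak_gradient U f F \<longleftrightarrow>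
     loc_integrable U f \<and>
     (\<forall>b\<in>Basis. loc_integrable U (\<lambda>x. F x \<bullet> b) \<and>
        distr_eq U (distr_deriv b (distr_of U f)) (distr_of U (\<lambda>x. F x \<bullet> b)))"

definition eikonal_2d :: "(real \<times> real) set \<Rightarrow> (real \<times> real \<Rightarrow> real) \<Rightarrow> bool" where
  "eikonal_2d D \<psi> \<longleftrightarrow>
     (\<exists>G. has_weak_gradient D \<psi> G \<and>
          (AE z in lebesgue_on D. (fst (G z))\<^sup>2 + (snd (G z))\<^sup>2 = 1))"

text \<open>The natural domain of \<open>\<psi>\<close> is the image of \<open>B\<close> under \<open>(\<alpha>, \<beta>)\<close>. For \<open>\<alpha> = \<bar>x' - P'\<bar>\<close> this image
  need not be open, as it may contain points with \<open>\<alpha> = 0\<close>; hence the interior.\<close>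

definition stream_function ::
    "('a::euclidean_space \<Rightarrow> 'a) \<Rightarrow> 'a set \<Rightarrow> ('a \<Rightarrow> real) \<Rightarrow> ('a \<Rightarrow> real) \<Rightarrow> (real \<times> real \<Rightarrow> real) \<Rightarrow> bool"
  where
  "stream_function u B \<alpha> \<beta> \<psi> \<longleftrightarrow>
     eikonal_2d (interior ((\<lambda>x. (\<alpha> x, \<beta> x)) ` B)) \<psi> \<and>
     has_weak_gradient B (\<lambda>x. \<psi> (\<alpha> x, \<beta> x)) u"

text \<open>Points \<open>x = (x', x\<^sub>N)\<close> of \<open>\<real>\<^sup>N\<close> have type \<open>(real ^ 'm) \<times> real\<close>, where \<open>CARD('m) = N - 1\<close>; norm,
  inner product and Lebesgue measure of this product type are the Euclidean ones.\<close>

definition e_N :: "(real ^ 'm) \<times> real" where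
  "e_N = (0, 1)"

definition equator :: "((real ^ 'm) \<times> real) set" where
  "equator = {\<xi> \<in> sphere 0 1. snd \<xi> = 0}"

definition chi :: "('a \<Rightarrow> 'a::euclidean_space) \<Rightarrow> 'a \<Rightarrow> 'a \<Rightarrow> real" where
  "chi u x \<xi> = (if u x \<bullet> \<xi> > 0 then 1 else 0)"

end

theory Submission
  imports Defs
begin

text \<open>Write \<open>x = (x', x\<^sub>N)\<close> and \<open>u = (u', u\<^sub>N)\<close>, and fix a ball \<open>B\<close> on which \<open>u\<close> avoids \<open>\<plusminus>e\<^sub>N\<close>, so that
\<open>u' \<noteq> 0\<close> there. For \<open>\<xi> = (\<xi>', 0)\<close> the indicator \<open>\<chi>(\<cdot>, \<xi>)\<close> only sees the direction of \<open>u'\<close>.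

The kinetic equation makes \<open>\<chi>(\<cdot>, \<xi>)\<close> invariant under every translation orthogonal to \<open>\<xi>\<close>. Fix a
translation \<open>v\<close> with horizontal part \<open>d\<close>. For almost every \<open>x\<close>, no \<open>\<xi>'\<close> orthogonal to \<open>d\<close>
separates \<open>u'(x)\<close> from \<open>u'(x + v)\<close>, which means that the projections of these two vectors to the
complement of \<open>d\<close> are nonnegative multiples of one vector (\<open>kinetic_compatible\<close>). By Fubini this
holds for almost all pairs of points. Hence the lines \<open>x' + \<real>u'(x)\<close> are pairwise coplanar, with
consistent orientations. Pairwise coplanar lines that do not all lie in one plane are concurrent
or parallel; the lines at hand start from almost all points of an open set in dimension
\<open>N - 1 \<ge> 3\<close>, so no plane contains them (\<open>compatible_field_direction\<close>), and the orientation is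
constant (\<open>compatible_field_sign\<close>). So \<open>u' = \<plusminus>\<bar>u'\<bar> E / \<bar>E\<bar>\<close> with \<open>E\<close> a constant unit vector or
\<open>E(x) = x' - P\<close>.

Let \<open>Z\<close> generate a rotation about \<open>P\<close>, respectively a translation, that preserves \<open>\<alpha> = \<bar>x' - P\<bar>\<close>,
respectively \<open>\<alpha> = E \<bullet> x'\<close>. The curl equation and \<open>u' \<parallel> E\<close> give \<open>Z u\<^sub>N = 0\<close> weakly, so \<open>u\<^sub>N\<close> is
invariant under the flow of \<open>Z\<close>, and so is \<open>\<bar>u'\<bar> = sqrt (1 - u\<^sub>N\<^sup>2)\<close>. That \<open>Z \<bar>u'\<bar> = 0\<close> weakly is
precisely the vanishing of the horizontal curls of \<open>u\<close> (\<open>horizontal_curl_free\<close>).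

A weak Poincare lemma gives \<open>u = \<nabla>\<Phi>\<close> on \<open>B\<close> with \<open>\<Phi>\<close> 1-Lipschitz (\<open>lipschitz_potential\<close>). The same
flows show that \<open>\<Phi>\<close> is constant on the fibres of \<open>(\<alpha>, \<beta>)\<close>, so \<open>\<Phi> = \<psi>(\<alpha>, \<beta>)\<close>, where \<open>\<psi>\<close> is the
restriction of \<open>\<Phi>\<close> to a half plane or plane through the centre of \<open>B\<close>.

Along a subsequence of step sizes, difference quotients of \<open>\<Phi>\<close> converge at almost every \<open>x\<close>, in
all directions \<open>v\<close> at once, to \<open>u(x) \<bullet> v\<close> (\<open>AE_directional_derivatives\<close>). In the directions
\<open>E(x) / \<bar>E(x)\<bar>\<close> and \<open>e\<^sub>N\<close> they are the difference quotients of \<open>\<psi>\<close> at \<open>(\<alpha>, \<beta>)\<close>, and the squares of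
the two limits add up to \<open>\<bar>u\<bar>\<^sup>2 = 1\<close>. The exceptional set in the plane has a null preimage, so it
is null itself, and for a Lipschitz function such limits form the weak gradient
(\<open>eikonal_of_fibred_potential\<close>).\<close>

section \<open>Smooth functions and test functions\<close>

definition smooth :: "('a::euclidean_space \<Rightarrow> real) \<Rightarrow> bool" where
  "smooth f \<longleftrightarrow> (\<forall>k. C_k k f)"

abbreviation dderiv :: "('a::euclidean_space \<Rightarrow> real) \<Rightarrow> 'a \<Rightarrow> 'a \<Rightarrow> real" where
  "dderiv f v x \<equiv> frechet_derivative f (at x) v"

lemma smooth_differentiable: "smooth f \<Longrightarrow> f differentiable (at x)"
  unfolding smooth_def by (metis C_k.simps(2))

lemma smooth_dderiv: "smooth f \<Longrightarrow> smooth (dderiv f v)"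
  unfolding smooth_def by (metis C_k.simps(2))

lemma smooth_has_derivative:
  "smooth f \<Longrightarrow> (f has_derivative frechet_derivative f (at x)) (at x)"
  using frechet_derivative_works smooth_differentiable by blast

lemma smooth_continuous: "smooth f \<Longrightarrow> continuous_on S f"
  by (meson C_k.simps(1) continuous_on_subset smooth_def subset_UNIV)

lemma smooth_borel: "smooth f \<Longrightarrow> f \<in> borel_measurable borel"
  by (simp add: borel_measurable_continuous_onI smooth_continuous)

lemma smooth_dderiv_linear: "smooth f \<Longrightarrow> linear (\<lambda>v. dderiv f v x)"
  using linear_frechet_derivative smooth_differentiable by blast

lemma dderiv_basis:
  assumes "smooth f"
  shows "dderiv f v x = (\<Sum>b\<in>Basis. (v \<bullet> b) * dderiv f b x)"
proof -
  note lin = smooth_dderiv_linear[OF assms, of x]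
  have "dderiv f v x = dderiv f (\<Sum>b\<in>Basis. (v \<bullet> b) *\<^sub>R b) x" by (simp add: euclidean_representation)
  then show ?thesis by (simp only: linear_sum[OF lin] linear_scale[OF lin] real_scaleR_def)
qed

lemma has_derivative_dderiv: "(f has_derivative f') (at x) \<Longrightarrow> dderiv f v x = f' v"
  using frechet_derivative_at by metis

text \<open>Smoothness is a greatest fixed point: a class of differentiable functions that is closed under
directional derivatives consists of smooth functions. This replaces explicit formulas for higher
derivatives of products and compositions.\<close>

lemma smooth_coinduct:
  assumes "S f"
    and step: "\<And>f. S f \<Longrightarrow> (\<forall>x. f differentiable (at x)) \<and> (\<forall>v. S (dderiv f v))"
  shows "smooth f"
proof -
  have "\<forall>f. S f \<longrightarrow> C_k k f" for k
  proof (induction k)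
    case 0
    then show ?case
      using step differentiable_imp_continuous_within continuous_at_imp_continuous_on
      by (metis C_k.simps(1))
  next
    case (Suc k)
    then show ?case using step by simp
  qed
  then show ?thesis using assms(1) by (simp add: smooth_def)
qed

text \<open>The derivative of \<open>exp (- 1 / t) / t ^ m\<close> is a combination of the functions with \<open>m + 1\<close> and
\<open>m + 2\<close>; keeping the power of \<open>t\<close> as a parameter makes the family closed under differentiation.\<close>

definition flat_exp :: "nat \<Rightarrow> real \<Rightarrow> real" where
  "flat_exp m t = (if t > 0 then exp (- 1 / t) / t ^ m else 0)"

lemma flat_exp_tendsto_0: "(flat_exp m \<longlongrightarrow> 0) (at_right 0)"
proof -
  have "((\<lambda>t::real. (1 / t) ^ m / exp (1 / t)) \<longlongrightarrow> 0) (at_right 0)"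
    using filterlim_compose[OF tendsto_power_div_exp_0 filterlim_inverse_at_top_right]
    by (simp add: inverse_eq_divide)
  moreover have "eventually (\<lambda>t. (1 / t) ^ m / exp (1 / t) = flat_exp m t) (at_right 0)"
    unfolding eventually_at_right_field
    by (intro exI[of _ 1]) (auto simp: flat_exp_def exp_minus field_simps)
  ultimately show ?thesis by (rule Lim_transform_eventually)
qed

lemma flat_exp_has_real_derivative:
  "(flat_exp m has_real_derivative (flat_exp (m + 2) t - real m * flat_exp (m + 1) t)) (at t)"
proof -
  consider "t < 0" | "t > 0" | "t = 0" by linarith
  then show ?thesis
  proof cases
    case 1
    have "((\<lambda>t. 0) has_real_derivative 0) (at t)" by simp
    then have "(flat_exp m has_real_derivative 0) (at t)"
      by (rule has_field_derivative_transform_within_open[of _ _ _ "{..<0}"])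
         (use 1 in \<open>auto simp: flat_exp_def\<close>)
    then show ?thesis using 1 by (simp add: flat_exp_def)
  next
    case 2
    have "((\<lambda>t. exp (- 1 / t) / t ^ m) has_real_derivative
        (exp (- 1 / t) * (1 / t\<^sup>2) * t ^ m - exp (- 1 / t) * (real m * t ^ (m - 1))) / (t ^ m * t ^ m)) (at t)"
      using 2 by (auto intro!: derivative_eq_intros simp: power2_eq_square)
    also have "(exp (- 1 / t) * (1 / t\<^sup>2) * t ^ m - exp (- 1 / t) * (real m * t ^ (m - 1))) / (t ^ m * t ^ m)
        = flat_exp (m + 2) t - real m * flat_exp (m + 1) t"
      using 2 by (cases m) (auto simp: flat_exp_def power2_eq_square field_simps)
    finally show ?thesis
      by (rule has_field_derivative_transform_within_open[of _ _ _ "{0<..}"])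
         (use 2 in \<open>auto simp: flat_exp_def\<close>)
  next
    case 3
    have "(flat_exp (m + 1) \<longlongrightarrow> 0) (at 0)"
    proof (rule filterlim_split_at)
      show "(flat_exp (m + 1) \<longlongrightarrow> 0) (at_left 0)"
        by (rule Lim_transform_eventually[of "\<lambda>_. 0"])
           (auto simp: flat_exp_def eventually_at_left_field intro!: exI[of _ "-1"])
    qed (rule flat_exp_tendsto_0)
    then have "((\<lambda>h. (flat_exp m (0 + h) - flat_exp m 0) / h) \<longlongrightarrow> 0) (at 0)"
      by (rule Lim_transform_eventually) (auto simp: flat_exp_def field_simps intro!: always_eventually)
    then show ?thesis using 3 by (simp add: DERIV_def flat_exp_def)
  qed
qed

text \<open>The algebra generated by smooth functions, affine functions and \<open>flat_exp m\<close> of affine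
functions. It is closed under directional derivatives, so by coinduction all of its members are
smooth; in particular sums and products of smooth functions are smooth.\<close>

inductive smooth_gen :: "('a::euclidean_space \<Rightarrow> real) \<Rightarrow> bool" where
  base: "smooth f \<Longrightarrow> smooth_gen f"
| affine: "smooth_gen (\<lambda>x. a \<bullet> x + c)"
| flat: "smooth_gen (\<lambda>x. flat_exp m (a \<bullet> x + c))"
| add: "smooth_gen f \<Longrightarrow> smooth_gen g \<Longrightarrow> smooth_gen (\<lambda>x. f x + g x)"
| mult: "smooth_gen f \<Longrightarrow> smooth_gen g \<Longrightarrow> smooth_gen (\<lambda>x. f x * g x)"

lemma smooth_gen_const: "smooth_gen (\<lambda>x. c)"
  using affine[of 0 c] by simp

lemma smooth_gen_derivative:
  assumes "smooth_gen f"
  shows "\<exists>D. (\<forall>x. (f has_derivative D x) (at x)) \<and> (\<forall>v. smooth_gen (\<lambda>x. D x v))"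
  using assms
proof induction
  case (base f)
  then show ?case
    by (intro exI[of _ "\<lambda>x. frechet_derivative f (at x)"])
       (auto simp: smooth_has_derivative smooth_dderiv intro: smooth_gen.base)
next
  case (affine a c)
  show ?case
    by (intro exI[of _ "\<lambda>x v. a \<bullet> v"]) (auto intro!: derivative_eq_intros smooth_gen_const)
next
  case (flat m a c)
  let ?d = "\<lambda>x. flat_exp (m + 2) (a \<bullet> x + c) - real m * flat_exp (m + 1) (a \<bullet> x + c)"
  have "((\<lambda>x. flat_exp m (a \<bullet> x + c)) has_derivative (\<lambda>v. (a \<bullet> v) * ?d x)) (at x)" for x
  proof -
    have "((\<lambda>x. a \<bullet> x + c) has_derivative (\<lambda>v. a \<bullet> v)) (at x)"
      by (auto intro!: derivative_eq_intros)
    from has_derivative_compose[OF this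
        flat_exp_has_real_derivative[of m "a \<bullet> x + c", unfolded has_field_derivative_def]]
    show ?thesis by (simp only: mult.commute)
  qed
  moreover have "smooth_gen (\<lambda>x. (a \<bullet> v) * ?d x)" for v
  proof -
    have "smooth_gen (\<lambda>x. (a \<bullet> v) * (flat_exp (m + 2) (a \<bullet> x + c) + (- real m) * flat_exp (m + 1) (a \<bullet> x + c)))"
      by (intro smooth_gen.mult smooth_gen.add smooth_gen.flat smooth_gen_const)
    then show ?thesis by simp
  qed
  ultimately show ?case by (intro exI[of _ "\<lambda>x v. (a \<bullet> v) * ?d x"]) auto
next
  case (add f g)
  then obtain D E where D: "\<forall>x. (f has_derivative D x) (at x)" "\<forall>v. smooth_gen (\<lambda>x. D x v)"
    and E: "\<forall>x. (g has_derivative E x) (at x)" "\<forall>v. smooth_gen (\<lambda>x. E x v)" by blast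
  then show ?case
    by (intro exI[of _ "\<lambda>x v. D x v + E x v"]) (auto intro!: smooth_gen.add has_derivative_add)
next
  case (mult f g)
  then obtain D E where D: "\<forall>x. (f has_derivative D x) (at x)" "\<forall>v. smooth_gen (\<lambda>x. D x v)"
    and E: "\<forall>x. (g has_derivative E x) (at x)" "\<forall>v. smooth_gen (\<lambda>x. E x v)" by blast
  show ?case
    by (intro exI[of _ "\<lambda>x v. f x * E x v + D x v * g x"] conjI allI has_derivative_mult
          smooth_gen.add smooth_gen.mult mult.hyps D(1)[rule_format] E(1)[rule_format]
          D(2)[rule_format] E(2)[rule_format])
qed

lemma smooth_gen_imp_smooth: "smooth_gen f \<Longrightarrow> smooth f"
proof (erule smooth_coinduct[of smooth_gen])
  fix f :: "'a \<Rightarrow> real" assume "smooth_gen f"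
  then obtain D where D: "\<And>x. (f has_derivative D x) (at x)" "\<And>v. smooth_gen (\<lambda>x. D x v)"
    using smooth_gen_derivative by blast
  have "dderiv f v = (\<lambda>x. D x v)" for v
    using has_derivative_dderiv[OF D(1)] by auto
  then show "(\<forall>x. f differentiable (at x)) \<and> (\<forall>v. smooth_gen (dderiv f v))"
    using D by (auto simp: differentiable_def) (use D(1) in blast)?
qed

lemma smooth_affine: "smooth (\<lambda>x. a \<bullet> x + c)"
  by (intro smooth_gen_imp_smooth smooth_gen.affine)

lemma smooth_const: "smooth (\<lambda>x. c)"
  by (intro smooth_gen_imp_smooth smooth_gen_const)

lemma smooth_flat_exp: "smooth (\<lambda>x. flat_exp m (a \<bullet> x + c))"
  by (intro smooth_gen_imp_smooth smooth_gen.flat)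

lemma smooth_add: "smooth f \<Longrightarrow> smooth g \<Longrightarrow> smooth (\<lambda>x. f x + g x)"
  by (rule smooth_gen_imp_smooth, rule smooth_gen.add) (rule smooth_gen.base, assumption)+

lemma smooth_mult: "smooth f \<Longrightarrow> smooth g \<Longrightarrow> smooth (\<lambda>x. f x * g x)"
  by (rule smooth_gen_imp_smooth, rule smooth_gen.mult) (rule smooth_gen.base, assumption)+

lemma smooth_power: "smooth f \<Longrightarrow> smooth (\<lambda>x. f x ^ n)"
  by (induction n) (simp_all add: smooth_const smooth_mult)

lemma smooth_prod: "(\<And>i. i \<in> I \<Longrightarrow> smooth (f i)) \<Longrightarrow> smooth (\<lambda>x. \<Prod>i\<in>I. f i x)"
  by (induction I rule: infinite_finite_induct) (simp_all add: smooth_const smooth_mult)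

lemma dderiv_affine_compose:
  assumes f: "smooth f" and L: "linear L"
  shows "dderiv (\<lambda>x. f (L x + k)) v x = dderiv f (L v) (L x + k)"
proof -
  have "((\<lambda>x. L x + k) has_derivative L) (at x)"
    by (intro has_derivative_add_const linear_imp_has_derivative L)
  from has_derivative_compose[OF this smooth_has_derivative[OF f]] show ?thesis
    by (rule has_derivative_dderiv)
qed

lemma smooth_affine_compose:
  fixes f :: "'b::euclidean_space \<Rightarrow> real" and L :: "'a::euclidean_space \<Rightarrow> 'b"
  assumes f: "smooth f" and L: "linear L"
  shows "smooth (\<lambda>x. f (L x + k))"
proof (rule smooth_coinduct[where S = "\<lambda>h. \<exists>g. smooth g \<and> h = (\<lambda>x. g (L x + k))"])
  show "\<exists>g. smooth g \<and> (\<lambda>x. f (L x + k)) = (\<lambda>x. g (L x + k))" using f by auto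
next
  fix h assume "\<exists>g. smooth g \<and> h = (\<lambda>x. g (L x + k))"
  then obtain g where g: "smooth g" "h = (\<lambda>x. g (L x + k))" by blast
  have "((\<lambda>x. L x + k) has_derivative L) (at x)" for x
    by (intro has_derivative_add_const linear_imp_has_derivative L)
  then have "h differentiable (at x)" for x
    using has_derivative_compose[OF _ smooth_has_derivative[OF g(1)], of "\<lambda>x. L x + k"] g(2)
    unfolding differentiable_def by blast
  moreover have "dderiv h v = (\<lambda>x. dderiv g (L v) (L x + k))" for v
    using dderiv_affine_compose[OF g(1) L] g(2) by auto
  ultimately show "(\<forall>x. h differentiable (at x)) \<and> (\<forall>v. \<exists>g. smooth g \<and> dderiv h v = (\<lambda>x. g (L x + k)))"
    using smooth_dderiv[OF g(1)] by blast
qed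

lemma dderiv_mult:
  "smooth f \<Longrightarrow> smooth g \<Longrightarrow> dderiv (\<lambda>x. f x * g x) v x = f x * dderiv g v x + dderiv f v x * g x"
  by (rule has_derivative_dderiv) (intro has_derivative_mult smooth_has_derivative)

lemma dderiv_affine: "dderiv (\<lambda>x. a \<bullet> x + c) v x = a \<bullet> v"
  by (rule has_derivative_dderiv) (intro has_derivative_add_const has_derivative_inner_right has_derivative_ident)

text \<open>A compact set off which the function vanishes is easier to transport along maps than the closure
of its support.\<close>

lemma test_functions_iff:
  "\<phi> \<in> test_functions U \<longleftrightarrow> smooth \<phi> \<and> (\<exists>K. compact K \<and> K \<subseteq> U \<and> (\<forall>x. x \<notin> K \<longrightarrow> \<phi> x = 0))"
proof
  assume "\<phi> \<in> test_functions U"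
  then show "smooth \<phi> \<and> (\<exists>K. compact K \<and> K \<subseteq> U \<and> (\<forall>x. x \<notin> K \<longrightarrow> \<phi> x = 0))"
    using closure_subset[of "{x. \<phi> x \<noteq> 0}"]
    by (auto simp: test_functions_def smooth_def intro!: exI[of _ "closure {x. \<phi> x \<noteq> 0}"])
next
  assume R: "smooth \<phi> \<and> (\<exists>K. compact K \<and> K \<subseteq> U \<and> (\<forall>x. x \<notin> K \<longrightarrow> \<phi> x = 0))"
  then obtain K where K: "compact K" "K \<subseteq> U" "\<forall>x. x \<notin> K \<longrightarrow> \<phi> x = 0" by blast
  then have "closure {x. \<phi> x \<noteq> 0} \<subseteq> K" by (intro closure_minimal) (auto simp: compact_imp_closed)
  then show "\<phi> \<in> test_functions U"
    using K R closed_Int_compact[OF closed_closure K(1), of "{x. \<phi> x \<noteq> 0}"]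
    by (simp add: test_functions_def smooth_def inf.absorb1)
qed

lemma test_functionsI:
  "smooth \<phi> \<Longrightarrow> compact K \<Longrightarrow> K \<subseteq> U \<Longrightarrow> (\<And>x. x \<notin> K \<Longrightarrow> \<phi> x = 0) \<Longrightarrow> \<phi> \<in> test_functions U"
  by (auto simp: test_functions_iff)

lemma test_functionsE:
  assumes "\<phi> \<in> test_functions U"
  obtains K where "smooth \<phi>" "compact K" "K \<subseteq> U" "\<And>x. x \<notin> K \<Longrightarrow> \<phi> x = 0"
  using assms unfolding test_functions_iff by blast

lemma test_functions_mono: "\<phi> \<in> test_functions U \<Longrightarrow> U \<subseteq> V \<Longrightarrow> \<phi> \<in> test_functions V"
  by (auto simp: test_functions_iff)

lemma dderiv_eq_0_outside:
  assumes "compact K" "\<And>x. x \<notin> K \<Longrightarrow> f x = 0" "x \<notin> K"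
  shows "dderiv f v x = 0"
proof -
  have "((\<lambda>_. 0) has_derivative (\<lambda>_. 0)) (at x)" by simp
  then have "(f has_derivative (\<lambda>_. 0)) (at x)"
    by (rule has_derivative_transform_within_open[of _ _ _ UNIV "- K"])
       (use assms in \<open>auto simp: compact_imp_closed open_Compl\<close>)
  then show ?thesis by (rule has_derivative_dderiv)
qed

lemma test_functions_dderiv:
  assumes "\<phi> \<in> test_functions U" shows "dderiv \<phi> v \<in> test_functions U"
proof -
  obtain K where K: "smooth \<phi>" "compact K" "K \<subseteq> U" "\<And>x. x \<notin> K \<Longrightarrow> \<phi> x = 0"
    by (metis test_functionsE[OF assms])
  show ?thesis
    by (rule test_functionsI[OF smooth_dderiv K(2,3)]) (use K dderiv_eq_0_outside in blast)+
qed

lemma test_functions_mult: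
  assumes "\<phi> \<in> test_functions U" "smooth f" shows "(\<lambda>x. f x * \<phi> x) \<in> test_functions U"
  using assms by (auto simp: test_functions_iff smooth_mult)

lemma test_functions_bounded:
  assumes "\<phi> \<in> test_functions U" obtains C where "C \<ge> 0" "\<And>x. \<bar>\<phi> x\<bar> \<le> C"
proof -
  obtain K where K: "smooth \<phi>" "compact K" "K \<subseteq> U" "\<And>x. x \<notin> K \<Longrightarrow> \<phi> x = 0"
    by (metis test_functionsE[OF assms])
  have "bounded (\<phi> ` K)"
    by (intro compact_imp_bounded compact_continuous_image smooth_continuous K)
  then obtain C where "\<forall>x\<in>K. \<bar>\<phi> x\<bar> \<le> C" by (auto simp: bounded_iff)
  then have "\<bar>\<phi> x\<bar> \<le> max C 0" for x using K(4)[of x] by (cases "x \<in> K") auto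
  then show ?thesis using that[of "max C 0"] by auto
qed

lemma test_functions_borel: "\<phi> \<in> test_functions U \<Longrightarrow> \<phi> \<in> borel_measurable borel"
  by (simp add: smooth_borel test_functions_iff)

section \<open>The fundamental lemma of the calculus of variations\<close>

text \<open>A smooth function with values in \<open>[0, 1]\<close> that is positive exactly on the open box.\<close>

definition box_bump :: "'a::euclidean_space \<Rightarrow> 'a \<Rightarrow> 'a \<Rightarrow> real" where
  "box_bump l u x = (\<Prod>b\<in>Basis. flat_exp 0 (x \<bullet> b - l \<bullet> b) * flat_exp 0 (u \<bullet> b - x \<bullet> b))"

lemma smooth_box_bump: "smooth (box_bump l u)"
proof -
  have "smooth (\<lambda>x. \<Prod>b\<in>Basis. flat_exp 0 (b \<bullet> x + - (l \<bullet> b)) * flat_exp 0 ((- b) \<bullet> x + u \<bullet> b))"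
    by (intro smooth_prod smooth_mult smooth_flat_exp)
  moreover have "box_bump l u = (\<lambda>x. \<Prod>b\<in>Basis. flat_exp 0 (b \<bullet> x + - (l \<bullet> b)) * flat_exp 0 ((- b) \<bullet> x + u \<bullet> b))"
    by (auto simp: box_bump_def fun_eq_iff inner_commute)
  ultimately show ?thesis by metis
qed

lemma box_bump_bounds: "0 \<le> box_bump l u x" "box_bump l u x \<le> 1"
proof -
  have *: "0 \<le> flat_exp 0 t" "flat_exp 0 t \<le> 1" for t by (auto simp: flat_exp_def)
  show "0 \<le> box_bump l u x" by (auto simp: box_bump_def * intro!: prod_nonneg)
  show "box_bump l u x \<le> 1" unfolding box_bump_def
    by (intro prod_le_1) (simp add: * mult_le_one)
qed

lemma box_bump_outside: "x \<notin> box l u \<Longrightarrow> box_bump l u x = 0"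
  unfolding box_bump_def
  by (rule prod_zero) (force simp: mem_box flat_exp_def)+

lemma box_bump_inside: "x \<in> box l u \<Longrightarrow> box_bump l u x > 0"
  by (auto simp: box_bump_def mem_box flat_exp_def intro!: prod_pos)

text \<open>For \<open>\<phi> = box_bump l u\<close> the test functions \<open>1 - (1 - \<phi>) ^ n\<close> are bounded by 1 and tend to the
indicator of the open box.\<close>

lemma integral_box_eq_0_of_test_functions:
  fixes f :: "'a::euclidean_space \<Rightarrow> real"
  assumes f: "integrable lborel f"
    and test: "\<And>\<phi>. \<phi> \<in> test_functions U \<Longrightarrow> (LBINT x. f x * \<phi> x) = 0"
    and lu: "cbox l u \<subseteq> U"
  shows "(LBINT x. f x * indicator (box l u) x) = 0"
proof -
  define \<eta> where "\<eta> n x = 1 + (-1) * (1 + (-1) * box_bump l u x) ^ n" for n :: nat and x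
  have sm: "smooth (\<eta> n)" for n
    unfolding \<eta>_def[abs_def] by (intro smooth_add smooth_mult smooth_const smooth_power smooth_box_bump)
  have "\<eta> n \<in> test_functions U" for n
  proof (rule test_functionsI[OF sm compact_cbox lu])
    fix x assume "x \<notin> cbox l u"
    then have "x \<notin> box l u" using box_subset_cbox by blast
    then show "\<eta> n x = 0" by (simp add: \<eta>_def box_bump_outside)
  qed
  then have z: "(LBINT x. f x * \<eta> n x) = 0" for n by (rule test)
  have lim: "(\<lambda>n. \<eta> n x) \<longlonglongrightarrow> indicator (box l u) x" for x
  proof (cases "x \<in> box l u")
    case True
    have "norm (1 + (-1) * box_bump l u x) < 1"
      using box_bump_inside[OF True] box_bump_bounds(2)[of l u x] unfolding real_norm_def by linarith
    then have "(\<lambda>n. (1 + (-1) * box_bump l u x) ^ n) \<longlonglongrightarrow> 0" by (rule LIMSEQ_power_zero)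
    then have "(\<lambda>n. 1 + (-1) * (1 + (-1) * box_bump l u x) ^ n) \<longlonglongrightarrow> 1 + (-1) * 0"
      by (intro tendsto_add tendsto_mult tendsto_const)
    then show ?thesis using True by (simp add: \<eta>_def)
  next
    case False
    then show ?thesis by (simp add: \<eta>_def box_bump_outside)
  qed
  have bd: "\<bar>\<eta> n x\<bar> \<le> 1" for n x
  proof -
    have "0 \<le> (1 + (-1) * box_bump l u x) ^ n" "(1 + (-1) * box_bump l u x) ^ n \<le> 1"
      using box_bump_bounds[of l u x] by (auto intro!: zero_le_power power_le_one)
    then show ?thesis by (simp add: \<eta>_def)
  qed
  have [measurable]: "f \<in> borel_measurable borel" using borel_measurable_integrable[OF f] by simp
  have [measurable]: "\<eta> n \<in> borel_measurable borel" for n by (rule smooth_borel[OF sm])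
  have "(\<lambda>n. LBINT x. f x * \<eta> n x) \<longlonglongrightarrow> (LBINT x. f x * indicator (box l u) x)"
  proof (rule integral_dominated_convergence[where w = "\<lambda>x. \<bar>f x\<bar>"])
    show "AE x in lborel. norm (f x * \<eta> n x) \<le> \<bar>f x\<bar>" for n
      using mult_left_mono[OF bd] by (auto simp: abs_mult)
  qed (use f lim in \<open>auto intro!: tendsto_mult\<close>)
  then show ?thesis by (simp add: z LIMSEQ_const_iff)
qed

text \<open>Boxes are an intersection-stable generator of the Borel sets, so all integrals over Borel sets
vanish; the sets where the function is positive and where it is negative are two of them.\<close>

lemma AE_eq_0_of_box_integrals:
  fixes f :: "'a::euclidean_space \<Rightarrow> real"
  assumes f: "integrable lborel f"
    and box: "\<And>l u. (LBINT x. f x * indicator (box l u) x) = 0"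
  shows "AE x in lborel. f x = 0"
proof -
  have [measurable]: "f \<in> borel_measurable borel" using borel_measurable_integrable[OF f] by simp
  have fi: "integrable lborel (\<lambda>x. f x * indicator A x)" if "A \<in> sets borel" for A
    by (rule Bochner_Integration.integrable_bound[OF f]) (use that in \<open>auto simp: indicator_def\<close>)
  let ?E = "range (\<lambda>(a, b). box a b :: 'a set)"
  have tot: "(LBINT x. f x) = 0"
  proof -
    have "(\<lambda>n. LBINT x. f x * indicator (box (- real n *\<^sub>R One) (real n *\<^sub>R One)) x) \<longlonglongrightarrow> (LBINT x. f x)"
    proof (rule integral_dominated_convergence[where w = "\<lambda>x. \<bar>f x\<bar>"])
      show "AE x in lborel. (\<lambda>n. f x * indicator (box (- real n *\<^sub>R One) (real n *\<^sub>R One)) x) \<longlonglongrightarrow> f x"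
      proof (rule AE_I2)
        fix x :: 'a
        obtain n0 :: nat where n0: "norm x < real n0" using reals_Archimedean2 by blast
        have "eventually (\<lambda>n. f x = f x * indicator (box (- real n *\<^sub>R One) (real n *\<^sub>R One)) x) sequentially"
          using eventually_ge_at_top[of n0]
        proof eventually_elim
          case (elim n)
          have "\<bar>x \<bullet> b\<bar> < real n" if "b \<in> Basis" for b
            using Basis_le_norm[OF that, of x] n0 elim by linarith
          then have "x \<in> box (- real n *\<^sub>R One) (real n *\<^sub>R One)"
            by (auto simp: mem_box abs_less_iff minus_less_iff)
          then show ?case by simp
        qed
        then show "(\<lambda>n. f x * indicator (box (- real n *\<^sub>R One) (real n *\<^sub>R One)) x) \<longlonglongrightarrow> f x"
          by (rule tendsto_eventually[OF eventually_mono]) auto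
      qed
    qed (use f in \<open>auto simp: indicator_def\<close>)
    then show ?thesis by (simp add: box LIMSEQ_const_iff)
  qed
  have "(LBINT x. f x * indicator A x) = 0" if "A \<in> sets borel" for A
  proof -
    have "Int_stable ?E" by (auto simp: Int_stable_def box_Int_box)
    moreover have "?E \<subseteq> Pow UNIV" by simp
    moreover have "A \<in> sigma_sets UNIV ?E" using that by (simp add: borel_eq_box)
    ultimately show ?thesis
    proof (induction rule: sigma_sets_induct_disjoint)
      case (basic A) then show ?case using box by auto
    next
      case (compl A)
      then have A: "A \<in> sets borel" by (simp add: borel_eq_box)
      have "(LBINT x. f x * indicator (UNIV - A) x) = (LBINT x. f x - f x * indicator A x)"
        by (intro Bochner_Integration.integral_cong) (auto simp: indicator_def)
      also have "\<dots> = 0" using fi[OF A] f compl tot by simp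
      finally show ?case .
    next
      case (union A)
      then have A: "A i \<in> sets borel" for i by (auto simp: borel_eq_box)
      have "(\<lambda>n. LBINT x. f x * indicator (\<Union>i<n. A i) x) \<longlonglongrightarrow> (LBINT x. f x * indicator (\<Union>i. A i) x)"
      proof (rule integral_dominated_convergence[where w = "\<lambda>x. \<bar>f x\<bar>"])
        show "AE x in lborel. (\<lambda>n. f x * indicator (\<Union>i<n. A i) x) \<longlonglongrightarrow> f x * indicator (\<Union>i. A i) x"
          by (intro AE_I2 tendsto_mult tendsto_const LIMSEQ_indicator_UN)
      qed (use f A in \<open>auto simp: indicator_def\<close>)
      moreover have "(LBINT x. f x * indicator (\<Union>i<n. A i) x) = 0" for n
      proof -
        have "f x * indicator (\<Union>i<n. A i) x = (\<Sum>i<n. f x * indicator (A i) x)" for x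
          using union(1) by (subst indicator_UN_disjoint) (auto simp: sum_distrib_left disjoint_family_on_def)
        then have "(LBINT x. f x * indicator (\<Union>i<n. A i) x) = (LBINT x. (\<Sum>i<n. f x * indicator (A i) x))"
          by presburger
        also have "\<dots> = 0" using union fi[OF A] by (subst Bochner_Integration.integral_sum) auto
        finally show ?thesis .
      qed
      ultimately show ?case by (simp add: LIMSEQ_const_iff)
    qed auto
  qed note sets0 = this
  have half: "AE x in lborel. \<not> 0 < g x" if g: "integrable lborel g"
    and s: "\<And>A. A \<in> sets borel \<Longrightarrow> (LBINT x. g x * indicator A x) = 0" for g :: "'a \<Rightarrow> real"
  proof -
    have [measurable]: "g \<in> borel_measurable borel" using borel_measurable_integrable[OF g] by simp
    let ?A = "{x. 0 < g x}"
    have A: "?A \<in> sets borel" by measurable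
    have gi: "integrable lborel (\<lambda>x. g x * indicator ?A x)"
      by (rule Bochner_Integration.integrable_bound[OF g]) (auto simp: indicator_def)
    have "AE x in lborel. g x * indicator ?A x = 0"
      using integral_nonneg_eq_0_iff_AE[OF gi] s[OF A] by (auto simp: indicator_def)
    then show ?thesis by eventually_elim (auto simp: indicator_def split: if_splits)
  qed
  have "AE x in lborel. \<not> 0 < f x" by (rule half[OF f sets0])
  moreover have "AE x in lborel. \<not> 0 < - f x"
    by (rule half) (use f sets0 in auto)
  ultimately show ?thesis by eventually_elim auto
qed

lemma fundamental_lemma:
  fixes f :: "'a::euclidean_space \<Rightarrow> real"
  assumes f: "integrable lborel f" and U: "open U"
    and test: "\<And>\<phi>. \<phi> \<in> test_functions U \<Longrightarrow> (LBINT x. f x * \<phi> x) = 0"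
  shows "AE x in lborel. x \<in> U \<longrightarrow> f x = 0"
proof -
  have [measurable]: "f \<in> borel_measurable borel" using borel_measurable_integrable[OF f] by simp
  define \<F> where "\<F> = {box l u | l u. cbox l u \<subseteq> U}"
  have loc: "AE x in lborel. x \<in> B \<longrightarrow> f x = 0" if B: "B \<in> \<F>" for B
  proof -
    obtain l u where lu: "B = box l u" "cbox l u \<subseteq> U" using B by (auto simp: \<F>_def)
    have "AE x in lborel. f x * indicator (box l u) x = 0"
    proof (rule AE_eq_0_of_box_integrals)
      show "integrable lborel (\<lambda>x. f x * indicator (box l u) x)"
        by (rule Bochner_Integration.integrable_bound[OF f]) (auto simp: indicator_def)
      fix l' u'
      obtain a b where ab: "box l u \<inter> box l' u' = box a b" "cbox a b \<subseteq> cbox l u \<or> box a b = {}"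
      proof -
        let ?a = "(\<Sum>i\<in>Basis. max (l\<bullet>i) (l'\<bullet>i) *\<^sub>R i)" and ?b = "(\<Sum>i\<in>Basis. min (u\<bullet>i) (u'\<bullet>i) *\<^sub>R i)"
        have "cbox ?a ?b \<subseteq> cbox l u" by (auto simp: mem_box)
        then show ?thesis using that[of ?a ?b] by (simp add: box_Int_box)
      qed
      have "(LBINT x. f x * indicator (box a b) x) = 0"
      proof (cases "box a b = {}")
        case False
        then show ?thesis using ab lu integral_box_eq_0_of_test_functions[OF f test] by blast
      qed simp
      then show "(LBINT x. f x * indicator (box l u) x * indicator (box l' u') x) = 0"
        by (simp add: ab(1)[symmetric] indicator_inter_arith mult.assoc)
    qed
    then show ?thesis by eventually_elim (auto simp: lu)
  qed
  obtain \<F>' where F': "\<F>' \<subseteq> \<F>" "countable \<F>'" "\<Union>\<F>' = \<Union>\<F>"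
    by (rule Lindelof[of \<F>]) (auto simp: \<F>_def)
  have "U \<subseteq> \<Union>\<F>"
  proof
    fix x assume "x \<in> U"
    then obtain e where e: "e > 0" "ball x e \<subseteq> U" using U openE by blast
    obtain a b where "cbox a b \<subseteq> ball x e" "x \<in> box a b"
      by (metis open_contains_cbox open_ball centre_in_ball e(1))
    then have "x \<in> box a b" "box a b \<in> \<F>" using e(2) by (auto simp: \<F>_def)
    then show "x \<in> \<Union>\<F>" by blast
  qed
  moreover have "AE x in lborel. \<forall>B\<in>\<F>'. x \<in> B \<longrightarrow> f x = 0"
    using F' loc by (subst AE_ball_countable) auto
  ultimately show ?thesis using F'(3) by (elim eventually_mono) blast
qed

lemma dderiv_bound:
  assumes "\<phi> \<in> test_functions U"
  obtains C where "C \<ge> 0" "\<And>x v. \<bar>dderiv \<phi> v x\<bar> \<le> C * norm v"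
proof -
  have sm: "smooth \<phi>" using assms by (simp add: test_functions_iff)
  have "\<exists>C\<ge>0. \<forall>x. \<bar>dderiv \<phi> b x\<bar> \<le> C" for b
    using test_functions_bounded[OF test_functions_dderiv[OF assms, of b]] by metis
  then obtain c where c: "\<And>b. c b \<ge> 0" "\<And>b x. \<bar>dderiv \<phi> b x\<bar> \<le> c b" by metis
  have "\<bar>dderiv \<phi> v x\<bar> \<le> (\<Sum>b\<in>Basis. c b) * norm v" for x v
  proof -
    have "dderiv \<phi> v x = (\<Sum>b\<in>Basis. (v \<bullet> b) * dderiv \<phi> b x)" by (rule dderiv_basis[OF sm])
    also have "\<bar>\<dots>\<bar> \<le> (\<Sum>b\<in>Basis. \<bar>(v \<bullet> b) * dderiv \<phi> b x\<bar>)" by (rule sum_abs)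
    also have "\<dots> \<le> (\<Sum>b\<in>Basis. c b * norm v)"
      unfolding abs_mult using c
      by (intro sum_mono) (subst mult.commute, intro mult_mono, auto simp: Basis_le_norm)
    finally show ?thesis by (simp add: sum_distrib_right)
  qed
  moreover have "(\<Sum>b\<in>Basis. c b) \<ge> 0" using c by (simp add: sum_nonneg)
  ultimately show ?thesis using that by blast
qed

lemma test_functions_lipschitz:
  assumes "\<phi> \<in> test_functions U"
  obtains C where "C \<ge> 0" "\<And>x y. \<bar>\<phi> x - \<phi> y\<bar> \<le> C * norm (x - y)"
proof -
  obtain C where C: "C \<ge> 0" "\<And>x v. \<bar>dderiv \<phi> v x\<bar> \<le> C * norm v"
    using dderiv_bound[OF assms] by metis
  have "norm (\<phi> x - \<phi> y) \<le> C * norm (x - y)" for x y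
  proof (rule differentiable_bound[of UNIV])
    show "(\<phi> has_derivative frechet_derivative \<phi> (at x)) (at x within UNIV)" for x
      using assms by (simp add: test_functions_iff smooth_has_derivative)
    show "onorm (frechet_derivative \<phi> (at x)) \<le> C" for x
      using C by (intro onorm_le) auto
  qed auto
  then show ?thesis using that C(1) by auto
qed

lemma integrable_bounded_support:
  fixes f :: "'a::euclidean_space \<Rightarrow> real"
  assumes "f \<in> borel_measurable borel" "bounded B" "\<And>x. \<bar>f x\<bar> \<le> C" "\<And>x. x \<notin> B \<Longrightarrow> f x = 0"
  shows "integrable lborel f"
proof -
  obtain a where a: "B \<subseteq> cbox (-a) a" using bounded_subset_cbox_symmetric[OF assms(2)] by blast
  show ?thesis
  proof (rule Bochner_Integration.integrable_bound)
    show "integrable lborel (\<lambda>x. C * indicator (cbox (-a) a) x :: real)"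
      by (intro integrable_mult_right integrable_real_indicator)
         (use emeasure_lborel_cbox_finite[of "-a" a] in \<open>auto simp: infinity_ennreal_def\<close>)
    show "AE x in lborel. norm (f x) \<le> norm (C * indicator (cbox (-a) a) x)"
    proof (rule AE_I2)
      fix x show "norm (f x) \<le> norm (C * indicator (cbox (-a) a) x)"
        using assms(3)[of x] assms(4)[of x] a by (cases "x \<in> cbox (-a) a") auto
    qed
  qed (use assms in auto)
qed

section \<open>Weak derivatives along affine flows\<close>

text \<open>The class in which all weak equations are tested. The function vanishes off \<open>B\<close>, so integrals
may be taken over the whole space, where changes of variables are available.\<close>

definition bounded_borel_on :: "'a::euclidean_space set \<Rightarrow> ('a \<Rightarrow> real) \<Rightarrow> bool" where
  "bounded_borel_on B f \<longleftrightarrow> f \<in> borel_measurable borel \<and> bounded B \<and>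
     (\<exists>C. \<forall>x. \<bar>f x\<bar> \<le> C) \<and> (\<forall>x. x \<notin> B \<longrightarrow> f x = 0)"

lemma bounded_borel_on_borel: "bounded_borel_on B f \<Longrightarrow> f \<in> borel_measurable borel"
  and bounded_borel_on_bounded: "bounded_borel_on B f \<Longrightarrow> bounded B"
  and bounded_borel_on_outside: "bounded_borel_on B f \<Longrightarrow> x \<notin> B \<Longrightarrow> f x = 0"
  by (auto simp: bounded_borel_on_def)

lemma bounded_borel_onE:
  assumes "bounded_borel_on B f" obtains C where "C \<ge> 0" "\<And>x. \<bar>f x\<bar> \<le> C"
  using assms unfolding bounded_borel_on_def by (metis abs_ge_zero order_trans)

lemma bounded_borel_on_integrable: "bounded_borel_on B f \<Longrightarrow> integrable lborel f"
  unfolding bounded_borel_on_def by (metis integrable_bounded_support)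

text \<open>One-parameter groups of affine maps with their generating vector field. Affine maps carry test
functions to test functions, and \<open>speed\<close> is the uniform Lipschitz bound in time that dominates
difference quotients. Translations, rotations and dilations are the instances.\<close>

locale affine_flow =
  fixes M :: "real \<Rightarrow> 'a::euclidean_space \<Rightarrow> 'a" and X :: "'a \<Rightarrow> 'a"
  assumes affine: "\<exists>L k. linear L \<and> M t = (\<lambda>x. L x + k)"
    and group: "M (s + t) x = M s (M t x)"
    and zero: "M 0 x = x"
    and generator: "((\<lambda>t. M t x) has_vector_derivative X x) (at 0)"
    and speed: "bounded S \<Longrightarrow> \<exists>C\<ge>0. \<forall>x\<in>S. \<forall>t. \<bar>t\<bar> \<le> 1 \<longrightarrow> norm (M t x - x) \<le> C * \<bar>t\<bar>"
begin

lemma smooth_flow: "smooth \<phi> \<Longrightarrow> smooth (\<lambda>x. \<phi> (M t x))"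
  using affine[of t] smooth_affine_compose[of \<phi>] by auto

lemma continuous_flow: "continuous_on S (M t)"
proof -
  obtain L k where L: "linear L" "M t = (\<lambda>x. L x + k)" using affine by blast
  show ?thesis unfolding L(2)
    by (intro continuous_on_add continuous_on_const linear_continuous_on linear_conv_bounded_linear[THEN iffD1] L(1))
qed

lemma borel_flow [measurable]: "M t \<in> borel_measurable borel"
  by (intro borel_measurable_continuous_onI continuous_flow)

lemma flow_inverse: "M t (M (- t) x) = x" "M (- t) (M t x) = x"
  using group[of t "- t" x] group[of "- t" t x] zero by auto

lemma test_functions_flow:
  assumes "smooth \<phi>" "compact K" "\<And>x. x \<notin> K \<Longrightarrow> \<phi> x = 0" "M (- t) ` K \<subseteq> U"
  shows "(\<lambda>x. \<phi> (M t x)) \<in> test_functions U"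
proof (rule test_functionsI[OF smooth_flow[OF assms(1)] _ assms(4)])
  show "compact (M (- t) ` K)" by (intro compact_continuous_image continuous_flow assms)
  fix x assume "x \<notin> M (- t) ` K"
  then have "M t x \<notin> K" using flow_inverse(2)[of t x] by (metis imageI)
  then show "\<phi> (M t x) = 0" by (rule assms(3))
qed

text \<open>The derivative at time 0 suffices everywhere, since the group law reduces any other time to it.\<close>

lemma flow_chain_rule:
  assumes "smooth \<phi>"
  shows "((\<lambda>t. \<phi> (M t x)) has_real_derivative dderiv \<phi> (X x) x) (at 0)"
proof -
  have "((\<lambda>t. M t x) has_derivative (\<lambda>h. h *\<^sub>R X x)) (at 0)"
    using generator[of x] by (simp add: has_vector_derivative_def)
  from has_derivative_compose[OF this smooth_has_derivative[OF assms, of "M 0 x"]]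
  have "((\<lambda>t. \<phi> (M t x)) has_derivative (\<lambda>h. dderiv \<phi> (h *\<^sub>R X x) x)) (at 0)"
    by (simp add: zero)
  then show ?thesis
    by (simp add: has_field_derivative_def linear_scale[OF smooth_dderiv_linear[OF assms]] mult_commute_abs)
qed

text \<open>Differentiation under the integral sign. The function \<open>f\<close> is only bounded and measurable, so all
regularity is taken from the test function: its Lipschitz constant dominates the difference
quotients.\<close>

lemma flow_integral_derivative_0:
  assumes f: "bounded_borel_on S f"
    and \<phi>: "\<phi> \<in> test_functions U"
  shows "((\<lambda>t. LBINT x. f x * \<phi> (M t x)) has_real_derivative
           (LBINT x. f x * dderiv \<phi> (X x) x)) (at 0)"
proof -
  note f'[measurable] = bounded_borel_on_borel[OF f]
  obtain C where C: "C \<ge> 0" "\<And>x. \<bar>f x\<bar> \<le> C" using bounded_borel_onE[OF f] by metis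
  note fS = bounded_borel_on_outside[OF f] bounded_borel_on_bounded[OF f]
  have sm: "smooth \<phi>" using \<phi> by (simp add: test_functions_iff)
  have [measurable]: "\<phi> \<in> borel_measurable borel" by (rule smooth_borel[OF sm])
  obtain L where L: "L \<ge> 0" "\<And>x y. \<bar>\<phi> x - \<phi> y\<bar> \<le> L * norm (x - y)"
    using test_functions_lipschitz[OF \<phi>] by metis
  obtain B where B: "B \<ge> 0" "\<And>x. \<bar>\<phi> x\<bar> \<le> B"
    using test_functions_bounded[OF \<phi>] by metis
  obtain D where D: "D \<ge> 0" "\<And>x t. x \<in> S \<Longrightarrow> \<bar>t\<bar> \<le> 1 \<Longrightarrow> norm (M t x - x) \<le> D * \<bar>t\<bar>"
    using speed[OF fS(2)] by metis
  have int: "integrable lborel (\<lambda>x. f x * \<phi> (M t x))" for t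
    by (rule integrable_bounded_support[OF _ fS(2), of _ "C * B"])
       (use fS B C in \<open>auto simp: abs_mult intro!: mult_mono\<close>)
  have fi: "integrable lborel (\<lambda>x. \<bar>f x\<bar> * (L * D))"
    by (rule integrable_bounded_support[OF _ fS(2), of _ "C * (L * D)"])
       (use fS L D C in \<open>auto simp: abs_mult intro!: mult_right_mono\<close>)
  have "((\<lambda>t. ((LBINT x. f x * \<phi> (M t x)) - (LBINT x. f x * \<phi> (M 0 x))) / (t - 0))
          \<longlongrightarrow> (LBINT x. f x * dderiv \<phi> (X x) x)) (at 0)"
    unfolding tendsto_at_iff_sequentially comp_def
  proof (intro allI impI)
    fix s :: "nat \<Rightarrow> real" assume s: "\<forall>i. s i \<in> UNIV - {0}" "s \<longlonglongrightarrow> 0"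
    have lim: "(\<lambda>n. f x * ((\<phi> (M (s n) x) - \<phi> x) / s n)) \<longlonglongrightarrow> f x * dderiv \<phi> (X x) x" for x
    proof -
      have "((\<lambda>t. (\<phi> (M t x) - \<phi> (M 0 x)) / (t - 0)) \<longlongrightarrow> dderiv \<phi> (X x) x) (at 0)"
        using flow_chain_rule[OF sm, of x] unfolding has_field_derivative_iff by simp
      then have "(\<lambda>n. (\<phi> (M (s n) x) - \<phi> (M 0 x)) / (s n - 0)) \<longlonglongrightarrow> dderiv \<phi> (X x) x"
        using s unfolding tendsto_at_iff_sequentially comp_def by blast
      then show ?thesis by (intro tendsto_mult tendsto_const) (simp add: zero)
    qed
    have "eventually (\<lambda>n. \<bar>s n\<bar> < 1) sequentially"
      using tendstoD[OF s(2), of 1] by simp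
    then obtain n0 where n0: "\<And>n. n \<ge> n0 \<Longrightarrow> \<bar>s n\<bar> < 1" by (auto simp: eventually_sequentially)
    have [measurable]: "(\<lambda>x. f x * dderiv \<phi> (X x) x) \<in> borel_measurable borel"
      by (rule borel_measurable_LIMSEQ_real[OF lim]) measurable
    have "(\<lambda>n. LBINT x. f x * ((\<phi> (M (s (n + n0)) x) - \<phi> x) / s (n + n0))) \<longlonglongrightarrow> (LBINT x. f x * dderiv \<phi> (X x) x)"
    proof (rule integral_dominated_convergence[OF _ _ fi])
      show "AE x in lborel. (\<lambda>n. f x * ((\<phi> (M (s (n + n0)) x) - \<phi> x) / s (n + n0))) \<longlonglongrightarrow> f x * dderiv \<phi> (X x) x"
        using LIMSEQ_ignore_initial_segment[OF lim] by (intro AE_I2)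
      fix n
      show "AE x in lborel. norm (f x * ((\<phi> (M (s (n + n0)) x) - \<phi> x) / s (n + n0))) \<le> \<bar>f x\<bar> * (L * D)"
      proof (rule AE_I2)
        fix x
        show "norm (f x * ((\<phi> (M (s (n + n0)) x) - \<phi> x) / s (n + n0))) \<le> \<bar>f x\<bar> * (L * D)"
        proof (cases "x \<in> S")
          case True
          let ?s = "s (n + n0)"
          have "\<bar>\<phi> (M ?s x) - \<phi> x\<bar> \<le> L * norm (M ?s x - x)" by (rule L(2))
          also have "\<dots> \<le> L * (D * \<bar>?s\<bar>)"
            using n0[of "n + n0"] by (intro mult_left_mono L(1) D(2) True) auto
          finally have "\<bar>\<phi> (M ?s x) - \<phi> x\<bar> \<le> L * (D * \<bar>?s\<bar>)" .
          then have "\<bar>(\<phi> (M ?s x) - \<phi> x) / ?s\<bar> \<le> L * D"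
            using s(1) by (simp add: abs_divide divide_le_eq mult.assoc)
          from mult_left_mono[OF this, of "\<bar>f x\<bar>"] show ?thesis by (simp only: real_norm_def abs_mult abs_ge_zero)
        qed (simp add: fS)
      qed
    qed measurable
    then have "(\<lambda>n. LBINT x. f x * ((\<phi> (M (s n) x) - \<phi> x) / s n)) \<longlonglongrightarrow> (LBINT x. f x * dderiv \<phi> (X x) x)"
      by (rule LIMSEQ_offset)
    moreover have eq: "((LBINT x. f x * \<phi> (M (s n) x)) - (LBINT x. f x * \<phi> (M 0 x))) / (s n - 0)
        = (LBINT x. f x * ((\<phi> (M (s n) x) - \<phi> x) / s n))" for n
    proof -
      have eq: "(\<lambda>x. f x * ((\<phi> (M (s n) x) - \<phi> x) / s n)) = (\<lambda>x. (f x * \<phi> (M (s n) x) - f x * \<phi> (M 0 x)) / s n)"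
        by (simp add: zero right_diff_distrib)
      show ?thesis
        unfolding eq integral_divide_zero Bochner_Integration.integral_diff[OF int int] diff_zero ..
    qed
    ultimately show "(\<lambda>n. ((LBINT x. f x * \<phi> (M (s n) x)) - (LBINT x. f x * \<phi> (M 0 x))) / (s n - 0))
        \<longlonglongrightarrow> (LBINT x. f x * dderiv \<phi> (X x) x)" by (simp only: eq)
  qed
  then show ?thesis unfolding has_field_derivative_iff by simp
qed

lemma flow_integral_derivative:
  assumes f: "bounded_borel_on S f"
    and \<phi>: "\<phi> \<in> test_functions U"
  shows "((\<lambda>t. LBINT x. f x * \<phi> (M t x)) has_real_derivative
           (LBINT x. f x * dderiv (\<lambda>y. \<phi> (M t y)) (X x) x)) (at t)"
proof -
  obtain K where K: "smooth \<phi>" "compact K" "K \<subseteq> U" "\<And>x. x \<notin> K \<Longrightarrow> \<phi> x = 0"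
    using test_functionsE[OF \<phi>] by metis
  have \<phi>t: "(\<lambda>x. \<phi> (M t x)) \<in> test_functions UNIV" by (rule test_functions_flow[OF K(1,2)]) (auto simp: K(4))
  have eq: "M t (M s x) = M (s + t) x" for s x using group[of t s x] by (metis add.commute)
  from flow_integral_derivative_0[OF f \<phi>t]
  have "((\<lambda>s. LBINT x. f x * \<phi> (M (s + t) x)) has_real_derivative
           (LBINT x. f x * dderiv (\<lambda>y. \<phi> (M t y)) (X x) x)) (at 0)"
    by (simp only: eq)
  then show ?thesis using DERIV_shift[of "\<lambda>t. LBINT x. f x * \<phi> (M t x)" _ 0 t] by simp
qed

end

locale measure_preserving_affine_flow = affine_flow +
  assumes preserve: "distr lborel borel (M t) = lborel"
begin

lemma integral_flow:
  assumes [measurable]: "g \<in> borel_measurable borel"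
  shows "(LBINT x. g (M t x)) = (LBINT x. g x :: real)"
  using integral_distr[of "M t" lborel borel g] by (simp add: preserve)

lemma integrable_flow:
  assumes g: "integrable lborel g"
  shows "integrable lborel (\<lambda>x. g (M t x) :: real)"
proof -
  have [measurable]: "g \<in> borel_measurable borel" using borel_measurable_integrable[OF g] by simp
  show ?thesis using integrable_distr_eq[of "M t" lborel borel g] g by (simp add: preserve)
qed

text \<open>If the derivative of \<open>h\<close> along the generator vanishes weakly, then \<open>t \<mapsto> \<integral> h (\<phi> \<circ> M t)\<close> is
constant as long as the supports stay in \<open>B\<close>; a change of variables and the fundamental lemma
turn this into pointwise invariance.\<close>

lemma flow_invariant_AE:
  assumes h: "bounded_borel_on B h"
    and weak: "\<forall>\<eta>\<in>test_functions B. (LBINT x. h x * dderiv \<eta> (X x) x) = 0"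
    and V: "open V" "\<forall>t\<in>closed_segment 0 T. M t ` V \<subseteq> B"
  shows "AE x in lborel. x \<in> V \<longrightarrow> h (M T x) = h x"
proof -
  note h'[measurable] = bounded_borel_on_borel[OF h]
  have hi: "integrable lborel h" by (rule bounded_borel_on_integrable[OF h])
  have "AE x in lborel. x \<in> V \<longrightarrow> h (M T x) - h x = 0"
  proof (rule fundamental_lemma[OF _ V(1)])
    show "integrable lborel (\<lambda>x. h (M T x) - h x)"
      by (intro Bochner_Integration.integrable_diff integrable_flow hi)
    fix \<phi> assume \<phi>: "\<phi> \<in> test_functions V"
    obtain K where K: "smooth \<phi>" "compact K" "K \<subseteq> V" "\<And>x. x \<notin> K \<Longrightarrow> \<phi> x = 0"
      using test_functionsE[OF \<phi>] by metis
    have [measurable]: "\<phi> \<in> borel_measurable borel" by (rule smooth_borel[OF K(1)])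
    obtain c where c: "\<And>x. \<bar>\<phi> x\<bar> \<le> c" using test_functions_bounded[OF \<phi>] by metis
    define F where "F t = (LBINT x. h x * \<phi> (M t x))" for t
    have "(F has_real_derivative 0) (at t within closed_segment 0 (- T))" if "t \<in> closed_segment 0 (- T)" for t
    proof -
      have "- t \<in> closed_segment 0 T" using that by (auto simp: closed_segment_eq_real_ivl split: if_splits)
      then have "M (- t) ` K \<subseteq> B" using V(2) K(3) by blast
      then have "(\<lambda>x. \<phi> (M t x)) \<in> test_functions B" by (intro test_functions_flow[OF K(1,2)]) (auto simp: K(4))
      from weak[rule_format, OF this] flow_integral_derivative[OF h \<phi>, of t]
      show ?thesis unfolding F_def[abs_def] by (auto intro: has_field_derivative_at_within)
    qed
    then obtain k where "\<And>t. t \<in> closed_segment 0 (- T) \<Longrightarrow> F t = k"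
      using has_field_derivative_zero_constant[of "closed_segment 0 (- T)" F] by auto
    then have "F (- T) = F 0" by simp
    moreover have "F (- T) = (LBINT x. h (M T x) * \<phi> x)"
      unfolding F_def using integral_flow[of "\<lambda>x. h x * \<phi> (M (- T) x)" T] by (simp add: flow_inverse)
    moreover have "F 0 = (LBINT x. h x * \<phi> x)" by (simp add: F_def zero)
    moreover have gi: "integrable lborel (\<lambda>x. g x * \<phi> x)" if g: "integrable lborel g" for g
    proof (rule Bochner_Integration.integrable_bound)
      show "integrable lborel (\<lambda>x. \<bar>g x\<bar> * c)" using g by simp
      show "(\<lambda>x. g x * \<phi> x) \<in> borel_measurable lborel" using borel_measurable_integrable[OF g] by simp
      show "AE x in lborel. norm (g x * \<phi> x) \<le> norm (\<bar>g x\<bar> * c)"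
      proof (rule AE_I2)
        fix x show "norm (g x * \<phi> x) \<le> norm (\<bar>g x\<bar> * c)"
          using mult_left_mono[OF order_trans[OF c abs_ge_self], of "\<bar>g x\<bar>" x] by (simp add: abs_mult)
      qed
    qed
    moreover have "(LBINT x. (h (M T x) - h x) * \<phi> x) = (LBINT x. h (M T x) * \<phi> x) - (LBINT x. h x * \<phi> x)"
      unfolding left_diff_distrib
      by (rule Bochner_Integration.integral_diff[OF gi[OF integrable_flow[OF hi]] gi[OF hi]])
    ultimately show "(LBINT x. (h (M T x) - h x) * \<phi> x) = 0" by linarith
  qed
  then show ?thesis by simp
qed

lemma flow_stays_near_compact:
  assumes "open B" "compact S" "S \<subseteq> B"
  obtains V \<delta> where "open V" "S \<subseteq> V" "\<delta> > 0" "\<And>t. \<bar>t\<bar> \<le> \<delta> \<Longrightarrow> M t ` V \<subseteq> B"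
proof -
  obtain e where e: "e > 0" "(\<Union>x\<in>S. cball x e) \<subseteq> B"
    using compact_subset_open_imp_cball_epsilon_subset[OF assms(2,1,3)] by metis
  define V where "V = (\<Union>x\<in>S. ball x (e / 2))"
  have "V \<subseteq> (\<Union>x\<in>S. \<Union>y\<in>cball 0 e. {x + y})"
  proof
    fix y assume "y \<in> V"
    then obtain x where "x \<in> S" "dist x y < e / 2" by (auto simp: V_def)
    then show "y \<in> (\<Union>x\<in>S. \<Union>y\<in>cball 0 e. {x + y})"
      using e(1) by (intro UN_I[of x] UN_I[of "y - x"]) (auto simp: dist_norm norm_minus_commute)
  qed
  moreover have "bounded (\<Union>x\<in>S. \<Union>y\<in>cball 0 e. {x + y})"
    by (intro bounded_sums compact_imp_bounded assms bounded_cball)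
  ultimately have "bounded V" using bounded_subset by blast
  from speed[OF this] obtain C where C: "C \<ge> 0" "\<And>x t. x \<in> V \<Longrightarrow> \<bar>t\<bar> \<le> 1 \<Longrightarrow> norm (M t x - x) \<le> C * \<bar>t\<bar>"
    by blast
  define \<delta> where "\<delta> = min 1 (e / (2 * (C + 1)))"
  show ?thesis
  proof
    show "open V" "S \<subseteq> V" using e(1) by (auto simp: V_def)
    show "\<delta> > 0" using e(1) C(1) by (auto simp: \<delta>_def)
    fix t assume t: "\<bar>t\<bar> \<le> \<delta>"
    show "M t ` V \<subseteq> B"
    proof (rule image_subsetI)
      fix y assume y: "y \<in> V"
      then obtain x where x: "x \<in> S" "dist x y < e / 2" by (auto simp: V_def)
      have "norm (M t y - y) \<le> C * \<bar>t\<bar>" using C(2)[OF y] t by (simp add: \<delta>_def)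
      also have "\<dots> \<le> (C + 1) * (e / (2 * (C + 1)))"
        using t C(1) by (intro mult_mono) (auto simp: \<delta>_def)
      also have "\<dots> = e / 2" using C(1) by (simp add: field_simps)
      finally have "dist (M t y) y \<le> e / 2" by (simp add: dist_norm)
      then have "dist x (M t y) \<le> e" using x(2) dist_triangle2[of x "M t y" y] by linarith
      then have "M t y \<in> cball x e" by simp
      then show "M t y \<in> B" using e(2) x(1) by blast
    qed
  qed
qed

text \<open>Near a compact subset of \<open>B\<close> the flow stays in \<open>B\<close> for a short time that does not depend on the
point.\<close>

lemma flow_invariant_near_compact:
  assumes h: "bounded_borel_on B h"
    and weak: "\<forall>\<eta>\<in>test_functions B. (LBINT x. h x * dderiv \<eta> (X x) x) = 0"
    and S: "open B" "compact S" "S \<subseteq> B"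
  shows "\<exists>V \<delta>. open V \<and> S \<subseteq> V \<and> \<delta> > 0 \<and>
    (\<forall>t. \<bar>t\<bar> \<le> \<delta> \<longrightarrow> (AE x in lborel. x \<in> V \<longrightarrow> x \<in> B \<and> M t x \<in> B \<and> h (M t x) = h x))"
proof -
  obtain V \<delta> where V: "open V" "S \<subseteq> V" "\<delta> > 0" "\<And>t. \<bar>t\<bar> \<le> \<delta> \<Longrightarrow> M t ` V \<subseteq> B"
    using flow_stays_near_compact[OF S] by blast
  have "M 0 ` V \<subseteq> B" using V(3) by (intro V(4)) simp
  then have "V \<subseteq> B" by (simp add: zero)
  have "AE x in lborel. x \<in> V \<longrightarrow> x \<in> B \<and> M t x \<in> B \<and> h (M t x) = h x" if t: "\<bar>t\<bar> \<le> \<delta>" for t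
  proof -
    have "\<forall>s\<in>closed_segment 0 t. M s ` V \<subseteq> B"
      using t by (intro ballI V(4)) (auto simp: closed_segment_eq_real_ivl split: if_splits)
    from flow_invariant_AE[OF h weak V(1) this] show ?thesis
      by eventually_elim (use V(4)[OF t] \<open>V \<subseteq> B\<close> in blast)
  qed
  then show ?thesis using V(1-3) by (intro exI[of _ V] exI[of _ \<delta>]) simp
qed

text \<open>Functions of \<open>h\<close> and of invariants of the flow inherit the weak equation. There is no chain rule
for weak derivatives of merely bounded functions; the way around is to pass to almost everywhere
invariance and back.\<close>

lemma flow_invariant_weak_derivative:
  assumes h: "bounded_borel_on B h"
    and weak: "\<forall>\<eta>\<in>test_functions B. (LBINT x. h x * dderiv \<eta> (X x) x) = 0"
    and B: "open B"
    and G: "bounded_borel_on B G"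
    and Gh: "\<And>x t. x \<in> B \<Longrightarrow> M t x \<in> B \<Longrightarrow> h (M t x) = h x \<Longrightarrow> G (M t x) = G x"
    and \<phi>: "\<phi> \<in> test_functions B"
  shows "(LBINT x. G x * dderiv \<phi> (X x) x) = 0"
proof -
  obtain K where K: "smooth \<phi>" "compact K" "K \<subseteq> B" "\<And>x. x \<notin> K \<Longrightarrow> \<phi> x = 0"
    using test_functionsE[OF \<phi>] by metis
  note G'[measurable] = bounded_borel_on_borel[OF G]
  have [measurable]: "\<phi> \<in> borel_measurable borel" by (rule smooth_borel[OF K(1)])
  obtain V \<delta> where V: "open V" "K \<subseteq> V" "\<delta> > 0" "\<forall>t. \<bar>t\<bar> \<le> \<delta> \<longrightarrow>
      (AE x in lborel. x \<in> V \<longrightarrow> x \<in> B \<and> M t x \<in> B \<and> h (M t x) = h x)"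
    using flow_invariant_near_compact[OF h weak B K(2,3)] by (elim exE conjE)
  define F where "F t = (LBINT x. G x * \<phi> (M t x))" for t
  have "F t = F 0" if t: "\<bar>t\<bar> \<le> \<delta>" for t
  proof -
    have "F t = (LBINT x. G (M (- t) x) * \<phi> x)"
      unfolding F_def using integral_flow[of "\<lambda>x. G x * \<phi> (M t x)" "- t"] by (simp add: flow_inverse)
    also have "\<dots> = (LBINT x. G x * \<phi> x)"
    proof (rule integral_cong_AE)
      have "AE x in lborel. x \<in> V \<longrightarrow> x \<in> B \<and> M (- t) x \<in> B \<and> h (M (- t) x) = h x"
        by (rule V(4)[THEN spec, THEN mp]) (use t in simp)
      then show "AE x in lborel. G (M (- t) x) * \<phi> x = G x * \<phi> x"
      proof (rule eventually_mono)
        fix x assume x: "x \<in> V \<longrightarrow> x \<in> B \<and> M (- t) x \<in> B \<and> h (M (- t) x) = h x"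
        show "G (M (- t) x) * \<phi> x = G x * \<phi> x"
        proof (cases "x \<in> K")
          case True
          then have xV: "x \<in> B" "M (- t) x \<in> B" "h (M (- t) x) = h x" using x V(2) by blast+
          show ?thesis by (simp only: Gh[OF xV])
        next
          case False
          have "\<phi> x = 0" by (rule K(4)[OF False])
          then show ?thesis by (simp only: mult_zero_right)
        qed
      qed
    qed measurable
    finally show ?thesis unfolding F_def zero .
  qed
  then have const: "\<forall>t. \<bar>0 - t\<bar> < \<delta> \<longrightarrow> F 0 = F t" by (metis abs_minus_cancel diff_0 less_imp_le)
  have "(F has_real_derivative (LBINT x. G x * dderiv \<phi> (X x) x)) (at 0)"
    unfolding F_def[abs_def] by (rule flow_integral_derivative_0[OF G \<phi>])
  from DERIV_local_const[OF this V(3) const] show ?thesis .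
qed

end

section \<open>A weak Poincare lemma\<close>

lemma lborel_distr_translation: "distr lborel borel (\<lambda>x. x + v) = (lborel :: 'a::euclidean_space measure)"
proof -
  have "(\<lambda>x. x + v) = (+) v" by (auto simp: add.commute)
  then show ?thesis using lborel_distr_plus[of v] by simp
qed

lemma translation_flow:
  "measure_preserving_affine_flow (\<lambda>t x. x + t *\<^sub>R v) (\<lambda>x::'a::euclidean_space. v)"
proof
  fix t s :: real and x :: 'a and S :: "'a set"
  show "\<exists>L k. linear L \<and> (\<lambda>x. x + t *\<^sub>R v) = (\<lambda>x. L x + k)"
    by (rule exI[of _ "\<lambda>x. x"], rule exI[of _ "t *\<^sub>R v"]) (simp add: linear_iff)
  show "((\<lambda>t. x + t *\<^sub>R v) has_vector_derivative v) (at 0)"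
    unfolding has_vector_derivative_def by (auto intro!: derivative_eq_intros)
  show "\<exists>C\<ge>0. \<forall>x\<in>S. \<forall>t. \<bar>t\<bar> \<le> 1 \<longrightarrow> norm (x + t *\<^sub>R v - x) \<le> C * \<bar>t\<bar>"
    by (rule exI[of _ "norm v"]) (auto simp: mult.commute)
  show "distr lborel borel (\<lambda>x. x + t *\<^sub>R v) = lborel" by (rule lborel_distr_translation)
qed (simp_all add: scaleR_left_distrib)

lemma dilation_flow:
  "affine_flow (\<lambda>s x. c + exp s *\<^sub>R (x - c)) (\<lambda>x::'a::euclidean_space. x - c)"
proof
  fix t s :: real and x :: 'a and S :: "'a set"
  show "\<exists>L k. linear L \<and> (\<lambda>x. c + exp t *\<^sub>R (x - c)) = (\<lambda>x. L x + k)"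
    by (rule exI[of _ "\<lambda>x. exp t *\<^sub>R x"], rule exI[of _ "c - exp t *\<^sub>R c"])
       (auto simp: linear_iff algebra_simps)
  show "((\<lambda>s. c + exp s *\<^sub>R (x - c)) has_vector_derivative (x - c)) (at 0)"
    unfolding has_vector_derivative_def by (auto intro!: derivative_eq_intros)
  assume "bounded S"
  then obtain R where R: "\<And>x. x \<in> S \<Longrightarrow> norm x \<le> R" by (auto simp: bounded_iff)
  have "norm (c + exp t *\<^sub>R (x - c) - x) \<le> (3 * (\<bar>R\<bar> + norm c)) * \<bar>t\<bar>" if "x \<in> S" "\<bar>t\<bar> \<le> 1" for x t
  proof -
    have e: "\<bar>exp t - 1\<bar> \<le> 3 * \<bar>t\<bar>"
    proof (cases "t \<ge> 0")
      case True
      then have "exp t \<le> 1 + t + t\<^sup>2" using that(2) by (intro exp_bound) auto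
      moreover have "t\<^sup>2 \<le> t" using True that(2) by (simp add: power2_eq_square mult_left_le_one_le)
      moreover have "exp t \<ge> 1" using True by simp
      ultimately show ?thesis using True by simp
    next
      case False
      then have "exp t < 1" by simp
      then show ?thesis using exp_ge_add_one_self[of t] False by linarith
    qed
    have "c + exp t *\<^sub>R (x - c) - x = (exp t - 1) *\<^sub>R (x - c)" by (simp add: algebra_simps)
    then have "norm (c + exp t *\<^sub>R (x - c) - x) = \<bar>exp t - 1\<bar> * norm (x - c)" by simp
    also have "\<dots> \<le> (3 * \<bar>t\<bar>) * (\<bar>R\<bar> + norm c)"
      using e R[OF that(1)] norm_triangle_ineq4[of x c] by (intro mult_mono) auto
    finally show ?thesis by (simp add: mult_ac)
  qed
  then show "\<exists>C\<ge>0. \<forall>x\<in>S. \<forall>t. \<bar>t\<bar> \<le> 1 \<longrightarrow> norm (c + exp t *\<^sub>R (x - c) - x) \<le> C * \<bar>t\<bar>"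
    by (intro exI[of _ "3 * (\<bar>R\<bar> + norm c)"]) auto
qed (simp_all add: exp_add)

lemma integral_dilation:
  fixes g :: "'a::euclidean_space \<Rightarrow> real"
  assumes [measurable]: "g \<in> borel_measurable borel" and t: "t > 0"
  shows "(LBINT z. g z) = t ^ DIM('a) * (LBINT x. g (c + t *\<^sub>R (x - c)))"
proof -
  have "(LBINT z. g z) = (LINT z|density (distr lborel borel (\<lambda>x. (c - t *\<^sub>R c) + t *\<^sub>R x)) (\<lambda>_. ennreal (\<bar>t\<bar> ^ DIM('a))). g z)"
    using lborel_affine[of t "c - t *\<^sub>R c"] t by simp
  also have "\<dots> = (LINT z|distr lborel borel (\<lambda>x. (c - t *\<^sub>R c) + t *\<^sub>R x). t ^ DIM('a) * g z)"
    by (subst integral_density) (use t in auto)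
  also have "\<dots> = (LBINT x. t ^ DIM('a) * g ((c - t *\<^sub>R c) + t *\<^sub>R x))"
    by (subst integral_distr) auto
  also have "\<dots> = t ^ DIM('a) * (LBINT x. g (c + t *\<^sub>R (x - c)))"
    by (simp add: algebra_simps)
  finally show ?thesis .
qed

lemma integrable_mult_test:
  assumes f: "f \<in> borel_measurable borel" "\<And>x. \<bar>f x\<bar> \<le> C" and \<eta>: "\<eta> \<in> test_functions U"
  shows "integrable lborel (\<lambda>x. f x * \<eta> x)"
proof -
  obtain K where K: "smooth \<eta>" "compact K" "K \<subseteq> U" "\<And>x. x \<notin> K \<Longrightarrow> \<eta> x = 0"
    using test_functionsE[OF \<eta>] by metis
  obtain D where D: "\<And>x. \<bar>\<eta> x\<bar> \<le> D" using test_functions_bounded[OF \<eta>] by metis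
  note [measurable] = f(1) smooth_borel[OF K(1)]
  show ?thesis
  proof (rule integrable_bounded_support[OF _ compact_imp_bounded[OF K(2)]])
    show "\<bar>f x * \<eta> x\<bar> \<le> C * D" for x
      unfolding abs_mult by (intro mult_mono f D order_trans[OF abs_ge_zero f(2)]) auto
  qed (simp_all add: K(4))
qed

lemma FTC_bounded:
  fixes F f :: "real \<Rightarrow> real"
  assumes F: "continuous_on {0..1} F" "\<And>t. 0 < t \<Longrightarrow> t < 1 \<Longrightarrow> (F has_real_derivative f t) (at t)"
    and f: "f \<in> borel_measurable borel" "\<And>t. t \<in> {0..1} \<Longrightarrow> \<bar>f t\<bar> \<le> C"
  shows "(LINT t:{0..1}|lborel. f t) = F 1 - F 0"
proof -
  have hi: "(f has_integral F 1 - F 0) {0..1}"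
    by (rule fundamental_theorem_of_calculus_interior)
       (use F in \<open>auto simp: has_real_derivative_iff_has_vector_derivative\<close>)
  have "set_integrable lborel {0..1} f"
    unfolding set_integrable_def
  proof (rule integrable_bounded_support[of _ "{0..1}" "max C 0"])
    show "\<bar>indicator {0..1} x *\<^sub>R f x\<bar> \<le> max C 0" for x using f(2)[of x] by (auto simp: indicator_def)
  qed (use f in auto)
  then have "(LINT t:{0..1}|lborel. f t) = integral {0..1} f" by (rule set_borel_integral_eq_integral)
  also have "\<dots> = F 1 - F 0" using hi by (rule integral_unique)
  finally show ?thesis .
qed

lemma fubini_bounded:
  fixes f :: "'a::euclidean_space \<Rightarrow> 'b::euclidean_space \<Rightarrow> real"
  assumes f: "case_prod f \<in> borel_measurable borel" "bounded S" "bounded T" "\<And>x y. \<bar>f x y\<bar> \<le> C"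
    "\<And>x y. x \<notin> S \<or> y \<notin> T \<Longrightarrow> f x y = 0"
  shows "(LBINT x. LBINT y. f x y) = (LBINT y. LBINT x. f x y)"
proof -
  have "integrable lborel (case_prod f)"
    by (rule integrable_bounded_support[OF f(1) bounded_Times[OF f(2,3)], of C]) (use f(4,5) in \<open>auto split: prod.splits\<close>)
  then have "integrable (lborel \<Otimes>\<^sub>M lborel) (case_prod f)" by (simp add: lborel_prod)
  from lborel_pair.Fubini_integral[OF this] show ?thesis by simp
qed

text \<open>A property of pairs that is known for each fixed translation holds for almost all pairs:
exchange \<open>v\<close> and \<open>x\<close> by Fubini, then substitute \<open>y = x + v\<close> for fixed \<open>x\<close>.\<close>

lemma AE_pairs_of_translations:
  fixes P :: "'a::euclidean_space \<times> 'a \<Rightarrow> bool"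
  assumes P: "Measurable.pred borel P" and v: "\<And>v. AE x in lborel. P (x, x + v)"
  shows "AE x in lborel. AE y in lborel. P (x, y)"
proof -
  note P[measurable]
  have m: "Measurable.pred borel (\<lambda>(x, v). P (x, x + v))"
    by (simp add: borel_prod[symmetric])
  have "{p \<in> space (lborel \<Otimes>\<^sub>M lborel). P (fst p, fst p + snd p)} \<in> sets (lborel \<Otimes>\<^sub>M lborel)"
    unfolding lborel_prod using m by (simp add: pred_def split_beta')
  moreover have "AE v in lborel. AE x in lborel. P (x, x + v)" using v by simp
  ultimately have "AE x in lborel. AE v in lborel. P (x, x + v)"
    using lborel_pair.AE_commute[of "\<lambda>x v. P (x, x + v)"] by simp
  then show ?thesis
  proof eventually_elim
    case (elim x)
    have "AE y in distr lborel borel ((+) x). P (x, y)"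
      using elim by (subst AE_distr_iff) auto
    then show ?case unfolding lborel_distr_plus .
  qed
qed

text \<open>The radial potential \<open>\<Phi>(x) = \<integral>\<^sub>0\<^sup>1 U (c + t (x - c)) \<bullet> (x - c) dt\<close> of a field that is only
bounded and weakly curl-free. Put \<open>J(t) = t \<integral> (U \<bullet> b)(c + t (x - c)) \<phi>(x) dx\<close>. After
substitution the dilation acts on the test function, so \<open>J\<close> can be differentiated, and the curl
equation, tested with \<open>\<phi>\<close> times the coordinates, gives
\<open>J'(t) = - \<integral> U (c + t (x - c)) \<bullet> (x - c) \<partial>\<^sub>b \<phi>(x) dx\<close>. Integrating over \<open>[0, 1]\<close> and using
\<open>J(0) = 0\<close> yields the claim.\<close>

lemma weak_poincare_lemma:
  fixes U :: "'a::euclidean_space \<Rightarrow> 'a"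
  assumes U: "U \<in> borel_measurable borel" "\<And>x. norm (U x) \<le> 1" "\<And>x. x \<notin> ball c r \<Longrightarrow> U x = 0"
    and curl: "\<forall>b\<in>Basis. \<forall>b'\<in>Basis. \<forall>\<eta>\<in>test_functions (ball c r).
      (LBINT x. (U x \<bullet> b) * dderiv \<eta> b' x) = (LBINT x. (U x \<bullet> b') * dderiv \<eta> b x)"
    and b: "b \<in> Basis" and \<phi>: "\<phi> \<in> test_functions (ball c r)"
  shows "(LBINT x. (LINT t:{0..1}|lborel. U (c + t *\<^sub>R (x - c)) \<bullet> (x - c)) * dderiv \<phi> b x)
    = - (LBINT x. (U x \<bullet> b) * \<phi> x)"
proof -
  note U(1)[measurable]
  define B where "B = ball c r"
  define N where "N = real DIM('a)"
  have Ui: "\<bar>U x \<bullet> i\<bar> \<le> 1" if "i \<in> Basis" for i x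
    using Basis_le_norm[OF that, of "U x"] U(2)[of x] by linarith
  obtain K where K: "smooth \<phi>" "compact K" "K \<subseteq> B" "\<And>x. x \<notin> K \<Longrightarrow> \<phi> x = 0"
    using test_functionsE[OF \<phi>] unfolding B_def by metis
  have B0: "bounded_borel_on B (\<lambda>x. U x \<bullet> i)" if "i \<in> Basis" for i
    unfolding bounded_borel_on_def B_def using Ui[OF that] U by auto
  have int: "integrable lborel (\<lambda>x. (U x \<bullet> i) * \<eta> x)" if "i \<in> Basis" "\<eta> \<in> test_functions B" for i \<eta>
    by (rule integrable_mult_test[OF _ Ui[OF that(1)] that(2)]) simp
  have smi: "smooth (\<lambda>x. (x - c) \<bullet> i)" for i
  proof -
    have "(\<lambda>x. (x - c) \<bullet> i) = (\<lambda>x. i \<bullet> x + - (i \<bullet> c))"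
      by (auto simp: inner_diff_left inner_commute[of i] inner_diff_right)
    then show ?thesis using smooth_affine[of i "- (i \<bullet> c)"] by simp
  qed
  have dmi: "dderiv (\<lambda>x. (x - c) \<bullet> i) v x = v \<bullet> i" for i v x
    by (rule has_derivative_dderiv) (auto intro!: derivative_eq_intros)
  (* Here the curl equation enters: the radial derivative of a component becomes the derivative
     of the radial component in the direction b; N counts the coordinate terms. *)
  have star: "(LBINT x. (U x \<bullet> b) * dderiv \<eta> (x - c) x)
      = (1 - N) * (LBINT x. (U x \<bullet> b) * \<eta> x) + (LBINT x. (U x \<bullet> (x - c)) * dderiv \<eta> b x)"
    if \<eta>: "\<eta> \<in> test_functions B" for \<eta>
  proof -
    have sm: "smooth \<eta>" using \<eta> by (simp add: test_functions_iff)
    define \<eta>' where "\<eta>' i x = ((x - c) \<bullet> i) * \<eta> x" for i x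
    have \<eta>': "\<eta>' i \<in> test_functions B" for i
      unfolding \<eta>'_def[abs_def] by (rule test_functions_mult[OF \<eta> smi])
    have d\<eta>': "dderiv (\<eta>' i) v x = ((x - c) \<bullet> i) * dderiv \<eta> v x + (v \<bullet> i) * \<eta> x" for i v x
      unfolding \<eta>'_def[abs_def] by (simp add: dderiv_mult[OF smi sm] dmi)
    note td = test_functions_dderiv[OF \<eta>] test_functions_dderiv[OF \<eta>']
    have xi: "(\<lambda>x. ((x - c) \<bullet> i) * dderiv \<eta> v x) \<in> test_functions B" for i v
      by (rule test_functions_mult[OF td(1) smi])
    have one: "(LBINT x. (U x \<bullet> b) * (((x - c) \<bullet> i) * dderiv \<eta> i x))
       = (LBINT x. (U x \<bullet> i) * (((x - c) \<bullet> i) * dderiv \<eta> b x)) + (b \<bullet> i) * (LBINT x. (U x \<bullet> i) * \<eta> x)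
          - (LBINT x. (U x \<bullet> b) * \<eta> x)" if i: "i \<in> Basis" for i
    proof -
      have "(LBINT x. (U x \<bullet> b) * (((x - c) \<bullet> i) * dderiv \<eta> i x))
        = (LBINT x. (U x \<bullet> b) * dderiv (\<eta>' i) i x - (U x \<bullet> b) * \<eta> x)"
        by (intro Bochner_Integration.integral_cong) (use i in \<open>auto simp: d\<eta>' algebra_simps inner_Basis\<close>)
      also have "\<dots> = (LBINT x. (U x \<bullet> b) * dderiv (\<eta>' i) i x) - (LBINT x. (U x \<bullet> b) * \<eta> x)"
        by (intro Bochner_Integration.integral_diff int b \<eta> td)
      also have "(LBINT x. (U x \<bullet> b) * dderiv (\<eta>' i) i x) = (LBINT x. (U x \<bullet> i) * dderiv (\<eta>' i) b x)"
        using curl b i \<eta>' unfolding B_def by blast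
      also have "\<dots> = (LBINT x. (U x \<bullet> i) * (((x - c) \<bullet> i) * dderiv \<eta> b x) + (b \<bullet> i) * ((U x \<bullet> i) * \<eta> x))"
        by (intro Bochner_Integration.integral_cong) (auto simp: d\<eta>' algebra_simps)
      also have "\<dots> = (LBINT x. (U x \<bullet> i) * (((x - c) \<bullet> i) * dderiv \<eta> b x)) + (LBINT x. (b \<bullet> i) * ((U x \<bullet> i) * \<eta> x))"
        by (intro Bochner_Integration.integral_add integrable_mult_right int i \<eta> xi)
      finally show ?thesis by simp
    qed
    have "(LBINT x. (U x \<bullet> b) * dderiv \<eta> (x - c) x)
        = (LBINT x. (\<Sum>i\<in>Basis. (U x \<bullet> b) * (((x - c) \<bullet> i) * dderiv \<eta> i x)))"
    proof (intro Bochner_Integration.integral_cong refl)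
      fix x
      have "dderiv \<eta> (x - c) x = (\<Sum>i\<in>Basis. ((x - c) \<bullet> i) * dderiv \<eta> i x)"
        by (rule dderiv_basis[OF sm])
      then show "(U x \<bullet> b) * dderiv \<eta> (x - c) x = (\<Sum>i\<in>Basis. (U x \<bullet> b) * (((x - c) \<bullet> i) * dderiv \<eta> i x))"
        by (simp add: sum_distrib_left)
    qed
    also have "\<dots> = (\<Sum>i\<in>Basis. LBINT x. (U x \<bullet> b) * (((x - c) \<bullet> i) * dderiv \<eta> i x))"
      by (intro Bochner_Integration.integral_sum int b xi)
    also have "\<dots> = (\<Sum>i\<in>Basis. (LBINT x. (U x \<bullet> i) * (((x - c) \<bullet> i) * dderiv \<eta> b x)) + (b \<bullet> i) * (LBINT x. (U x \<bullet> i) * \<eta> x)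
          - (LBINT x. (U x \<bullet> b) * \<eta> x))"
      by (intro sum.cong refl one)
    also have "\<dots> = (\<Sum>i\<in>Basis. LBINT x. (U x \<bullet> i) * (((x - c) \<bullet> i) * dderiv \<eta> b x))
        + (\<Sum>i\<in>Basis. (b \<bullet> i) * (LBINT x. (U x \<bullet> i) * \<eta> x)) - N * (LBINT x. (U x \<bullet> b) * \<eta> x)"
      by (simp add: sum.distrib sum_subtractf N_def)
    also have "(\<Sum>i\<in>Basis. (b \<bullet> i) * (LBINT x. (U x \<bullet> i) * \<eta> x)) = (LBINT x. (U x \<bullet> b) * \<eta> x)"
      using b by (simp add: inner_Basis if_distrib[of "\<lambda>a. a * _"] cong: if_cong)
    also have "(\<Sum>i\<in>Basis. LBINT x. (U x \<bullet> i) * (((x - c) \<bullet> i) * dderiv \<eta> b x))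
        = (LBINT x. (\<Sum>i\<in>Basis. (U x \<bullet> i) * (((x - c) \<bullet> i) * dderiv \<eta> b x)))"
      by (intro Bochner_Integration.integral_sum[symmetric] int xi)
    also have "\<dots> = (LBINT x. (U x \<bullet> (x - c)) * dderiv \<eta> b x)"
      by (intro Bochner_Integration.integral_cong refl)
         (simp add: euclidean_inner[of "U _" "_ - c"] sum_distrib_right mult.assoc)
    finally show ?thesis by (simp add: algebra_simps)
  qed
  (* With t = exp (- s) the dilations form a flow, so J can be differentiated by the general
     formula for flows. For s >= 0 the dilation M s pulls supports towards the centre c, hence
     keeps them in the ball. *)
  define M where "M s x = c + exp s *\<^sub>R (x - c)" for s and x :: 'a
  interpret M: affine_flow M "\<lambda>x. x - c"
    using dilation_flow[of c] by (simp add: M_def[abs_def])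
  have \<phi>M: "(\<lambda>x. \<phi> (M s x)) \<in> test_functions B" if "s \<ge> 0" for s
  proof (rule M.test_functions_flow[OF K(1,2)])
    show "M (- s) ` K \<subseteq> B"
    proof (rule image_subsetI)
      fix x assume "x \<in> K"
      then have "norm (x - c) < r" using K(3) by (auto simp: B_def dist_norm norm_minus_commute)
      moreover have "exp (- s) * norm (x - c) \<le> 1 * norm (x - c)" using that by (intro mult_right_mono) auto
      ultimately show "M (- s) x \<in> B" by (simp add: M_def B_def dist_norm)
    qed
  qed (rule K(4))
  define F where "F s = (LBINT x. (U x \<bullet> b) * \<phi> (M s x))" for s
  define F' where "F' s = (LBINT x. (U x \<bullet> b) * dderiv (\<lambda>y. \<phi> (M s y)) (x - c) x)" for s
  have dF: "(F has_real_derivative F' s) (at s)" for s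
    unfolding F_def[abs_def] F'_def by (rule M.flow_integral_derivative[OF B0[OF b] \<phi>])
  define J where "J t = t * (LBINT x. (U (c + t *\<^sub>R (x - c)) \<bullet> b) * \<phi> x)" for t
  define k where "k t = (LBINT x. (U (c + t *\<^sub>R (x - c)) \<bullet> (x - c)) * dderiv \<phi> b x)" for t
  have [measurable]: "\<phi> \<in> borel_measurable borel" "dderiv \<phi> b \<in> borel_measurable borel"
    by (intro smooth_borel smooth_dderiv K(1))+
  have texp: "exp ((N - 1) * (- ln t)) * t ^ DIM('a) = t" if t: "t > 0" for t
  proof -
    have "t ^ DIM('a) = exp (N * ln t)" using t by (simp add: N_def exp_of_nat_mult)
    then have "exp ((N - 1) * (- ln t)) * t ^ DIM('a) = exp ((N - 1) * (- ln t) + N * ln t)" by (simp only: exp_add)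
    also have "(N - 1) * (- ln t) + N * ln t = ln t" by (simp add: algebra_simps)
    finally show ?thesis using t by simp
  qed
  have JG: "J t = exp ((N - 1) * (- ln t)) * F (- ln t)" if t: "t > 0" for t
  proof -
    have "F (- ln t) = t ^ DIM('a) * (LBINT x. (U (c + t *\<^sub>R (x - c)) \<bullet> b) * \<phi> x)"
      unfolding F_def M_def using t
      by (subst integral_dilation[where c = c and t = t]) (auto simp: exp_minus)
    then show ?thesis using texp[OF t] by (simp add: J_def mult.assoc[symmetric])
  qed
  have dJ: "(J has_real_derivative (exp ((N - 1) * (- ln t)) * ((N - 1) * F (- ln t) + F' (- ln t)) * (- (1 / t)))) (at t)"
    if t: "t > 0" for t
  proof -
    have "((\<lambda>t. exp ((N - 1) * (- ln t)) * F (- ln t)) has_real_derivative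
        (exp ((N - 1) * (- ln t)) * ((N - 1) * F (- ln t) + F' (- ln t)) * (- (1 / t)))) (at t)"
      using t by (auto intro!: derivative_eq_intros DERIV_chain2[OF dF] simp: algebra_simps divide_simps)
    then show ?thesis
      by (rule has_field_derivative_transform_within_open[of _ _ _ "{0<..}"]) (use t JG in auto)
  qed
  have dJk: "(J has_real_derivative - k t) (at t)" if t: "0 < t" "t < 1" for t
  proof -
    define s where "s = - ln t"
    have s: "s \<ge> 0" "exp s = 1 / t" using t by (auto simp: s_def exp_minus inverse_eq_divide)
    have "(N - 1) * F s + F' s = (LBINT x. (U x \<bullet> (x - c)) * dderiv (\<lambda>y. \<phi> (M s y)) b x)"
      using star[OF \<phi>M[OF s(1)]] by (simp add: F_def F'_def algebra_simps)
    also have "\<dots> = (LBINT x. (U x \<bullet> (x - c)) * ((1 / t) * dderiv \<phi> b (c + (1 / t) *\<^sub>R (x - c))))"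
    proof (intro Bochner_Integration.integral_cong refl arg_cong2[of _ _ _ _ "(*)"])
      fix x
      have eq: "(\<lambda>y. \<phi> (M s y)) = (\<lambda>y. \<phi> ((1 / t) *\<^sub>R y + (c - (1 / t) *\<^sub>R c)))"
        by (simp add: M_def s algebra_simps)
      have "dderiv (\<lambda>y. \<phi> (M s y)) b x = dderiv \<phi> ((1 / t) *\<^sub>R b) ((1 / t) *\<^sub>R x + (c - (1 / t) *\<^sub>R c))"
        unfolding eq by (rule dderiv_affine_compose[OF K(1)]) (simp add: linear_iff algebra_simps)
      also have "(1 / t) *\<^sub>R x + (c - (1 / t) *\<^sub>R c) = c + (1 / t) *\<^sub>R (x - c)" by (simp add: algebra_simps)
      finally show "dderiv (\<lambda>y. \<phi> (M s y)) b x = (1 / t) * dderiv \<phi> b (c + (1 / t) *\<^sub>R (x - c))"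
        by (simp add: linear_scale[OF smooth_dderiv_linear[OF K(1)]])
    qed
    also have "\<dots> = t ^ DIM('a) * (LBINT x. (U (c + t *\<^sub>R (x - c)) \<bullet> (t *\<^sub>R (x - c))) * ((1 / t) * dderiv \<phi> b x))"
      using t by (subst integral_dilation[where c = c and t = t]) auto
    also have "\<dots> = t ^ DIM('a) * k t"
      using t by (simp add: k_def)
    finally have "exp ((N - 1) * s) * ((N - 1) * F s + F' s) * (- (1 / t)) = - (exp ((N - 1) * s) * t ^ DIM('a) * (1 / t)) * k t"
      by simp
    also have "exp ((N - 1) * s) * t ^ DIM('a) = t" unfolding s_def by (rule texp[OF t(1)])
    finally show ?thesis using dJ[OF t(1)] t by (simp add: s_def)
  qed
  obtain Cb where Cb: "Cb \<ge> 0" "\<And>x. \<bar>\<phi> x\<bar> \<le> Cb" using test_functions_bounded[OF \<phi>] by metis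
  obtain R where R: "\<And>x. x \<in> K \<Longrightarrow> norm (x - c) \<le> R"
    using K(3) by (intro that[of r]) (auto simp: B_def dist_norm norm_minus_commute dual_order.strict_implies_order)
  obtain D where D: "D \<ge> 0" "\<And>x. \<bar>dderiv \<phi> b x\<bar> \<le> D"
    using test_functions_bounded[OF test_functions_dderiv[OF \<phi>, of b]] by metis
  have \<phi>i: "integrable lborel \<phi>"
    by (rule integrable_bounded_support[OF _ compact_imp_bounded[OF K(2)] Cb(2) K(4)]) auto
  have Jb: "\<bar>J t\<bar> \<le> \<bar>t\<bar> * (LBINT x. \<bar>\<phi> x\<bar>)" for t
  proof -
    have "\<bar>LBINT x. (U (c + t *\<^sub>R (x - c)) \<bullet> b) * \<phi> x\<bar> \<le> (LBINT x. \<bar>\<phi> x\<bar>)"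
    proof (rule order_trans[OF integral_abs_bound], rule integral_mono[OF integrable_abs integrable_abs[OF \<phi>i]])
      show "integrable lborel (\<lambda>x. (U (c + t *\<^sub>R (x - c)) \<bullet> b) * \<phi> x)"
        by (rule integrable_mult_test[OF _ Ui[OF b] \<phi>]) simp
    qed (use Ui[OF b] in \<open>auto simp: abs_mult intro!: mult_left_le_one_le\<close>)
    then show ?thesis by (simp add: J_def abs_mult mult_left_mono)
  qed
  have "continuous_on {0..1} J"
    unfolding continuous_on_eq_continuous_within
  proof
    fix t :: real assume "t \<in> {0..1}"
    show "continuous (at t within {0..1}) J"
    proof (cases "t = 0")
      case True
      have "(J \<longlongrightarrow> 0) (at 0)"
      proof (rule Lim_null_comparison)
        show "\<forall>\<^sub>F t in at 0. norm (J t) \<le> \<bar>t\<bar> * (LBINT x. \<bar>\<phi> x\<bar>)"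
          using Jb by (simp add: always_eventually)
        show "((\<lambda>t. \<bar>t\<bar> * (LBINT x. \<bar>\<phi> x\<bar>)) \<longlongrightarrow> 0) (at (0::real))"
          by (rule tendsto_eq_intros refl | simp)+
      qed
      then have "continuous (at 0) J" by (simp add: continuous_at J_def)
      then show ?thesis using True continuous_at_imp_continuous_within by blast
    next
      case False
      then have "t > 0" using \<open>t \<in> {0..1}\<close> by simp
      from DERIV_isCont[OF dJ[OF this]] show ?thesis by (rule continuous_at_imp_continuous_within)
    qed
  qed
  define f where "f t x = indicator {0..1} t * ((U (c + t *\<^sub>R (x - c)) \<bullet> (x - c)) * dderiv \<phi> b x)" for t x
  have d0: "dderiv \<phi> b x = 0" if "x \<notin> K" for x by (rule dderiv_eq_0_outside[OF K(2,4) that])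
  have fm: "(\<lambda>(x, t). f t x) \<in> borel_measurable borel" "(\<lambda>(t, x). f t x) \<in> borel_measurable borel"
    unfolding f_def by (simp_all add: borel_prod[symmetric])
  have fb: "\<bar>(U (c + t *\<^sub>R (x - c)) \<bullet> (x - c)) * dderiv \<phi> b x\<bar> \<le> \<bar>R\<bar> * D" for t x
  proof (cases "x \<in> K")
    case True
    have "\<bar>U (c + t *\<^sub>R (x - c)) \<bullet> (x - c)\<bar> \<le> 1 * \<bar>R\<bar>"
      using R[OF True] U(2)[of "c + t *\<^sub>R (x - c)"]
      by (intro order_trans[OF Cauchy_Schwarz_ineq2] mult_mono) auto
    then show ?thesis unfolding abs_mult using D by (intro mult_mono) auto
  qed (use d0 D in simp)
  have gi: "integrable lborel (\<lambda>x. (U (c + t *\<^sub>R (x - c)) \<bullet> (x - c)) * dderiv \<phi> b x)" for t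
    by (rule integrable_bounded_support[OF _ compact_imp_bounded[OF K(2)] fb]) (simp_all add: d0)
  have [measurable]: "K \<in> sets borel" using K(2) by (rule borel_compact)
  have ii: "integrable lborel (\<lambda>x. \<bar>R\<bar> * D * indicator K x)"
    by (rule integrable_bounded_support[OF _ compact_imp_bounded[OF K(2)], of _ "\<bar>R\<bar> * D"])
       (use D in \<open>auto simp: indicator_def\<close>)
  have kb: "\<bar>k t\<bar> \<le> (LBINT x. \<bar>R\<bar> * D * indicator K x)" for t
    unfolding k_def
  proof (rule order_trans[OF integral_abs_bound], rule integral_mono[OF integrable_abs[OF gi] ii])
    fix x show "\<bar>(U (c + t *\<^sub>R (x - c)) \<bullet> (x - c)) * dderiv \<phi> b x\<bar> \<le> \<bar>R\<bar> * D * indicator K x"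
      using fb[of t x] d0[of x] by (cases "x \<in> K") auto
  qed
  have km: "k \<in> borel_measurable borel"
    unfolding k_def[abs_def] by measurable
  have "- J 1 = - (J 1 - J 0)" by (simp add: J_def)
  also have "J 1 - J 0 = (LINT t:{0..1}|lborel. - k t)"
    by (rule FTC_bounded[symmetric, OF \<open>continuous_on {0..1} J\<close> dJk]) (use km kb in auto)
  also have "- \<dots> = (LBINT t. LBINT x. f t x)"
    by (simp add: set_lebesgue_integral_def f_def k_def)
  also have "\<dots> = (LBINT x. LBINT t. f t x)"
    by (rule fubini_bounded[OF fm(2) bounded_closed_interval[of 0 1] compact_imp_bounded[OF K(2)], of "\<bar>R\<bar> * D"])
       (use fb D in \<open>auto simp: f_def indicator_def d0\<close>)
  also have "\<dots> = (LBINT x. (LINT t:{0..1}|lborel. U (c + t *\<^sub>R (x - c)) \<bullet> (x - c)) * dderiv \<phi> b x)"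
    by (simp add: f_def set_lebesgue_integral_def mult.assoc[symmetric])
  finally show ?thesis by (simp add: J_def)
qed

section \<open>Lipschitz representatives\<close>

text \<open>The fundamental theorem of calculus for weak derivatives in a fixed direction. Here
\<open>t \<mapsto> \<integral> f(x) \<phi>(x - t v) dx\<close> is differentiable because \<open>\<phi>\<close> is, and convexity keeps the translated
supports in \<open>B\<close>.\<close>

lemma weak_derivative_increment:
  fixes f k :: "'a::euclidean_space \<Rightarrow> real"
  assumes f: "bounded_borel_on B f" and k: "bounded_borel_on B k" and B: "open B" "convex B"
    and weak: "\<forall>\<eta>\<in>test_functions B. (LBINT x. f x * dderiv \<eta> v x) = - (LBINT x. k x * \<eta> x)"
  shows "AE x in lborel. x \<in> B \<and> x + v \<in> B \<longrightarrow> f (x + v) - f x = (LINT t:{0..1}|lborel. k (x + t *\<^sub>R v))"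
proof -
  interpret T: measure_preserving_affine_flow "\<lambda>t x. x + t *\<^sub>R (- v)" "\<lambda>x. - v" by (rule translation_flow)
  note [measurable] = bounded_borel_on_borel[OF f] bounded_borel_on_borel[OF k]
  obtain C where C: "C \<ge> 0" "\<And>x. \<bar>k x\<bar> \<le> C" using bounded_borel_onE[OF k] by metis
  define V where "V = B \<inter> (\<lambda>x. x + v) -` B"
  have V: "open V" unfolding V_def by (intro open_Int B open_vimage continuous_intros)
  define q where "q x = (LINT t:{0..1}|lborel. k (x + t *\<^sub>R v))" for x
  obtain R where R: "\<And>x. x \<in> B \<Longrightarrow> norm x \<le> R"
    using bounded_borel_on_bounded[OF f] by (auto simp: bounded_iff)
  have bq: "bounded_borel_on (cball 0 (\<bar>R\<bar> + norm v)) q"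
    unfolding bounded_borel_on_def
  proof (intro conjI allI impI exI[of _ C])
    show "q \<in> borel_measurable borel" unfolding q_def[abs_def] set_lebesgue_integral_def by measurable
    fix x
    have ki: "integrable lborel (\<lambda>t. indicator {0..1} t *\<^sub>R k (x + t *\<^sub>R v) :: real)"
      by (rule integrable_bounded_support[of _ "{0..1}" C]) (use C in \<open>auto simp: indicator_def\<close>)
    have "\<bar>q x\<bar> \<le> (LBINT t. \<bar>indicator {0..1} t *\<^sub>R k (x + t *\<^sub>R v)\<bar>)"
      unfolding q_def set_lebesgue_integral_def by (rule integral_abs_bound)
    also have "\<dots> \<le> (LBINT t. C * indicator {0..1::real} t)"
    proof (rule integral_mono[OF integrable_abs[OF ki]])
      show "integrable lborel (\<lambda>t. C * indicator {0..1::real} t)"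
        by (rule integrable_bounded_support[of _ "{0..1}" C]) (use C in \<open>auto simp: indicator_def\<close>)
    qed (use C in \<open>auto simp: indicator_def\<close>)
    also have "\<dots> = C" by simp
    finally show "\<bar>q x\<bar> \<le> C" .
    assume x: "x \<notin> cball 0 (\<bar>R\<bar> + norm v)"
    have "indicator {0..1} t *\<^sub>R k (x + t *\<^sub>R v) = 0" for t :: real
    proof (cases "t \<in> {0..1}")
      case True
      have "x + t *\<^sub>R v \<notin> B"
      proof
        assume "x + t *\<^sub>R v \<in> B"
        then have "norm (x + t *\<^sub>R v) \<le> R" by (rule R)
        moreover have "norm (t *\<^sub>R v) \<le> norm v" using True by (simp add: mult_left_le_one_le)
        ultimately have "norm x \<le> R + norm v"
          using norm_triangle_ineq4[of "x + t *\<^sub>R v" "t *\<^sub>R v"] by simp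
        then show False using x by simp
      qed
      then show ?thesis by (simp add: bounded_borel_on_outside[OF k])
    qed simp
    then have "(\<lambda>t. indicator {0..1} t *\<^sub>R k (x + t *\<^sub>R v)) = (\<lambda>t::real. 0)" by blast
    then show "q x = 0" unfolding q_def set_lebesgue_integral_def by simp
  qed simp
  have fi: "integrable lborel f" "integrable lborel (\<lambda>x. f (x + v))"
    using bounded_borel_on_integrable[OF f] T.integrable_flow[of f "- 1"] by auto
  have "AE x in lborel. x \<in> V \<longrightarrow> f (x + v) - f x - q x = 0"
  proof (rule fundamental_lemma[OF _ V])
    show "integrable lborel (\<lambda>x. f (x + v) - f x - q x)"
      using fi bounded_borel_on_integrable[OF bq] by simp
    fix \<phi> assume \<phi>: "\<phi> \<in> test_functions V"
    obtain K where K: "smooth \<phi>" "compact K" "K \<subseteq> V" "\<And>x. x \<notin> K \<Longrightarrow> \<phi> x = 0"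
      using test_functionsE[OF \<phi>] by metis
    have [measurable]: "\<phi> \<in> borel_measurable borel" by (rule smooth_borel[OF K(1)])
    obtain D where D: "D \<ge> 0" "\<And>x. \<bar>\<phi> x\<bar> \<le> D" using test_functions_bounded[OF \<phi>] by metis
    define F where "F t = (LBINT x. f x * \<phi> (x + t *\<^sub>R (- v)))" for t
    define g where "g t = (LBINT x. k x * \<phi> (x + t *\<^sub>R (- v)))" for t
    have dF: "(F has_real_derivative (LBINT x. f x * dderiv (\<lambda>y. \<phi> (y + t *\<^sub>R (- v))) (- v) x)) (at t)" for t
      unfolding F_def[abs_def] by (rule T.flow_integral_derivative[OF f \<phi>])
    have dFg: "(F has_real_derivative g t) (at t)" if t: "0 < t" "t < 1" for t
    proof -
      have "(\<lambda>x. x + (- t) *\<^sub>R (- v)) ` K \<subseteq> B"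
      proof (rule image_subsetI)
        fix x assume "x \<in> K"
        then have "x \<in> B" "x + v \<in> B" using K(3) by (auto simp: V_def)
        then have "(1 - t) *\<^sub>R x + t *\<^sub>R (x + v) \<in> B"
          using B(2) t by (intro convexD) auto
        then show "x + (- t) *\<^sub>R (- v) \<in> B" by (simp add: algebra_simps)
      qed
      then have \<phi>t: "(\<lambda>x. \<phi> (x + t *\<^sub>R (- v))) \<in> test_functions B"
        by (intro T.test_functions_flow[OF K(1,2)]) (auto simp: K(4))
      have "(LBINT x. f x * dderiv (\<lambda>y. \<phi> (y + t *\<^sub>R (- v))) (- v) x)
          = (LBINT x. - (f x * dderiv (\<lambda>y. \<phi> (y + t *\<^sub>R (- v))) v x))"
        using linear_neg[OF smooth_dderiv_linear[OF T.smooth_flow[OF K(1)]]] by simp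
      also have "\<dots> = g t" using weak \<phi>t by (simp add: g_def)
      finally show ?thesis using dF[of t] by simp
    qed
    have "continuous_on {0..1} F"
      using DERIV_isCont[OF dF] by (simp add: continuous_at_imp_continuous_on)
    have gshift: "g t = (LBINT x. k (x + t *\<^sub>R v) * \<phi> x)" for t
      unfolding g_def using T.integral_flow[of "\<lambda>x. k x * \<phi> (x + t *\<^sub>R (- v))" "- t"] by simp
    have ki: "integrable lborel (\<lambda>x. k (x + t *\<^sub>R v) * \<phi> x)" for t
      by (rule integrable_mult_test[OF _ C(2) \<phi>]) simp
    have ai: "integrable lborel (\<lambda>x. C * \<bar>\<phi> x\<bar>)"
      by (rule integrable_bounded_support[OF _ compact_imp_bounded[OF K(2)], of _ "C * D"])
         (use K(4) C D in \<open>auto simp: abs_mult intro!: mult_left_mono\<close>)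
    have gb: "\<bar>g t\<bar> \<le> (LBINT x. C * \<bar>\<phi> x\<bar>)" for t
      unfolding gshift
      by (rule order_trans[OF integral_abs_bound], rule integral_mono[OF integrable_abs[OF ki] ai])
         (use C in \<open>auto simp: abs_mult intro!: mult_right_mono\<close>)
    have gm: "g \<in> borel_measurable borel" unfolding g_def[abs_def] by measurable
    have "F 1 - F 0 = (LINT t:{0..1}|lborel. g t)"
      by (rule FTC_bounded[symmetric, OF \<open>continuous_on {0..1} F\<close> dFg gm gb])
    also have "\<dots> = (LBINT t. LBINT x. indicator {0..1} t * (k (x + t *\<^sub>R v) * \<phi> x))"
      by (simp add: set_lebesgue_integral_def gshift)
    also have "\<dots> = (LBINT x. LBINT t. indicator {0..1} t * (k (x + t *\<^sub>R v) * \<phi> x))"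
    proof (rule fubini_bounded[OF _ bounded_closed_interval[of 0 1] compact_imp_bounded[OF K(2)], of _ "C * D"])
      show "(\<lambda>(t, x). indicator {0..1} t * (k (x + t *\<^sub>R v) * \<phi> x)) \<in> borel_measurable borel"
        by (simp add: borel_prod[symmetric])
      show "\<bar>indicator {0..1} t * (k (x + t *\<^sub>R v) * \<phi> x)\<bar> \<le> C * D" for t :: real and x
        using C D mult_mono[OF C(2)[of "x + t *\<^sub>R v"] D(2)[of x] C(1)] by (auto simp: indicator_def abs_mult)
    qed (auto simp: K(4))
    also have "\<dots> = (LBINT x. q x * \<phi> x)"
      by (simp add: q_def set_lebesgue_integral_def mult.assoc[symmetric])
    finally have eq: "F 1 - F 0 = (LBINT x. q x * \<phi> x)" .
    have F1: "F 1 = (LBINT x. f (x + v) * \<phi> x)"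
      unfolding F_def using T.integral_flow[of "\<lambda>x. f x * \<phi> (x + 1 *\<^sub>R (- v))" "- 1"] by simp
    obtain Cf where Cf: "\<And>x. \<bar>f x\<bar> \<le> Cf" using bounded_borel_onE[OF f] by metis
    obtain Cq where Cq: "\<And>x. \<bar>q x\<bar> \<le> Cq" using bounded_borel_onE[OF bq] by metis
    have i1: "integrable lborel (\<lambda>x. f (x + v) * \<phi> x)"
      by (rule integrable_mult_test[OF _ Cf \<phi>]) simp
    have i2: "integrable lborel (\<lambda>x. f x * \<phi> x)"
      by (rule integrable_mult_test[OF _ Cf \<phi>]) simp
    have i3: "integrable lborel (\<lambda>x. q x * \<phi> x)"
      by (rule integrable_mult_test[OF bounded_borel_on_borel[OF bq] Cq \<phi>])
    have "(LBINT x. (f (x + v) - f x - q x) * \<phi> x)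
        = (LBINT x. f (x + v) * \<phi> x) - (LBINT x. f x * \<phi> x) - (LBINT x. q x * \<phi> x)"
      using i1 i2 i3 by (simp add: left_diff_distrib)
    also have "\<dots> = 0" using eq F1 by (simp add: F_def)
    finally show "(LBINT x. (f (x + v) - f x - q x) * \<phi> x) = 0" .
  qed
  then show ?thesis by eventually_elim (auto simp: V_def q_def)
qed

text \<open>Selects single points with good properties: an open null set is empty.\<close>

lemma AE_imp_dense:
  fixes W :: "'a::euclidean_space set"
  assumes W: "open W" "W \<noteq> {}" and P: "AE y in lborel. P y"
  shows "\<exists>y. y \<in> W \<and> P y"
proof (rule ccontr)
  assume "\<not> ?thesis"
  then have "AE y in lborel. y \<notin> W" using P by (auto elim!: eventually_mono)
  then have "W \<in> null_sets lborel" using W by (subst AE_iff_null_sets) auto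
  then have "negligible W" by (simp add: negligible_iff_null_sets null_sets_completionI)
  then show False using W open_not_negligible by blast
qed

text \<open>The Lipschitz bound holds for almost all pairs, hence for all pairs of points \<open>x\<close> of a set \<open>X\<close>
of full measure, by comparison with a third point near \<open>x\<close>. The infimal convolution
\<open>inf {f y + \<bar>x - y\<bar> | y \<in> X}\<close> then extends \<open>f\<close> to the whole space with the same constant.\<close>

lemma lipschitz_representative:
  fixes f :: "'a::euclidean_space \<Rightarrow> real"
  assumes f: "f \<in> borel_measurable borel" and B: "open B" "B \<noteq> {}"
    and inc: "\<And>v. AE x in lborel. x \<in> B \<and> x + v \<in> B \<longrightarrow> \<bar>f (x + v) - f x\<bar> \<le> norm v"
  obtains \<Phi> where "\<And>x y. \<bar>\<Phi> x - \<Phi> y\<bar> \<le> norm (x - y)" "AE x in lborel. x \<in> B \<longrightarrow> f x = \<Phi> x"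
proof -
  note f[measurable]
  have [measurable]: "B \<in> sets borel" using B by simp
  have "AE x in lborel. AE y in lborel. x \<in> B \<and> y \<in> B \<longrightarrow> \<bar>f y - f x\<bar> \<le> norm (y - x)"
  proof -
    have "AE x in lborel. AE y in lborel. (case (x, y) of (x, y) \<Rightarrow> x \<in> B \<and> y \<in> B \<longrightarrow> \<bar>f y - f x\<bar> \<le> norm (y - x))"
    proof (rule AE_pairs_of_translations)
      show "Measurable.pred borel (\<lambda>(x, y). x \<in> B \<and> y \<in> B \<longrightarrow> \<bar>f y - f x\<bar> \<le> norm (y - x))"
        by (simp add: borel_prod[symmetric])
    qed (use inc in simp)
    then show ?thesis by simp
  qed note pairs = this
  define X where "X = {x \<in> B. AE y in lborel. y \<in> B \<longrightarrow> \<bar>f y - f x\<bar> \<le> norm (y - x)}"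
  have aeX: "AE x in lborel. x \<in> B \<longrightarrow> x \<in> X"
    using pairs by eventually_elim (auto simp: X_def)
  have lip: "\<bar>f x - f y\<bar> \<le> norm (x - y)" if x: "x \<in> X" and y: "y \<in> X" for x y
  proof (rule field_le_epsilon)
    fix e :: real assume e: "e > 0"
    have "x \<in> B" using x by (simp add: X_def)
    have "\<exists>z. z \<in> B \<inter> ball x (e / 2) \<and> \<bar>f z - f x\<bar> \<le> norm (z - x) \<and> \<bar>f z - f y\<bar> \<le> norm (z - y)"
    proof -
      have ae: "AE z in lborel. (z \<in> B \<longrightarrow> \<bar>f z - f x\<bar> \<le> norm (z - x)) \<and> (z \<in> B \<longrightarrow> \<bar>f z - f y\<bar> \<le> norm (z - y))"
        using x y by (auto simp: X_def)
      have "B \<inter> ball x (e / 2) \<noteq> {}" using \<open>x \<in> B\<close> e by auto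
      from AE_imp_dense[OF open_Int[OF B(1) open_ball] this ae] show ?thesis by blast
    qed
    then obtain z where z: "z \<in> ball x (e / 2)" "\<bar>f z - f x\<bar> \<le> norm (z - x)" "\<bar>f z - f y\<bar> \<le> norm (z - y)" by blast
    have "norm (z - y) \<le> norm (z - x) + norm (x - y)" using norm_triangle_ineq[of "z - x" "x - y"] by simp
    moreover have "norm (z - x) < e / 2" using z(1) by (simp add: dist_norm norm_minus_commute)
    ultimately show "\<bar>f x - f y\<bar> \<le> norm (x - y) + e" using z(2,3) by linarith
  qed
  obtain x0 where x0: "x0 \<in> X" using AE_imp_dense[OF B aeX] by blast
  define \<Phi> where "\<Phi> x = Inf ((\<lambda>y. f y + norm (x - y)) ` X)" for x
  have low: "f x0 - norm (x - x0) \<le> f y + norm (x - y)" if "y \<in> X" for x y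
    using lip[OF x0 that] norm_triangle_ineq[of "x0 - x" "x - y"] by (simp add: norm_minus_commute[of x0 x])
  have bdd: "bdd_below ((\<lambda>y. f y + norm (x - y)) ` X)" for x
    by (rule bdd_belowI[of _ "f x0 - norm (x - x0)"]) (use low in auto)
  have one: "\<Phi> x \<le> \<Phi> y + norm (x - y)" for x y
  proof -
    have "\<Phi> x - norm (x - y) \<le> \<Phi> y"
      unfolding \<Phi>_def[of y]
    proof (rule cInf_greatest)
      show "(\<lambda>z. f z + norm (y - z)) ` X \<noteq> {}" using x0 by blast
      fix a assume "a \<in> (\<lambda>z. f z + norm (y - z)) ` X"
      then obtain z where z: "z \<in> X" "a = f z + norm (y - z)" by blast
      have "\<Phi> x \<le> f z + norm (x - z)" unfolding \<Phi>_def by (rule cInf_lower[OF _ bdd]) (use z in auto)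
      then show "\<Phi> x - norm (x - y) \<le> a" using z norm_triangle_ineq[of "x - y" "y - z"] by simp
    qed
    then show ?thesis by simp
  qed
  have "\<Phi> x = f x" if x: "x \<in> X" for x
  proof (rule antisym)
    have "\<Phi> x \<le> f x + norm (x - x)" unfolding \<Phi>_def by (rule cInf_lower[OF _ bdd]) (use x in blast)
    then show "\<Phi> x \<le> f x" by simp
    show "f x \<le> \<Phi> x" unfolding \<Phi>_def
    proof (rule cInf_greatest)
      fix a assume "a \<in> (\<lambda>y. f y + norm (x - y)) ` X"
      then obtain y where "y \<in> X" "a = f y + norm (x - y)" by blast
      then show "f x \<le> a" using lip[OF x, of y] by simp
    qed (use x in blast)
  qed
  then have "AE x in lborel. x \<in> B \<longrightarrow> f x = \<Phi> x" using aeX by (auto elim!: eventually_mono)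
  moreover have "\<bar>\<Phi> x - \<Phi> y\<bar> \<le> norm (x - y)" for x y
    using one[of x y] one[of y x] by (simp add: abs_le_iff norm_minus_commute)
  ultimately show ?thesis using that by blast
qed

section \<open>Difference quotients of Lipschitz functions\<close>

text \<open>True for continuous functions by dominated convergence. A bounded Borel function is an almost
everywhere limit of continuous functions, which may be truncated to the same bound and so
converge in \<open>L\<^sup>1\<close> on bounded sets.\<close>

lemma L1_continuity_of_translation:
  fixes f :: "'a::euclidean_space \<Rightarrow> real"
  assumes f: "f \<in> borel_measurable borel" "\<And>x. \<bar>f x\<bar> \<le> C" and B: "bounded B" "B \<in> sets borel" and v: "v \<longlonglongrightarrow> 0"
  shows "(\<lambda>k. LBINT x. indicator B x * \<bar>f (x + v k) - f x\<bar>) \<longlonglongrightarrow> 0"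
proof -
  note [measurable] = f(1) B(2)
  have C: "C \<ge> 0" using f(2)[of undefined] by linarith
  have "f \<in> borel_measurable lebesgue" using f(1) by (simp add: measurable_completion)
  then have "f measurable_on UNIV" by (rule lebesgue_measurable_imp_measurable_on) simp
  then obtain N g where g: "negligible N" "\<And>n. continuous_on UNIV (g n)" "\<And>x. x \<notin> N \<Longrightarrow> (\<lambda>n. g n x) \<longlonglongrightarrow> f x"
    unfolding measurable_on_def by auto
  (* Truncation at the bound C of f keeps both continuity and the limit. *)
  define h where "h n x = max (- C) (min C (g n x))" for n :: nat and x
  have hc: "continuous_on UNIV (h n)" for n
    unfolding h_def[abs_def] by (intro continuous_intros g)
  have [measurable]: "h n \<in> borel_measurable borel" for n by (rule borel_measurable_continuous_onI[OF hc])
  have hb: "\<bar>h n x\<bar> \<le> C" for n x using C by (auto simp: h_def)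
  have hl: "(\<lambda>n. h n x) \<longlonglongrightarrow> f x" if "x \<notin> N" for x
  proof -
    have "(\<lambda>n. h n x) \<longlonglongrightarrow> max (- C) (min C (f x))"
      unfolding h_def by (intro tendsto_max tendsto_min tendsto_const g that)
    moreover have "max (- C) (min C (f x)) = f x" using f(2)[of x] by auto
    ultimately show ?thesis by simp
  qed
  obtain R where R: "\<And>x. x \<in> B \<Longrightarrow> norm x \<le> R" using B(1) by (auto simp: bounded_iff)
  define B' :: "'a set" where "B' = cball 0 (R + 1)"
  have [measurable]: "B' \<in> sets borel" by (simp add: B'_def)
  have int: "integrable lborel (\<lambda>x. indicator B' x * p x)" "integrable lborel (\<lambda>x. indicator B x * p x)"
    if "p \<in> borel_measurable borel" "\<And>x. \<bar>p x\<bar> \<le> 2 * C" for p :: "'a \<Rightarrow> real"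
  proof -
    note that(1)[measurable]
    show "integrable lborel (\<lambda>x. indicator B' x * p x)"
      by (rule integrable_bounded_support[of _ B' "2 * C"]) (use that C in \<open>auto simp: indicator_def B'_def\<close>)
    show "integrable lborel (\<lambda>x. indicator B x * p x)"
      by (rule integrable_bounded_support[of _ B "2 * C"]) (use that C B in \<open>auto simp: indicator_def\<close>)
  qed
  have b2: "\<bar>\<bar>p - q\<bar>\<bar> \<le> 2 * C" if "\<bar>p\<bar> \<le> C" "\<bar>q\<bar> \<le> C" for p q :: real using that by linarith
  define a where "a n = (LBINT x. indicator B' x * \<bar>h n x - f x\<bar>)" for n
  have a0: "a \<longlonglongrightarrow> 0"
  proof -
    have "(\<lambda>n. LBINT x. indicator B' x * \<bar>h n x - f x\<bar>) \<longlonglongrightarrow> (LINT x|(lborel::'a measure). 0::real)"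
    proof (rule integral_dominated_convergence[where w = "\<lambda>x. indicator B' x * (2 * C)"])
      show "integrable lborel (\<lambda>x::'a. indicator B' x * (2 * C))" by (rule int) (use C in auto)
      have "AE x in lebesgue. x \<notin> N" using g(1) by (rule negligible_iff_null_sets[THEN iffD1, THEN AE_not_in])
      then have "AE x in lborel. x \<notin> N" by (simp add: AE_completion_iff)
      then show "AE x in lborel. (\<lambda>n. indicator B' x * \<bar>h n x - f x\<bar>) \<longlonglongrightarrow> 0"
      proof eventually_elim
        case (elim x)
        have "(\<lambda>n. indicator B' x * \<bar>h n x - f x\<bar>) \<longlonglongrightarrow> indicator B' x * \<bar>f x - f x\<bar>"
          by (intro tendsto_intros hl elim)
        then show ?case by simp
      qed
      show "AE x in lborel. norm (indicator B' x * \<bar>h n x - f x\<bar>) \<le> indicator B' x * (2 * C)" for n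
        using b2[OF hb f(2)] by (intro AE_I2) (auto simp: indicator_def)
    qed auto
    then show ?thesis by (simp add: a_def[abs_def])
  qed
  have d0: "(\<lambda>k. LBINT x. indicator B x * \<bar>h n (x + v k) - h n x\<bar>) \<longlonglongrightarrow> 0" for n
  proof -
    have "(\<lambda>k. LBINT x. indicator B x * \<bar>h n (x + v k) - h n x\<bar>) \<longlonglongrightarrow> (LINT x|(lborel::'a measure). 0::real)"
    proof (rule integral_dominated_convergence[where w = "\<lambda>x. indicator B x * (2 * C)"])
      show "integrable lborel (\<lambda>x::'a. indicator B x * (2 * C))" by (rule int) (use C in auto)
      show "AE x in lborel. (\<lambda>k. indicator B x * \<bar>h n (x + v k) - h n x\<bar>) \<longlonglongrightarrow> 0"
      proof (rule AE_I2)
        fix x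
        have "(\<lambda>k. x + v k) \<longlonglongrightarrow> x + 0" by (intro tendsto_intros v)
        moreover have "isCont (h n) x" using hc[of n] by (simp add: continuous_on_eq_continuous_at)
        ultimately have "(\<lambda>k. h n (x + v k)) \<longlonglongrightarrow> h n x" by (intro isCont_tendsto_compose[of x "h n"]) simp_all
        then have "(\<lambda>k. indicator B x * \<bar>h n (x + v k) - h n x\<bar>) \<longlonglongrightarrow> indicator B x * \<bar>h n x - h n x\<bar>"
          by (intro tendsto_intros)
        then show "(\<lambda>k. indicator B x * \<bar>h n (x + v k) - h n x\<bar>) \<longlonglongrightarrow> 0" by simp
      qed
      show "AE x in lborel. norm (indicator B x * \<bar>h n (x + v k) - h n x\<bar>) \<le> indicator B x * (2 * C)" for k
        using b2[OF hb hb] by (intro AE_I2) (auto simp: indicator_def)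
    qed auto
    then show ?thesis by simp
  qed
  have main: "(LBINT x. indicator B x * \<bar>f (x + v k) - f x\<bar>)
      \<le> 2 * a n + (LBINT x. indicator B x * \<bar>h n (x + v k) - h n x\<bar>)" if k: "norm (v k) \<le> 1" for k n
  proof -
    interpret T: measure_preserving_affine_flow "\<lambda>t x. x + t *\<^sub>R v k" "\<lambda>x. v k" by (rule translation_flow)
    have i1: "integrable lborel (\<lambda>x. indicator B' (x + v k) * \<bar>h n (x + v k) - f (x + v k)\<bar>)"
      using T.integrable_flow[OF int(1)[of "\<lambda>x. \<bar>h n x - f x\<bar>"], of 1] b2[OF hb f(2)] by simp
    have i2: "integrable lborel (\<lambda>x. indicator B' x * \<bar>h n x - f x\<bar>)" by (rule int) (use b2[OF hb f(2)] in auto)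
    have i3: "integrable lborel (\<lambda>x. indicator B x * \<bar>h n (x + v k) - h n x\<bar>)"
      by (rule int) (use b2[OF hb hb] in auto)
    have i4: "integrable lborel (\<lambda>x. indicator B x * \<bar>f (x + v k) - f x\<bar>)"
      by (rule int) (use b2[OF f(2) f(2)] in auto)
    have "(LBINT x. indicator B x * \<bar>f (x + v k) - f x\<bar>)
      \<le> (LBINT x. indicator B' (x + v k) * \<bar>h n (x + v k) - f (x + v k)\<bar> + indicator B' x * \<bar>h n x - f x\<bar>
            + indicator B x * \<bar>h n (x + v k) - h n x\<bar>)"
    proof (rule integral_mono[OF i4 Bochner_Integration.integrable_add[OF Bochner_Integration.integrable_add[OF i1 i2] i3]])
      fix x
      show "indicator B x * \<bar>f (x + v k) - f x\<bar> \<le> indicator B' (x + v k) * \<bar>h n (x + v k) - f (x + v k)\<bar>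
         + indicator B' x * \<bar>h n x - f x\<bar> + indicator B x * \<bar>h n (x + v k) - h n x\<bar>"
      proof (cases "x \<in> B")
        case True
        then have "x + v k \<in> B'" "x \<in> B'" using R[OF True] k norm_triangle_ineq[of x "v k"] by (auto simp: B'_def)
        then show ?thesis using True by simp
      qed simp
    qed
    also have "\<dots> = (LBINT x. indicator B' (x + v k) * \<bar>h n (x + v k) - f (x + v k)\<bar>)
       + (LBINT x. indicator B' x * \<bar>h n x - f x\<bar>) + (LBINT x. indicator B x * \<bar>h n (x + v k) - h n x\<bar>)"
      using i1 i2 i3 by simp
    also have "(LBINT x. indicator B' (x + v k) * \<bar>h n (x + v k) - f (x + v k)\<bar>) = a n"
      unfolding a_def using T.integral_flow[of "\<lambda>x. indicator B' x * \<bar>h n x - f x\<bar>" 1] by simp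
    finally show ?thesis by (simp add: a_def)
  qed
  show ?thesis
  proof (rule LIMSEQ_I)
    fix e :: real assume e: "e > 0"
    obtain n where n: "\<bar>a n\<bar> < e / 4" using LIMSEQ_D[OF a0, of "e / 4"] e by auto
    obtain k1 where k1: "\<And>k. k \<ge> k1 \<Longrightarrow> \<bar>LBINT x. indicator B x * \<bar>h n (x + v k) - h n x\<bar>\<bar> < e / 4"
      using LIMSEQ_D[OF d0[of n], of "e / 4"] e by auto
    obtain k2 where k2: "\<And>k. k \<ge> k2 \<Longrightarrow> norm (v k) < 1" using LIMSEQ_D[OF v, of 1] by auto
    have "norm ((LBINT x. indicator B x * \<bar>f (x + v k) - f x\<bar>) - 0) < e" if "k \<ge> max k1 k2" for k
    proof -
      have "0 \<le> (LBINT x. indicator B x * \<bar>f (x + v k) - f x\<bar>)" by (rule integral_nonneg_AE) simp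
      moreover have "(LBINT x. indicator B x * \<bar>f (x + v k) - f x\<bar>)
         \<le> 2 * a n + (LBINT x. indicator B x * \<bar>h n (x + v k) - h n x\<bar>)"
        using k2[of k] that by (intro main) auto
      ultimately show ?thesis using n k1[of k] that by simp
    qed
    then show "\<exists>no. \<forall>k\<ge>no. norm ((LBINT x. indicator B x * \<bar>f (x + v k) - f x\<bar>) - 0) < e" by blast
  qed
qed

text \<open>A substitute for Rademacher's theorem, with one sequence of step sizes for almost every point
and all directions. For fixed \<open>v\<close> the difference quotient is the mean of \<open>U \<bullet> v\<close> over a short
segment, so it tends to \<open>U \<bullet> v\<close> in \<open>L\<^sup>1(B)\<close>. Integrating over \<open>v\<close> gives convergence in \<open>L\<^sup>1\<close> of
the product space, hence a subsequence along which almost every \<open>x\<close> has convergence for almost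
every \<open>v\<close>; the quotients are uniformly Lipschitz in \<open>v\<close>, so convergence for a dense set of \<open>v\<close>
extends to all of them. That \<open>v\<close> may depend on \<open>x\<close> matters later, when \<open>v\<close> is the radial
direction.\<close>

lemma AE_directional_derivatives:
  fixes \<Phi> :: "'a::euclidean_space \<Rightarrow> real" and U :: "'a \<Rightarrow> 'a"
  assumes \<Phi>: "\<And>x y. \<bar>\<Phi> x - \<Phi> y\<bar> \<le> norm (x - y)"
    and U: "U \<in> borel_measurable borel" "\<And>x. norm (U x) \<le> 1"
    and B: "open B" "bounded B"
    and inc: "\<And>v. AE x in lborel. x \<in> B \<and> x + v \<in> B \<longrightarrow>
      \<Phi> (x + v) - \<Phi> x = (LINT t:{0..1}|lborel. U (x + t *\<^sub>R v) \<bullet> v)"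
  shows "\<exists>r::nat \<Rightarrow> nat. strict_mono r \<and> (AE x in lborel. x \<in> B \<longrightarrow> (\<forall>v. norm v < 2 \<longrightarrow>
    (\<lambda>j. real (Suc (r j)) * (\<Phi> (x + v /\<^sub>R real (Suc (r j))) - \<Phi> x)) \<longlonglongrightarrow> U x \<bullet> v))"
proof -
  note U(1)[measurable]
  have [measurable]: "B \<in> sets borel" using B by simp
  have "continuous_on UNIV \<Phi>"
    by (rule lipschitz_on_continuous_on[of 1]) (use \<Phi> in \<open>auto simp: lipschitz_on_def dist_norm\<close>)
  then have [measurable]: "\<Phi> \<in> borel_measurable borel" by (rule borel_measurable_continuous_onI)
  define s where "s n = real (Suc n)" for n
  have s: "s n > 0" for n by (simp add: s_def)
  have s0: "(\<lambda>n. v /\<^sub>R s n) \<longlonglongrightarrow> 0" for v :: 'a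
    using tendsto_scaleR[OF LIMSEQ_inverse_real_of_nat tendsto_const[of v]] by (simp add: s_def)
  define Q where "Q n x v = s n * (\<Phi> (x + v /\<^sub>R s n) - \<Phi> x) - U x \<bullet> v" for n x v
  (* The radius 2 leaves room for unit vectors in the interior of the range of directions. *)
  define W where "W = ball (0::'a) 2"
  have Qlip: "\<bar>Q n x v - Q n x w\<bar> \<le> 2 * norm (v - w)" for n x v w
  proof -
    have "\<bar>\<Phi> (x + v /\<^sub>R s n) - \<Phi> (x + w /\<^sub>R s n)\<bar> \<le> norm (v - w) / s n"
      using \<Phi>[of "x + v /\<^sub>R s n" "x + w /\<^sub>R s n"] s[of n]
      by (simp add: scaleR_diff_right[symmetric] divide_inverse mult.commute)
    then have "s n * \<bar>\<Phi> (x + v /\<^sub>R s n) - \<Phi> (x + w /\<^sub>R s n)\<bar> \<le> norm (v - w)"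
      using s[of n] by (simp add: field_simps)
    then have 1: "\<bar>s n * (\<Phi> (x + v /\<^sub>R s n) - \<Phi> (x + w /\<^sub>R s n))\<bar> \<le> norm (v - w)"
      using s[of n] by (simp add: abs_mult)
    have 2: "\<bar>U x \<bullet> (v - w)\<bar> \<le> norm (v - w)"
      using Cauchy_Schwarz_ineq2[of "U x" "v - w"] U(2)[of x] mult_left_le_one_le[of "norm (v - w)" "norm (U x)"] by simp
    have "Q n x v - Q n x w = s n * (\<Phi> (x + v /\<^sub>R s n) - \<Phi> (x + w /\<^sub>R s n)) - U x \<bullet> (v - w)"
      by (simp add: Q_def algebra_simps inner_diff_right)
    then show ?thesis using 1 2 by linarith
  qed
  have Q0: "Q n x 0 = 0" for n x by (simp add: Q_def)
  have Qb: "\<bar>Q n x v\<bar> \<le> 4" if "v \<in> W" for n x v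
    using Qlip[of n x v 0] that by (simp add: Q0 W_def)
  have Qm: "(\<lambda>(x, v). Q n x v) \<in> borel_measurable borel" for n
    unfolding Q_def by (simp add: borel_prod[symmetric])
  have [measurable]: "(\<lambda>x. Q n x v) \<in> borel_measurable borel" for n v
    unfolding Q_def by measurable
  define I where "I n v = (LBINT x. indicator B x * \<bar>Q n x v\<bar>)" for n v
  have Bi: "integrable lborel (\<lambda>x. indicator B x * C :: real)" for C
    by (rule integrable_bounded_support[OF _ B(2), of _ "\<bar>C\<bar>"]) (auto simp: indicator_def)
  have I0: "(\<lambda>n. I n v) \<longlonglongrightarrow> 0" if v: "v \<in> W" for v
  proof -
    have vb: "norm v \<le> 2" using v by (simp add: W_def)
    define p where "p x = U x \<bullet> v" for x
    have [measurable]: "p \<in> borel_measurable borel" unfolding p_def[abs_def] by measurable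
    have pb: "\<bar>p x\<bar> \<le> 2" for x
      unfolding p_def by (rule order_trans[OF Cauchy_Schwarz_ineq2])
        (use mult_mono[OF U(2) vb, of x] in simp)
    define E where "E n x = (LBINT t. indicator {0..1} t * \<bar>p (x + t *\<^sub>R (v /\<^sub>R s n)) - p x\<bar>)" for n x
    have Em: "E n \<in> borel_measurable borel" for n unfolding E_def[abs_def] by measurable
    note Em[measurable]
    have Ii: "integrable lborel (\<lambda>t. indicator {0..1} t * q t)" if "q \<in> borel_measurable borel" "\<And>t. \<bar>q t\<bar> \<le> C" for q :: "real \<Rightarrow> real" and C
    proof -
      note that(1)[measurable]
      show ?thesis
        by (rule integrable_bounded_support[of _ "{0..1}" "\<bar>C\<bar>"]) (use that(2) in \<open>auto simp: indicator_def intro: order_trans[OF _ abs_ge_self]\<close>)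
    qed
    have pp: "\<bar>\<bar>p y - p x\<bar>\<bar> \<le> 4" for x y using pb[of x] pb[of y] by linarith
    have Eb: "0 \<le> E n x" "E n x \<le> 4" for n x
    proof -
      show "0 \<le> E n x" unfolding E_def by (rule integral_nonneg_AE) simp
      have "E n x \<le> (LBINT t. indicator {0..1::real} t * 4)"
        unfolding E_def
      proof (rule integral_mono)
        show "integrable lborel (\<lambda>t. indicator {0..1} t * \<bar>p (x + t *\<^sub>R (v /\<^sub>R s n)) - p x\<bar>)"
          by (rule Ii[OF _ pp]) measurable
        show "integrable lborel (\<lambda>t. indicator {0..1::real} t * (4::real))" by (rule Ii[of _ 4]) auto
      qed (use pp in \<open>auto simp: indicator_def\<close>)
      then show "E n x \<le> 4" by simp
    qed
    have E0: "(\<lambda>n. LBINT x. indicator B x * E n x) \<longlonglongrightarrow> 0"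
    proof -
      define h where "h n t = (LBINT x. indicator B x * \<bar>p (x + t *\<^sub>R (v /\<^sub>R s n)) - p x\<bar>)" for n t
      have [measurable]: "h n \<in> borel_measurable borel" for n unfolding h_def[abs_def] by measurable
      have eq: "(LBINT x. indicator B x * E n x) = (LBINT t. indicator {0..1} t * h n t)" for n
      proof -
        have "(LBINT x. indicator B x * E n x)
          = (LBINT x. LBINT t. indicator B x * (indicator {0..1} t * \<bar>p (x + t *\<^sub>R (v /\<^sub>R s n)) - p x\<bar>))"
          by (simp add: E_def)
        also have "\<dots> = (LBINT t. LBINT x. indicator B x * (indicator {0..1} t * \<bar>p (x + t *\<^sub>R (v /\<^sub>R s n)) - p x\<bar>))"
        proof (rule fubini_bounded[OF _ B(2) bounded_closed_interval[of 0 1], of _ 4])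
          show "(\<lambda>(x, t). indicator B x * (indicator {0..1} t * \<bar>p (x + t *\<^sub>R (v /\<^sub>R s n)) - p x\<bar>)) \<in> borel_measurable borel"
            by (simp add: borel_prod[symmetric])
        qed (use pp in \<open>auto simp: indicator_def\<close>)
        also have "\<dots> = (LBINT t. indicator {0..1} t * h n t)"
          by (simp add: h_def mult.left_commute[of "indicator B _"])
        finally show ?thesis .
      qed
      have hb: "\<bar>h n t\<bar> \<le> (LBINT x. indicator B x * 4)" for n t
        unfolding h_def
      proof (rule order_trans[OF integral_abs_bound], rule integral_mono[OF integrable_abs Bi])
        show "integrable lborel (\<lambda>x. indicator B x * \<bar>p (x + t *\<^sub>R (v /\<^sub>R s n)) - p x\<bar>)"
          by (rule integrable_bounded_support[OF _ B(2), of _ 4]) (use pp in \<open>auto simp: indicator_def\<close>)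
      qed (use pp in \<open>auto simp: indicator_def\<close>)
      have "(\<lambda>n. LBINT t. indicator {0..1} t * h n t) \<longlonglongrightarrow> (LINT t|(lborel::real measure). 0::real)"
      proof (rule integral_dominated_convergence[where w = "\<lambda>t. indicator {0..1} t * (LBINT x. indicator B x * 4)"])
        show "integrable lborel (\<lambda>t. indicator {0..1::real} t * (LBINT x. indicator B x * 4 :: real))"
          by (rule Ii[OF _ order_refl]) measurable
        show "AE t in lborel. (\<lambda>n. indicator {0..1} t * h n t) \<longlonglongrightarrow> 0"
        proof (rule AE_I2)
          fix t :: real
          have "(\<lambda>n. t *\<^sub>R (v /\<^sub>R s n)) \<longlonglongrightarrow> t *\<^sub>R 0" by (intro tendsto_scaleR tendsto_const s0)
          then have "(\<lambda>n. h n t) \<longlonglongrightarrow> 0"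
            unfolding h_def by (intro L1_continuity_of_translation[OF _ pb B(2)]) auto
          then show "(\<lambda>n. indicator {0..1} t * h n t) \<longlonglongrightarrow> 0" by (rule tendsto_mult_right_zero)
        qed
        show "AE t in lborel. norm (indicator {0..1} t * h n t) \<le> indicator {0..1} t * (LBINT x. indicator B x * 4)" for n
          using hb by (intro AE_I2) (auto simp: indicator_def)
      qed auto
      then show ?thesis by (simp add: eq)
    qed
    define A where "A n = {x \<in> B. x + v /\<^sub>R s n \<notin> B}" for n
    have [measurable]: "A n \<in> sets borel" for n unfolding A_def by measurable
    have A0: "(\<lambda>n. LBINT x. indicator (A n) x * (4::real)) \<longlonglongrightarrow> 0"
    proof -
      have "(\<lambda>n. LBINT x. indicator (A n) x * (4::real)) \<longlonglongrightarrow> (LINT x|(lborel::'a measure). 0)"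
      proof (rule integral_dominated_convergence[OF _ _ Bi[of 4]])
        show "AE x in lborel. (\<lambda>n. indicator (A n) x * (4::real)) \<longlonglongrightarrow> 0"
        proof (rule AE_I2)
          fix x
          show "(\<lambda>n. indicator (A n) x * (4::real)) \<longlonglongrightarrow> 0"
          proof (cases "x \<in> B")
            case True
            have "(\<lambda>n. x + v /\<^sub>R s n) \<longlonglongrightarrow> x + 0" by (intro tendsto_intros s0)
            then have "eventually (\<lambda>n. x + v /\<^sub>R s n \<in> B) sequentially"
              using topological_tendstoD[OF _ B(1)] True by fastforce
            then show ?thesis by (intro tendsto_eventually) (auto simp: A_def elim!: eventually_mono)
          qed (simp add: A_def)
        qed
      qed (auto simp: A_def indicator_def)
      then show ?thesis by simp
    qed
    have le: "I n v \<le> (LBINT x. indicator B x * E n x) + (LBINT x. indicator (A n) x * 4)" for n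
    proof -
      have j1: "integrable lborel (\<lambda>x. indicator B x * E n x)"
        by (rule integrable_bounded_support[OF _ B(2), of _ 4]) (use Eb in \<open>auto simp: indicator_def\<close>)
      have j2: "integrable lborel (\<lambda>x. indicator (A n) x * 4 :: real)"
        by (rule integrable_bounded_support[OF _ B(2), of _ 4]) (auto simp: indicator_def A_def)
      have j3: "integrable lborel (\<lambda>x. indicator B x * \<bar>Q n x v\<bar>)"
        by (rule integrable_bounded_support[OF _ B(2), of _ 4]) (use Qb[OF v] in \<open>auto simp: indicator_def\<close>)
      have "AE x in lborel. indicator B x * \<bar>Q n x v\<bar> \<le> indicator B x * E n x + indicator (A n) x * 4"
        using inc[of "v /\<^sub>R s n"]
      proof eventually_elim
        case (elim x)
        consider "x \<notin> B" | "x \<in> A n" | "x \<in> B" "x + v /\<^sub>R s n \<in> B" by (auto simp: A_def)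
        then show ?case
        proof cases
          case 2
          then show ?thesis using Qb[OF v, of n x] Eb(1)[of n x] by (auto simp: A_def)
        next
          case 3
          have pi: "integrable lborel (\<lambda>t. indicator {0..1} t * p (x + t *\<^sub>R (v /\<^sub>R s n)))"
            by (rule Ii[OF _ pb]) measurable
          have ci: "integrable lborel (\<lambda>t. indicator {0..1::real} t * p x)" by (rule Ii[OF _ pb]) measurable
          have "\<Phi> (x + v /\<^sub>R s n) - \<Phi> x = (LBINT t. indicator {0..1} t * (U (x + t *\<^sub>R (v /\<^sub>R s n)) \<bullet> (v /\<^sub>R s n)))"
            using elim 3 unfolding set_lebesgue_integral_def real_scaleR_def by blast
          then have "s n * (\<Phi> (x + v /\<^sub>R s n) - \<Phi> x) = (LBINT t. s n * (indicator {0..1} t * (U (x + t *\<^sub>R (v /\<^sub>R s n)) \<bullet> (v /\<^sub>R s n))))"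
            by (simp only: integral_mult_right_zero)
          also have "\<dots> = (LBINT t. indicator {0..1} t * p (x + t *\<^sub>R (v /\<^sub>R s n)))"
            using s[of n] by (intro Bochner_Integration.integral_cong) (auto simp: p_def field_simps)
          finally have "Q n x v = (LBINT t. indicator {0..1} t * p (x + t *\<^sub>R (v /\<^sub>R s n))) - (LBINT t. indicator {0..1::real} t * p x)"
            by (simp add: Q_def p_def)
          also have "\<dots> = (LBINT t. indicator {0..1} t * (p (x + t *\<^sub>R (v /\<^sub>R s n)) - p x))"
            using pi ci by (simp add: right_diff_distrib)
          finally have "\<bar>Q n x v\<bar> \<le> (LBINT t. \<bar>indicator {0..1} t * (p (x + t *\<^sub>R (v /\<^sub>R s n)) - p x)\<bar>)"
            using integral_abs_bound by metis
          also have "\<dots> = E n x" by (simp add: E_def abs_mult)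
          finally show ?thesis using 3 by (simp add: A_def)
        qed (simp add: A_def)
      qed
      then have "I n v \<le> (LBINT x. indicator B x * E n x + indicator (A n) x * 4)"
        unfolding I_def by (intro integral_mono_AE j3 Bochner_Integration.integrable_add j1 j2)
      then show ?thesis using j1 j2 by simp
    qed
    have "(\<lambda>n. (LBINT x. indicator B x * E n x) + (LBINT x. indicator (A n) x * 4)) \<longlonglongrightarrow> 0"
      using tendsto_add[OF E0 A0] by simp
    moreover have "0 \<le> I n v" for n unfolding I_def by (rule integral_nonneg_AE) simp
    ultimately show ?thesis using le
      by (intro tendsto_sandwich[of "\<lambda>_. 0" "\<lambda>n. I n v" sequentially "\<lambda>n. (LBINT x. indicator B x * E n x) + (LBINT x. indicator (A n) x * 4)"]) auto
  qed
  define G where "G n = (\<lambda>(x, v). indicator B x * (indicator W v * Q n x v))" for n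
  have Gm: "G n \<in> borel_measurable borel" for n
  proof -
    have q: "(\<lambda>p. Q n (fst p) (snd p)) \<in> borel_measurable (borel \<Otimes>\<^sub>M borel)"
      using Qm[of n] by (simp add: borel_prod split_beta')
    have w: "(indicator W :: 'a \<Rightarrow> real) \<in> borel_measurable borel" "(indicator B :: 'a \<Rightarrow> real) \<in> borel_measurable borel"
      by (rule borel_measurable_indicator, simp add: W_def) (rule borel_measurable_indicator, simp)
    have "(\<lambda>p. indicator B (fst p) * (indicator W (snd p) * Q n (fst p) (snd p))) \<in> borel_measurable (borel \<Otimes>\<^sub>M borel)"
      by (intro borel_measurable_times q measurable_compose[OF measurable_fst w(2)] measurable_compose[OF measurable_snd w(1)])
    then show ?thesis by (simp add: G_def borel_prod split_beta')
  qed
  have Gb: "\<bar>G n p\<bar> \<le> 4" "p \<notin> B \<times> W \<Longrightarrow> G n p = 0" for n p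
    using Qb by (auto simp: G_def indicator_def split: prod.splits)
  have bBW: "bounded (B \<times> W)" by (intro bounded_Times B) (simp add: W_def)
  have Gi: "integrable lborel (G n)" for n
    by (rule integrable_bounded_support[OF Gm bBW Gb])
  have nG: "(LBINT p. norm (G n p)) = (LBINT v. indicator W v * I n v)" for n
  proof -
    have "integrable (lborel \<Otimes>\<^sub>M lborel) (\<lambda>(x, v). norm (G n (x, v)))"
      using integrable_norm[OF Gi[of n]] by (simp add: lborel_prod split_beta')
    from lborel_pair.integral_snd[OF this]
    have "(LBINT p. norm (G n p)) = (LBINT v. LBINT x. norm (G n (x, v)))"
      by (simp add: lborel_prod split_beta')
    also have "\<dots> = (LBINT v. indicator W v * I n v)"
      by (simp add: G_def I_def abs_mult mult.left_commute[of "indicator B _"])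
    finally show ?thesis .
  qed
  have "(\<lambda>n. LBINT p. norm (G n p)) \<longlonglongrightarrow> 0"
  proof -
    have Imeas: "(\<lambda>v. I n v) \<in> borel_measurable borel" for n
      unfolding I_def Q_def by measurable
    note Imeas[measurable]
    have [measurable]: "W \<in> sets borel" by (simp add: W_def)
    have "(\<lambda>n. LBINT v. indicator W v * I n v) \<longlonglongrightarrow> (LINT v|(lborel::'a measure). 0)"
    proof (rule integral_dominated_convergence[where w = "\<lambda>v. indicator W v * (LBINT x. indicator B x * 4)"])
      show "integrable lborel (\<lambda>v. indicator W v * (LBINT x. indicator B x * 4 :: real))"
        by (rule integrable_bounded_support[of _ W "\<bar>LBINT x. indicator B x * 4 :: real\<bar>"])
           (auto simp: indicator_def W_def)
      show "AE v in lborel. (\<lambda>n. indicator W v * I n v) \<longlonglongrightarrow> 0"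
      proof (rule AE_I2)
        fix v show "(\<lambda>n. indicator W v * I n v) \<longlonglongrightarrow> 0"
          by (cases "v \<in> W") (use I0 in auto)
      qed
      show "AE v in lborel. norm (indicator W v * I n v) \<le> indicator W v * (LBINT x. indicator B x * 4)" for n
      proof (rule AE_I2)
        fix v show "norm (indicator W v * I n v) \<le> indicator W v * (LBINT x. indicator B x * 4)"
        proof (cases "v \<in> W")
          case True
          have "\<bar>I n v\<bar> \<le> (LBINT x. indicator B x * 4)" unfolding I_def
          proof (rule order_trans[OF integral_abs_bound], rule integral_mono[OF integrable_abs Bi])
            show "integrable lborel (\<lambda>x. indicator B x * \<bar>Q n x v\<bar>)"
              by (rule integrable_bounded_support[OF _ B(2), of _ 4]) (use Qb[OF True] in \<open>auto simp: indicator_def\<close>)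
          qed (use Qb[OF True] in \<open>auto simp: indicator_def\<close>)
          then show ?thesis using True by simp
        qed simp
      qed
    qed auto
    then show ?thesis by (simp only: nG integral_zero)
  qed
  from tendsto_L1_AE_subseq[OF Gi this] obtain r :: "nat \<Rightarrow> nat" where r: "strict_mono r"
    and "AE p in lborel. (\<lambda>n. G (r n) p) \<longlonglongrightarrow> 0" by blast
  then have "AE p in lborel \<Otimes>\<^sub>M lborel. (\<lambda>n. G (r n) p) \<longlonglongrightarrow> 0" unfolding lborel_prod by simp
  from lborel_pair.AE_pair[OF this]
  have "AE x in lborel. AE v in lborel. (\<lambda>n. G (r n) (x, v)) \<longlonglongrightarrow> 0" .
  then have "AE x in lborel. x \<in> B \<longrightarrow> (\<forall>v. norm v < 2 \<longrightarrow> (\<lambda>n. Q (r n) x v) \<longlonglongrightarrow> 0)"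
  proof (eventually_elim, intro impI allI)
    fix x v assume ae: "AE v in lborel. (\<lambda>n. G (r n) (x, v)) \<longlonglongrightarrow> 0" and x: "x \<in> B" and v: "norm (v::'a) < 2"
    show "(\<lambda>n. Q (r n) x v) \<longlonglongrightarrow> 0"
    proof (rule LIMSEQ_I)
      fix e :: real assume e: "e > 0"
      have "W \<inter> ball v (e / 4) \<noteq> {}" using v e by (auto simp: W_def)
      moreover have "open (W \<inter> ball v (e / 4))" unfolding W_def by (intro open_Int open_ball)
      ultimately obtain w where w: "w \<in> W" "w \<in> ball v (e / 4)" "(\<lambda>n. G (r n) (x, w)) \<longlonglongrightarrow> 0"
        using AE_imp_dense[OF _ _ ae] by blast
      then have "(\<lambda>n. Q (r n) x w) \<longlonglongrightarrow> 0" using x by (simp add: G_def)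
      then obtain n0 where n0: "\<And>n. n \<ge> n0 \<Longrightarrow> \<bar>Q (r n) x w\<bar> < e / 2"
        using LIMSEQ_D[of "\<lambda>n. Q (r n) x w" 0 "e / 2"] e by auto
      have "norm (v - w) < e / 4" using w(2) by (simp add: dist_norm)
      then have "norm (Q (r n) x v - 0) < e" if "n \<ge> n0" for n
        using n0[OF that] Qlip[of "r n" x v w] by simp
      then show "\<exists>no. \<forall>n\<ge>no. norm (Q (r n) x v - 0) < e" by blast
    qed
  qed
  then have "AE x in lborel. x \<in> B \<longrightarrow> (\<forall>v. norm v < 2 \<longrightarrow>
    (\<lambda>j. real (Suc (r j)) * (\<Phi> (x + v /\<^sub>R real (Suc (r j))) - \<Phi> x)) \<longlonglongrightarrow> U x \<bullet> v)"
    by (simp add: Q_def s_def LIM_zero_iff[of _ "U _ \<bullet> _"])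
  then show ?thesis using r by blast
qed

section \<open>Vector fields with pairwise coplanar lines\<close>

text \<open>Orthogonal projection to the complement of \<open>d\<close>. For \<open>d = 0\<close> the convention \<open>x / 0 = 0\<close> makes it
the identity, as it should be.\<close>

definition proj_perp :: "'b::euclidean_space \<Rightarrow> 'b \<Rightarrow> 'b" where
  "proj_perp d a = a - ((a \<bullet> d) / (d \<bullet> d)) *\<^sub>R d"

text \<open>Equality in the Cauchy-Schwarz inequality: the projections of \<open>a\<close> and \<open>b\<close> to the complement of
\<open>d\<close> are nonnegative multiples of one vector. As an equation between continuous expressions this
is a Borel condition.\<close>

definition compatible :: "'b::euclidean_space \<Rightarrow> 'b \<Rightarrow> 'b \<Rightarrow> bool" where
  "compatible d a b \<longleftrightarrow> proj_perp d a \<bullet> proj_perp d b = norm (proj_perp d a) * norm (proj_perp d b)"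

lemma proj_perp_orthogonal: "proj_perp d a \<bullet> d = 0"
  by (cases "d = 0") (auto simp: proj_perp_def inner_diff_left)

lemma inner_proj_perp: "proj_perp d a \<bullet> b = a \<bullet> proj_perp d b"
  by (simp add: proj_perp_def inner_diff_left inner_diff_right inner_commute)

lemma proj_perp_linear:
  "proj_perp d (a + b) = proj_perp d a + proj_perp d b" "proj_perp d (k *\<^sub>R a) = k *\<^sub>R proj_perp d a"
  by (simp_all add: proj_perp_def inner_add_left add_divide_distrib algebra_simps)

lemma proj_perp_self: "proj_perp d d = 0"
  by (cases "d = 0") (auto simp: proj_perp_def)

lemma proj_perp_eq_0: "proj_perp d a = 0 \<Longrightarrow> \<exists>s. a = s *\<^sub>R d"
  by (auto simp: proj_perp_def)

text \<open>If equality fails in Cauchy-Schwarz, then the difference of the two normalised projections has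
positive inner product with the first and negative inner product with the second. These are open
conditions, so some member of the dense set satisfies them too.\<close>

lemma compatible_of_half_spaces:
  assumes dense: "\<And>S. open S \<Longrightarrow> S \<noteq> {} \<Longrightarrow> \<exists>q\<in>Q. q \<in> S"
    and half: "\<And>q. q \<in> Q \<Longrightarrow> a \<bullet> proj_perp d q > 0 \<longleftrightarrow> b \<bullet> proj_perp d q > 0"
  shows "compatible d a b"
proof (rule ccontr)
  let ?p = "proj_perp d a" and ?q = "proj_perp d b"
  assume "\<not> compatible d a b"
  then have ne: "?p \<bullet> ?q \<noteq> norm ?p * norm ?q" by (simp add: compatible_def)
  then have p: "?p \<noteq> 0" and q: "?q \<noteq> 0" by auto
  have lt: "?p \<bullet> ?q < norm ?p * norm ?q" using norm_cauchy_schwarz[of ?p ?q] ne by linarith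
  (* A direction that separates the two projections. *)
  define e where "e = ?p /\<^sub>R norm ?p - ?q /\<^sub>R norm ?q"
  have "?p \<bullet> e = norm ?p - (?p \<bullet> ?q) / norm ?q"
    using p by (simp add: e_def inner_diff_right dot_square_norm power2_eq_square divide_inverse mult.commute)
  moreover have "(?p \<bullet> ?q) / norm ?q < norm ?p" using lt q by (simp add: divide_less_eq)
  ultimately have pe: "?p \<bullet> e > 0" by linarith
  have "?q \<bullet> e = (?p \<bullet> ?q) / norm ?p - norm ?q"
    using q by (simp add: e_def inner_diff_right dot_square_norm power2_eq_square divide_inverse mult.commute inner_commute)
  moreover have "(?p \<bullet> ?q) / norm ?p < norm ?q" using lt p by (simp add: divide_less_eq mult.commute)
  ultimately have qe: "?q \<bullet> e < 0" by linarith
  have "open {x. ?p \<bullet> x > 0 \<and> ?q \<bullet> x < 0}"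
    by (intro open_Collect_conj open_Collect_less continuous_intros)
  with dense pe qe obtain x where "x \<in> Q" "?p \<bullet> x > 0" "?q \<bullet> x < 0" by blast
  then show False using half[of x] by (simp add: inner_proj_perp)
qed

text \<open>If \<open>a\<close> is not a multiple of \<open>d\<close>, then \<open>b\<close> lies in the plane spanned by \<open>a\<close> and \<open>d\<close>. For \<open>a\<close>, \<open>b\<close>
attached to points that differ by \<open>d\<close>, this is coplanarity of the two lines.\<close>

lemma compatible_decompose:
  assumes "compatible d a b" "proj_perp d a \<noteq> 0"
  obtains l m where "b = l *\<^sub>R a + m *\<^sub>R d"
proof -
  let ?p = "proj_perp d a" and ?q = "proj_perp d b"
  have "norm ?p *\<^sub>R ?q = norm ?q *\<^sub>R ?p"
    using assms(1) by (simp add: compatible_def norm_cauchy_schwarz_eq)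
  then have "?q = (norm ?q / norm ?p) *\<^sub>R ?p"
    using assms(2) by (metis divide_inverse_commute eq_vector_fraction_iff norm_eq_zero)
  then have "b = (norm ?q / norm ?p) *\<^sub>R a + ((b \<bullet> d) / (d \<bullet> d) - (norm ?q / norm ?p) * ((a \<bullet> d) / (d \<bullet> d))) *\<^sub>R d"
    by (simp add: proj_perp_def algebra_simps)
  then show ?thesis using that by blast
qed

text \<open>For a fixed translation \<open>v\<close>, countably many directions orthogonal to \<open>X v\<close> suffice, namely the
projections of a countable dense set; this keeps the exceptional null set under control.\<close>

lemma kinetic_compatible:
  fixes W X :: "'a::euclidean_space \<Rightarrow> 'b::euclidean_space"
  assumes W: "W \<in> borel_measurable borel" and X: "linear X"
    and B: "open B" "bounded B" "convex B"
    and kin: "\<And>\<xi> v. norm \<xi> = 1 \<Longrightarrow> X v \<bullet> \<xi> = 0 \<Longrightarrow> \<forall>\<eta>\<in>test_functions B.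
      (LBINT x. (indicator B x * (if W x \<bullet> \<xi> > 0 then 1 else 0)) * dderiv \<eta> v x) = 0"
  shows "AE x in lborel. AE y in lborel. x \<in> B \<and> y \<in> B \<longrightarrow> compatible (X y - X x) (W x) (W y)"
proof -
  note W[measurable]
  have [measurable]: "B \<in> sets borel" using B by simp
  have [measurable]: "X \<in> borel_measurable borel"
    using X by (intro borel_measurable_continuous_onI linear_continuous_on) (simp add: linear_conv_bounded_linear)
  obtain Q :: "'b set" where Q: "countable Q" "\<And>S. open S \<Longrightarrow> S \<noteq> {} \<Longrightarrow> \<exists>q\<in>Q. q \<in> S"
    using countable_dense_setE by blast
  have half: "AE x in lborel. x \<in> B \<and> x + v \<in> B \<longrightarrow> (W x \<bullet> \<xi> > 0 \<longleftrightarrow> W (x + v) \<bullet> \<xi> > 0)"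
    if v: "X v \<bullet> \<xi> = 0" for \<xi> v
  proof (cases "\<xi> = 0")
    case False
    define u where "u = \<xi> /\<^sub>R norm \<xi>"
    have u: "norm u = 1" "X v \<bullet> u = 0" using False v by (auto simp: u_def)
    have sgn: "W x \<bullet> u > 0 \<longleftrightarrow> W x \<bullet> \<xi> > 0" for x using False by (auto simp: u_def zero_less_mult_iff)
    let ?h = "\<lambda>x. indicator B x * (if W x \<bullet> u > 0 then 1 else 0) :: real"
    have h: "bounded_borel_on B ?h"
      unfolding bounded_borel_on_def using B by (auto intro!: exI[of _ 1] simp: indicator_def)
    have z: "bounded_borel_on B (\<lambda>x. 0)" using B by (auto simp: bounded_borel_on_def)
    have "AE x in lborel. x \<in> B \<and> x + v \<in> B \<longrightarrow> ?h (x + v) - ?h x = (LINT t:{0..1::real}|lborel. 0)"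
      by (rule weak_derivative_increment[OF h z B(1,3)]) (use kin[OF u] in simp)
    then show ?thesis
      by eventually_elim (auto simp: sgn set_lebesgue_integral_def split: if_splits)
  qed simp
  have comp: "AE x in lborel. x \<in> B \<and> x + v \<in> B \<longrightarrow> compatible (X v) (W x) (W (x + v))" for v
  proof -
    have "AE x in lborel. \<forall>q\<in>Q. x \<in> B \<and> x + v \<in> B \<longrightarrow> (W x \<bullet> proj_perp (X v) q > 0 \<longleftrightarrow> W (x + v) \<bullet> proj_perp (X v) q > 0)"
      using Q(1) half by (subst AE_ball_countable) (auto simp: inner_commute[of "X v"] proj_perp_orthogonal)
    then show ?thesis
      by eventually_elim (auto intro: compatible_of_half_spaces[OF Q(2)])
  qed
  have "AE x in lborel. AE y in lborel. (case (x, y) of (x, y) \<Rightarrow> x \<in> B \<and> y \<in> B \<longrightarrow> compatible (X y - X x) (W x) (W y))"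
  proof (rule AE_pairs_of_translations)
    show "Measurable.pred borel (\<lambda>(x, y). x \<in> B \<and> y \<in> B \<longrightarrow> compatible (X y - X x) (W x) (W y))"
    proof -
      have [measurable]: "(\<lambda>p. proj_perp (X (snd p) - X (fst p)) (W (fst p))) \<in> borel_measurable (borel \<Otimes>\<^sub>M borel)"
        "(\<lambda>p. proj_perp (X (snd p) - X (fst p)) (W (snd p))) \<in> borel_measurable (borel \<Otimes>\<^sub>M borel)"
        unfolding proj_perp_def by measurable
      have "Measurable.pred (borel \<Otimes>\<^sub>M borel) (\<lambda>p. fst p \<in> B \<and> snd p \<in> B \<longrightarrow> compatible (X (snd p) - X (fst p)) (W (fst p)) (W (snd p)))"
        unfolding compatible_def by measurable
      then show ?thesis by (simp add: borel_prod split_beta')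
    qed
  qed (use comp in \<open>simp add: linear_add[OF X]\<close>)
  then show ?thesis by simp
qed

lemma AE_ex_conj:
  assumes "AE x in M. P x" "\<not> (AE x in M. Q x)" shows "\<exists>x. P x \<and> \<not> Q x"
  using assms by (metis (mono_tags, lifting) eventually_mono)

text \<open>Either the lines are parallel to a typical one, or there are two lines, through \<open>X x\<close> and \<open>X y\<close>,
that are coplanar and not parallel, so they meet in a point \<open>P\<close>. A line through a point off
their common plane that is coplanar with both must pass through \<open>P\<close>. Dimension at least 3 is
what makes the plane a null set.\<close>

lemma compatible_field_direction:
  fixes W X :: "'a::euclidean_space \<Rightarrow> 'b::euclidean_space"
  assumes dim: "DIM('b) \<ge> 3"
    and hyp: "\<And>\<nu> c. \<nu> \<noteq> 0 \<Longrightarrow> AE x in lborel. X x \<bullet> \<nu> \<noteq> c"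
    and W: "\<And>x. W x \<noteq> 0" and B: "open B" "B \<noteq> {}"
    and comp: "AE x in lborel. AE y in lborel. x \<in> B \<and> y \<in> B \<longrightarrow> compatible (X y - X x) (W x) (W y)"
  shows "\<exists>E. ((\<exists>w. norm w = 1 \<and> E = (\<lambda>x. w)) \<or> (\<exists>P. E = (\<lambda>x. X x - P))) \<and>
    (AE x in lborel. x \<in> B \<longrightarrow> (\<exists>k. W x = k *\<^sub>R E x))"
proof (cases "AE x in lborel. x \<in> B \<longrightarrow> (AE y in lborel. y \<in> B \<longrightarrow> (\<exists>k. W y = k *\<^sub>R W x))")
  case True
  obtain x where x: "x \<in> B" "AE y in lborel. y \<in> B \<longrightarrow> (\<exists>k. W y = k *\<^sub>R W x)"
    using AE_imp_dense[OF B True] by blast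
  define w where "w = W x /\<^sub>R norm (W x)"
  have w: "W x = norm (W x) *\<^sub>R w" "norm w = 1" using W[of x] by (auto simp: w_def)
  from x(2) have "AE y in lborel. y \<in> B \<longrightarrow> (\<exists>k. W y = k *\<^sub>R w)"
    by eventually_elim (metis w(1) scaleR_scaleR)
  then show ?thesis using w(2) by blast
next
  case False
  obtain x where x: "AE y in lborel. x \<in> B \<and> y \<in> B \<longrightarrow> compatible (X y - X x) (W x) (W y)"
    "x \<in> B" "\<not> (AE y in lborel. y \<in> B \<longrightarrow> (\<exists>k. W y = k *\<^sub>R W x))"
    using AE_ex_conj[OF comp False] by blast
  have "AE y in lborel. (x \<in> B \<and> y \<in> B \<longrightarrow> compatible (X y - X x) (W x) (W y)) \<and>
      (AE z in lborel. y \<in> B \<and> z \<in> B \<longrightarrow> compatible (X z - X y) (W y) (W z))"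
    using x(1) comp by eventually_elim blast
  from AE_ex_conj[OF this x(3)] obtain y where y: "y \<in> B" "compatible (X y - X x) (W x) (W y)"
    "AE z in lborel. y \<in> B \<and> z \<in> B \<longrightarrow> compatible (X z - X y) (W y) (W z)" "\<And>k. W y \<noteq> k *\<^sub>R W x"
    using x(2) by blast
  define a b d where "a = W x" and "b = W y" and "d = X y - X x"
  have ab: "a \<noteq> 0" "b \<noteq> 0" "\<And>k. b \<noteq> k *\<^sub>R a" using W y(4) by (auto simp: a_def b_def)
  (* The lines through X x and X y are coplanar and not parallel: this is their intersection. *)
  obtain k k' where d: "d = k *\<^sub>R a - k' *\<^sub>R b"
  proof (cases "proj_perp d a = 0")
    case True
    then obtain s where s: "a = s *\<^sub>R d" using proj_perp_eq_0 by blast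
    then have "s \<noteq> 0" using ab by auto
    then have "d = (1 / s) *\<^sub>R a - 0 *\<^sub>R b" using s by simp
    then show ?thesis by (rule that)
  next
    case False
    obtain l m where lm: "b = l *\<^sub>R a + m *\<^sub>R d"
      using compatible_decompose[OF _ False, of b] y(2) by (auto simp: a_def b_def d_def)
    then have "m \<noteq> 0" using ab(3)[of l] by auto
    have "(1 / m) *\<^sub>R b = (1 / m) *\<^sub>R (l *\<^sub>R a) + d" using \<open>m \<noteq> 0\<close> by (subst lm) (simp add: scaleR_right_distrib)
    then have "d = (- (l / m)) *\<^sub>R a - (- (1 / m)) *\<^sub>R b" by (simp add: algebra_simps)
    then show ?thesis by (rule that)
  qed
  define P where "P = X x + k *\<^sub>R a"
  have P': "P = X y + k' *\<^sub>R b" using d by (simp add: P_def d_def algebra_simps)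
  have "dim {a, b} \<le> card {a, b}" by (rule dim_le_card') simp
  also have "\<dots> \<le> 2" by (simp add: card_insert_if)
  finally have "dim {a, b} < DIM('b)" using dim by linarith
  from orthogonal_to_subspace_exists[OF this] obtain \<nu> where \<nu>: "\<nu> \<noteq> 0" "\<And>y. y \<in> span {a, b} \<Longrightarrow> orthogonal \<nu> y"
    by blast
  have \<nu>ab: "a \<bullet> \<nu> = 0" "b \<bullet> \<nu> = 0" using \<nu>(2)[of a] \<nu>(2)[of b] by (auto simp: orthogonal_def inner_commute span_base)
  (* Write W z in terms of a and e, and in terms of b and e. The normal vector of the plane of a
     and b shows that the coefficients of e agree, so the multiples of a and b are equal and
     hence zero. *)
  have "AE z in lborel. z \<in> B \<longrightarrow> (\<exists>k. W z = k *\<^sub>R (X z - P))"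
    using x(1) y(3) hyp[OF \<nu>(1), of "P \<bullet> \<nu>"]
  proof (eventually_elim, intro impI)
    fix z assume z: "x \<in> B \<and> z \<in> B \<longrightarrow> compatible (X z - X x) (W x) (W z)"
      "y \<in> B \<and> z \<in> B \<longrightarrow> compatible (X z - X y) (W y) (W z)" "X z \<bullet> \<nu> \<noteq> P \<bullet> \<nu>" "z \<in> B"
    define e where "e = X z - P"
    have e: "e \<bullet> \<nu> \<noteq> 0" using z(3) by (simp add: e_def inner_diff_left)
    have one: "\<exists>l m. W z = l *\<^sub>R p + m *\<^sub>R e"
      if p: "compatible (e + c *\<^sub>R p) p (W z)" "p \<noteq> 0" "p \<bullet> \<nu> = 0" for c p
    proof -
      have "proj_perp (e + c *\<^sub>R p) p \<noteq> 0"
      proof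
        assume "proj_perp (e + c *\<^sub>R p) p = 0"
        then obtain s where s: "p = s *\<^sub>R (e + c *\<^sub>R p)" using proj_perp_eq_0 by blast
        have "p \<bullet> \<nu> = s * (e \<bullet> \<nu> + c * (p \<bullet> \<nu>))" by (subst s) (simp add: inner_add_left)
        then have "s = 0" using p(3) e by simp
        then show False using s p(2) by simp
      qed
      from compatible_decompose[OF p(1) this] obtain l m where "W z = l *\<^sub>R p + m *\<^sub>R (e + c *\<^sub>R p)" .
      then have "W z = (l + m * c) *\<^sub>R p + m *\<^sub>R e" by (simp add: algebra_simps)
      then show ?thesis by blast
    qed
    have "X z - X x = e + k *\<^sub>R a" by (simp add: e_def P_def)
    moreover have "X z - X y = e + k' *\<^sub>R b" by (simp add: e_def P')
    ultimately have c: "compatible (e + k *\<^sub>R a) a (W z)" "compatible (e + k' *\<^sub>R b) b (W z)"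
      using z x(2) y(1) by (auto simp: a_def b_def)
    obtain l m where 1: "W z = l *\<^sub>R a + m *\<^sub>R e" using one[OF c(1) ab(1) \<nu>ab(1)] by blast
    obtain l' m' where 2: "W z = l' *\<^sub>R b + m' *\<^sub>R e" using one[OF c(2) ab(2) \<nu>ab(2)] by blast
    have "W z \<bullet> \<nu> = m * (e \<bullet> \<nu>)" "W z \<bullet> \<nu> = m' * (e \<bullet> \<nu>)"
      by (subst 1, simp add: inner_add_left \<nu>ab) (subst 2, simp add: inner_add_left \<nu>ab)
    then have "m = m'" using e by simp
    then have lab: "l *\<^sub>R a = l' *\<^sub>R b" using 1 2 by simp
    have "l' = 0"
    proof (rule ccontr)
      assume "l' \<noteq> 0"
      then have "b = (l / l') *\<^sub>R a" using lab by (metis divide_inverse_commute scaleR_scaleR scaleR_one left_inverse)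
      then show False using ab(3) by blast
    qed
    then have "W z = m' *\<^sub>R (X z - P)" using 2 by (simp add: e_def)
    then show "\<exists>k. W z = k *\<^sub>R (X z - P)" by blast
  qed
  then show ?thesis by (intro exI[of _ "\<lambda>x. X x - P"]) blast
qed

lemma exists_unit_orthogonal:
  fixes e :: "'b::euclidean_space"
  assumes "DIM('b) \<ge> 2"
  shows "\<exists>g. norm g = 1 \<and> g \<bullet> e = 0"
proof -
  have "dim {e} \<le> card {e}" by (rule dim_le_card') simp
  then have "dim {e} < DIM('b)" using assms by simp
  from orthogonal_to_subspace_exists[OF this] obtain g where g: "g \<noteq> 0" "\<And>y. y \<in> span {e} \<Longrightarrow> orthogonal g y" by blast
  then have "g \<bullet> e = 0" by (simp add: orthogonal_def span_base)
  then show ?thesis using g(1) by (intro exI[of _ "g /\<^sub>R norm g"]) simp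
qed

text \<open>At two points \<open>E\<close> has the same projection to the complement of the connecting vector, and it is
nonzero for generic pairs. Compatibility then forces the two proportionality factors to have the
same sign.\<close>

lemma compatible_field_sign:
  fixes W X E :: "'a::euclidean_space \<Rightarrow> 'b::euclidean_space"
  assumes dim: "DIM('b) \<ge> 2"
    and hyp: "\<And>\<nu> c. \<nu> \<noteq> 0 \<Longrightarrow> AE x in lborel. X x \<bullet> \<nu> \<noteq> c"
    and W: "\<And>x. W x \<noteq> 0"
    and comp: "AE x in lborel. AE y in lborel. x \<in> B \<and> y \<in> B \<longrightarrow> compatible (X y - X x) (W x) (W y)"
    and E: "(\<exists>w. norm w = 1 \<and> E = (\<lambda>x. w)) \<or> (\<exists>P. E = (\<lambda>x. X x - P))"
    and WE: "AE x in lborel. x \<in> B \<longrightarrow> (\<exists>k. W x = k *\<^sub>R E x)"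
  shows "\<exists>\<sigma>\<in>{1, - 1}. AE x in lborel. x \<in> B \<longrightarrow> E x \<noteq> 0 \<and> W x = (\<sigma> * (norm (W x) / norm (E x))) *\<^sub>R E x"
proof -
  have pE: "proj_perp (X y - X x) (E y) = proj_perp (X y - X x) (E x)" for x y
    using E
  proof (elim disjE exE conjE)
    fix P assume "E = (\<lambda>x. X x - P)"
    then have "E y = E x + (X y - X x)" by simp
    then show ?thesis by (simp add: proj_perp_linear proj_perp_self)
  qed simp
  have fin: "E x \<noteq> 0 \<and> W x = (\<sigma> * (norm (W x) / norm (E x))) *\<^sub>R E x"
    if "W x = k *\<^sub>R E x" "\<sigma> * k > 0" "\<sigma> \<in> {1, - 1}" for x k \<sigma>
  proof -
    have "E x \<noteq> 0" using W[of x] that(1) by auto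
    moreover have "\<sigma> * (norm (W x) / norm (E x)) = k" using that \<open>E x \<noteq> 0\<close> by auto
    ultimately show ?thesis using that(1) by simp
  qed
  show ?thesis
  proof (cases "AE x in lborel. x \<in> B \<longrightarrow> (\<exists>k>0. W x = k *\<^sub>R E x)")
    case True
    then have "AE x in lborel. x \<in> B \<longrightarrow> E x \<noteq> 0 \<and> W x = (1 * (norm (W x) / norm (E x))) *\<^sub>R E x"
      by eventually_elim (metis fin insertI1 mult_1)
    then show ?thesis by blast
  next
    case False
    have "AE x in lborel. (AE y in lborel. x \<in> B \<and> y \<in> B \<longrightarrow> compatible (X y - X x) (W x) (W y)) \<and> (x \<in> B \<longrightarrow> (\<exists>k. W x = k *\<^sub>R E x))"
      using comp WE by eventually_elim blast
    from AE_ex_conj[OF this False] obtain x k where x: "x \<in> B" "W x = k *\<^sub>R E x"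
      "AE y in lborel. x \<in> B \<and> y \<in> B \<longrightarrow> compatible (X y - X x) (W x) (W y)" "\<not> (\<exists>k>0. W x = k *\<^sub>R E x)"
      by blast
    have "k \<noteq> 0" using W[of x] x(2) by auto
    then have k: "k < 0" using x(2,4) by (meson linorder_neqE_linordered_idom)
    have Ex: "E x \<noteq> 0" using W[of x] x(2) by auto
    obtain \<nu> where \<nu>1: "norm \<nu> = 1" "\<nu> \<bullet> E x = 0" using exists_unit_orthogonal[OF dim] by blast
    then have \<nu>: "\<nu> \<noteq> 0" "orthogonal \<nu> (E x)" by (auto simp: orthogonal_def)
    have "AE y in lborel. y \<in> B \<longrightarrow> E y \<noteq> 0 \<and> W y = ((- 1) * (norm (W y) / norm (E y))) *\<^sub>R E y"
      using x(3) WE hyp[OF \<nu>(1), of "X x \<bullet> \<nu>"]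
    proof (eventually_elim, intro impI)
      fix y assume y: "x \<in> B \<and> y \<in> B \<longrightarrow> compatible (X y - X x) (W x) (W y)" "y \<in> B \<longrightarrow> (\<exists>k. W y = k *\<^sub>R E y)"
        "X y \<bullet> \<nu> \<noteq> X x \<bullet> \<nu>" "y \<in> B"
      define d where "d = X y - X x"
      define \<pi> where "\<pi> = proj_perp d (E x)"
      have "\<pi> \<noteq> 0"
      proof
        assume "\<pi> = 0"
        then obtain s where s: "E x = s *\<^sub>R d" using proj_perp_eq_0[of d "E x"] by (auto simp: \<pi>_def)
        then have "s \<noteq> 0" using Ex by auto
        moreover have "s * (d \<bullet> \<nu>) = 0" using \<nu>(2) s by (simp add: orthogonal_def inner_commute)
        ultimately show False using y(3) by (simp add: d_def inner_diff_left)
      qed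
      obtain l where l: "W y = l *\<^sub>R E y" using y by blast
      have "compatible d (W x) (W y)" using y x(1) by (simp add: d_def)
      then have "(k * l) * (norm \<pi>)\<^sup>2 = \<bar>k\<bar> * \<bar>l\<bar> * (norm \<pi>)\<^sup>2"
        using pE[of y x] unfolding compatible_def x(2) l
        by (simp add: proj_perp_linear \<pi>_def d_def dot_square_norm power2_eq_square mult_ac)
      then have "k * l = \<bar>k\<bar> * \<bar>l\<bar>" using \<open>\<pi> \<noteq> 0\<close> by simp
      moreover have "l \<noteq> 0" using W[of y] l by auto
      ultimately have "l < 0" using k by (simp add: abs_if split: if_splits)
      then show "E y \<noteq> 0 \<and> W y = ((- 1) * (norm (W y) / norm (E y))) *\<^sub>R E y"
        using fin[OF l, of "- 1"] by simp
    qed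
    then show ?thesis by blast
  qed
qed

section \<open>Rotations\<close>

text \<open>Uniqueness of Haar measure: evaluate \<open>\<integral>\<integral> 1\<^sub>A(x) 1\<^sub>B(x + y)\<close> with respect to \<open>\<mu>\<close> and Lebesgue
measure in both orders.\<close>

lemma translation_invariant_measure_unique:
  fixes \<mu> :: "'a::euclidean_space measure"
  assumes \<mu>: "sigma_finite_measure \<mu>" "sets \<mu> = sets borel" "\<And>c. distr \<mu> borel (\<lambda>x. x + c) = \<mu>"
    and A: "A \<in> sets borel" and B: "B \<in> sets borel"
  shows "emeasure \<mu> A * emeasure lborel B = emeasure \<mu> B * emeasure lborel A"
proof -
  interpret \<mu>: sigma_finite_measure \<mu> by fact
  interpret P: pair_sigma_finite lborel \<mu> ..
  note [measurable_cong] = \<mu>(2)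
  note [measurable] = A B
  have reflect: "distr lborel borel (\<lambda>y. x - y) = lborel" for x :: 'a
    using lborel_affine[of "- 1" x] by (simp add: density_1)
  have plus: "distr lborel borel (\<lambda>y. x + y) = lborel" for x :: 'a
    using lborel_distr_plus[of x] .
  have "(\<integral>\<^sup>+x. \<integral>\<^sup>+y. indicator A x * indicator B (x + y) \<partial>lborel \<partial>\<mu>) = (\<integral>\<^sup>+x. indicator A x * emeasure lborel B \<partial>\<mu>)"
  proof (intro nn_integral_cong)
    fix x
    have "(\<integral>\<^sup>+y. indicator B (x + y) \<partial>lborel) = (\<integral>\<^sup>+y. indicator B y \<partial>distr lborel borel (\<lambda>y. x + y))"
      by (subst nn_integral_distr) auto
    also have "\<dots> = emeasure lborel B" unfolding plus by simp
    finally show "(\<integral>\<^sup>+y. indicator A x * indicator B (x + y) \<partial>lborel) = indicator A x * emeasure lborel B"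
      by (simp add: nn_integral_cmult)
  qed
  then have l: "(\<integral>\<^sup>+x. \<integral>\<^sup>+y. indicator A x * indicator B (x + y) \<partial>lborel \<partial>\<mu>) = emeasure \<mu> A * emeasure lborel B"
    by (simp add: nn_integral_multc \<mu>(2))
  have "(\<integral>\<^sup>+x. \<integral>\<^sup>+y. indicator A x * indicator B (x + y) \<partial>lborel \<partial>\<mu>) = (\<integral>\<^sup>+y. \<integral>\<^sup>+x. indicator A x * indicator B (x + y) \<partial>\<mu> \<partial>lborel)"
    by (rule P.Fubini') measurable
  also have "\<dots> = (\<integral>\<^sup>+y. \<integral>\<^sup>+x. indicator A (x - y) * indicator B x \<partial>\<mu> \<partial>lborel)"
  proof (rule nn_integral_cong)
    fix y
    have "(\<integral>\<^sup>+x. indicator A (x - y) * indicator B x \<partial>\<mu>) = (\<integral>\<^sup>+x. indicator A (x - y) * indicator B x \<partial>distr \<mu> borel (\<lambda>x. x + y))"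
      by (simp add: \<mu>(3))
    also have "\<dots> = (\<integral>\<^sup>+x. indicator A x * indicator B (x + y) \<partial>\<mu>)"
      by (subst nn_integral_distr) auto
    finally show "(\<integral>\<^sup>+x. indicator A x * indicator B (x + y) \<partial>\<mu>) = (\<integral>\<^sup>+x. indicator A (x - y) * indicator B x \<partial>\<mu>)" ..
  qed
  also have "\<dots> = (\<integral>\<^sup>+x. \<integral>\<^sup>+y. indicator A (x - y) * indicator B x \<partial>lborel \<partial>\<mu>)"
    by (rule P.Fubini'[symmetric]) measurable
  also have "\<dots> = (\<integral>\<^sup>+x. emeasure lborel A * indicator B x \<partial>\<mu>)"
  proof (intro nn_integral_cong)
    fix x
    have "(\<integral>\<^sup>+y. indicator A (x - y) \<partial>lborel) = (\<integral>\<^sup>+y. indicator A y \<partial>distr lborel borel (\<lambda>y. x - y))"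
      by (subst nn_integral_distr) auto
    also have "\<dots> = emeasure lborel A" unfolding reflect by simp
    finally show "(\<integral>\<^sup>+y. indicator A (x - y) * indicator B x \<partial>lborel) = emeasure lborel A * indicator B x"
      by (simp add: nn_integral_multc)
  qed
  also have "\<dots> = emeasure \<mu> B * emeasure lborel A"
    by (subst nn_integral_cmult) (auto simp: \<mu>(2) mult.commute)
  finally show ?thesis using l by simp
qed

text \<open>The image measure is translation invariant, and it agrees with Lebesgue measure on the unit
ball.\<close>

lemma orthogonal_preserves_lborel:
  fixes L :: "'a::euclidean_space \<Rightarrow> 'a"
  assumes L: "linear L" "\<And>x. norm (L x) = norm x"
  shows "distr lborel borel L = lborel"
proof -
  have L': "orthogonal_transformation L" using L by (simp add: orthogonal_transformation)
  have [measurable]: "L \<in> borel_measurable borel"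
    using L(1) by (intro borel_measurable_continuous_onI linear_continuous_on) (simp add: linear_conv_bounded_linear)
  let ?\<mu> = "distr lborel borel L"
  have ball: "emeasure ?\<mu> (ball 0 r) = emeasure lborel (ball (0::'a) r)" for r
  proof -
    have "L -` ball 0 r = ball 0 r" using L(2) by auto
    then show ?thesis by (simp add: emeasure_distr)
  qed
  have sf: "sigma_finite_measure ?\<mu>"
  proof
    have "(\<Union>n::nat. ball 0 (real n)) = (UNIV :: 'a set)"
    proof (intro set_eqI iffI UNIV_I)
      fix x :: 'a
      obtain n :: nat where "norm x < real n" using reals_Archimedean2 by blast
      then show "x \<in> (\<Union>n::nat. ball 0 (real n))" by auto
    qed
    moreover have "emeasure ?\<mu> (ball 0 (real n)) \<noteq> \<infinity>" for n :: nat
      unfolding ball using emeasure_lborel_ball_finite[of "0::'a" "real n"] by simp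
    ultimately show "\<exists>A. countable A \<and> A \<subseteq> sets ?\<mu> \<and> \<Union> A = space ?\<mu> \<and> (\<forall>a\<in>A. emeasure ?\<mu> a \<noteq> \<infinity>)"
      by (intro exI[of _ "range (\<lambda>n::nat. ball 0 (real n))"] conjI ballI) (auto simp del: infinity_ennreal_def)
  qed
  have inv: "distr ?\<mu> borel (\<lambda>x. x + c) = ?\<mu>" for c
  proof -
    obtain d where d: "c = L d" using orthogonal_transformation_surj[OF L'] by (metis surjD)
    have "distr ?\<mu> borel (\<lambda>x. x + c) = distr lborel borel (\<lambda>x. L (x + d))"
      by (subst distr_distr) (auto simp: comp_def d linear_add[OF L(1)])
    also have "\<dots> = distr (distr lborel borel (\<lambda>x. x + d)) borel L"
      by (subst distr_distr) (auto simp: comp_def)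
    finally show ?thesis by (simp add: lborel_distr_translation)
  qed
  show ?thesis
  proof (rule measure_eqI)
    fix A assume "A \<in> sets ?\<mu>"
    then have A: "A \<in> sets borel" by simp
    have "emeasure ?\<mu> A * emeasure lborel (ball (0::'a) 1) = emeasure ?\<mu> (ball 0 1) * emeasure lborel A"
      by (rule translation_invariant_measure_unique[OF sf _ inv A]) auto
    then have eq: "emeasure lborel (ball (0::'a) 1) * emeasure ?\<mu> A = emeasure lborel (ball (0::'a) 1) * emeasure lborel A"
      by (simp add: ball mult.commute)
    have fin: "emeasure lborel (ball (0::'a) 1) \<noteq> \<infinity>" using emeasure_lborel_ball_finite[of "0::'a" 1] by auto
    have pos: "emeasure lborel (ball (0::'a) 1) \<noteq> 0"
    proof
      assume "emeasure lborel (ball (0::'a) 1) = 0"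
      then have "ball (0::'a) 1 \<in> null_sets lborel" by (intro null_setsI) auto
      then have "negligible (ball (0::'a) 1)" by (simp add: negligible_iff_null_sets null_sets_completionI)
      then show False using open_not_negligible[of "ball (0::'a) 1"] by auto
    qed
    show "emeasure ?\<mu> A = emeasure lborel A"
      using eq fin pos by (simp add: ennreal_mult_cancel_left)
  qed simp
qed

text \<open>Rotation by the angle \<open>t\<close> in the plane of the orthonormal vectors \<open>a\<close>, \<open>b\<close>, turning \<open>a\<close> towards
\<open>b\<close>; the identity on the orthogonal complement.\<close>

definition rotate_plane :: "'b::euclidean_space \<Rightarrow> 'b \<Rightarrow> real \<Rightarrow> 'b \<Rightarrow> 'b" where
  "rotate_plane a b t y = y + ((cos t - 1) * (y \<bullet> a) - sin t * (y \<bullet> b)) *\<^sub>R a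
     + (sin t * (y \<bullet> a) + (cos t - 1) * (y \<bullet> b)) *\<^sub>R b"

definition rotation_about :: "'b::euclidean_space \<Rightarrow> 'b \<Rightarrow> 'b \<Rightarrow> real \<Rightarrow> 'b \<times> real \<Rightarrow> 'b \<times> real" where
  "rotation_about P a b t x = (P + rotate_plane a b t (fst x - P), snd x)"

context
  fixes a b :: "'b::euclidean_space"
  assumes ab: "norm a = 1" "norm b = 1" "a \<bullet> b = 0"
begin

lemma rotate_plane_inner:
  "rotate_plane a b t y \<bullet> a = cos t * (y \<bullet> a) - sin t * (y \<bullet> b)"
  "rotate_plane a b t y \<bullet> b = sin t * (y \<bullet> a) + cos t * (y \<bullet> b)"
proof -
  have [simp]: "a \<bullet> a = 1" "b \<bullet> b = 1" "b \<bullet> a = 0" using ab by (simp_all add: dot_square_norm inner_commute)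
  show "rotate_plane a b t y \<bullet> a = cos t * (y \<bullet> a) - sin t * (y \<bullet> b)"
    "rotate_plane a b t y \<bullet> b = sin t * (y \<bullet> a) + cos t * (y \<bullet> b)"
    using ab(3) by (simp_all add: rotate_plane_def inner_add_left algebra_simps)
qed

lemma rotate_plane_linear: "linear (rotate_plane a b t)"
  by (simp add: linear_iff rotate_plane_def inner_add_left algebra_simps)

lemma rotate_plane_norm: "norm (rotate_plane a b t y) = norm y"
proof -
  have [simp]: "a \<bullet> a = 1" "b \<bullet> b = 1" "b \<bullet> a = 0" using ab by (simp_all add: dot_square_norm inner_commute)
  define p q where "p = y \<bullet> a" and "q = y \<bullet> b"
  define \<alpha> \<beta> where "\<alpha> = (cos t - 1) * p - sin t * q" and "\<beta> = sin t * p + (cos t - 1) * q"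
  have "rotate_plane a b t y \<bullet> rotate_plane a b t y = y \<bullet> y + (2 * (\<alpha> * p + \<beta> * q) + \<alpha>\<^sup>2 + \<beta>\<^sup>2)"
    using ab(3) unfolding rotate_plane_def p_def[symmetric] q_def[symmetric] \<alpha>_def[symmetric] \<beta>_def[symmetric]
    by (simp add: inner_add_left inner_add_right inner_commute[of a y] inner_commute[of b y] p_def[symmetric] q_def[symmetric] power2_eq_square algebra_simps)
  also have "2 * (\<alpha> * p + \<beta> * q) + \<alpha>\<^sup>2 + \<beta>\<^sup>2 = 0"
  proof -
    have "2 * (((c - 1) * p - s * q) * p + (s * p + (c - 1) * q) * q) + ((c - 1) * p - s * q)\<^sup>2 + (s * p + (c - 1) * q)\<^sup>2
        = (p\<^sup>2 + q\<^sup>2) * (c\<^sup>2 + s\<^sup>2 - 1)" for c s by algebra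
    from this[of "cos t" "sin t"]
    have "2 * (\<alpha> * p + \<beta> * q) + \<alpha>\<^sup>2 + \<beta>\<^sup>2 = (p\<^sup>2 + q\<^sup>2) * ((cos t)\<^sup>2 + (sin t)\<^sup>2 - 1)"
      unfolding \<alpha>_def \<beta>_def .
    then show ?thesis by simp
  qed
  finally show ?thesis by (simp add: norm_eq_sqrt_inner)
qed

lemma rotate_plane_add: "rotate_plane a b (s + t) y = rotate_plane a b s (rotate_plane a b t y)"
proof -
  have "rotate_plane a b s (rotate_plane a b t y) = rotate_plane a b t y
      + ((cos s - 1) * (cos t * (y \<bullet> a) - sin t * (y \<bullet> b)) - sin s * (sin t * (y \<bullet> a) + cos t * (y \<bullet> b))) *\<^sub>R a
      + (sin s * (cos t * (y \<bullet> a) - sin t * (y \<bullet> b)) + (cos s - 1) * (sin t * (y \<bullet> a) + cos t * (y \<bullet> b))) *\<^sub>R b"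
    unfolding rotate_plane_def[of a b s] rotate_plane_inner ..
  also have "\<dots> = rotate_plane a b (s + t) y"
    unfolding rotate_plane_def cos_add sin_add by (simp add: algebra_simps)
  finally show ?thesis ..
qed

lemma rotation_flow:
  "measure_preserving_affine_flow (rotation_about P a b)
     (\<lambda>x. (((fst x - P) \<bullet> a) *\<^sub>R b - ((fst x - P) \<bullet> b) *\<^sub>R a, 0))"
proof
  fix s t :: real and x :: "'b \<times> real" and S :: "('b \<times> real) set"
  let ?L = "\<lambda>x::'b \<times> real. (rotate_plane a b t (fst x), snd x)"
  have L: "linear ?L" using rotate_plane_linear[of t] by (auto simp: linear_iff)
  have M: "rotation_about P a b t = (\<lambda>x. ?L x + (P - rotate_plane a b t P, 0))"
    by (auto simp: rotation_about_def linear_diff[OF rotate_plane_linear] fun_eq_iff)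
  show "\<exists>L k. linear L \<and> rotation_about P a b t = (\<lambda>x. L x + k)" using L M by blast
  have Ln: "norm (?L x) = norm x" for x by (simp add: norm_prod_def rotate_plane_norm)
  show "distr lborel borel (rotation_about P a b t) = lborel"
  proof -
    have [measurable]: "?L \<in> borel_measurable borel"
      using L by (intro borel_measurable_continuous_onI linear_continuous_on) (simp add: linear_conv_bounded_linear)
    have "distr lborel borel (rotation_about P a b t) = distr (distr lborel borel ?L) borel (\<lambda>x. x + (P - rotate_plane a b t P, 0))"
      unfolding M by (subst distr_distr) (auto simp: comp_def)
    then show ?thesis by (simp only: orthogonal_preserves_lborel[OF L Ln] lborel_distr_translation)
  qed
  show "rotation_about P a b (s + t) x = rotation_about P a b s (rotation_about P a b t x)"
    by (simp add: rotation_about_def rotate_plane_add)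
  show "rotation_about P a b 0 x = x" by (simp add: rotation_about_def rotate_plane_def)
  show "((\<lambda>t. rotation_about P a b t x) has_vector_derivative (((fst x - P) \<bullet> a) *\<^sub>R b - ((fst x - P) \<bullet> b) *\<^sub>R a, 0)) (at 0)"
    unfolding rotation_about_def rotate_plane_def has_vector_derivative_def
    by (auto intro!: derivative_eq_intros simp: algebra_simps)
  assume "bounded S"
  then obtain R where R: "\<And>x. x \<in> S \<Longrightarrow> norm x \<le> R" by (auto simp: bounded_iff)
  have "norm (rotation_about P a b t x - x) \<le> (4 * (\<bar>R\<bar> + norm P)) * \<bar>t\<bar>" if x: "x \<in> S" for x t
  proof -
    define p q where "p = (fst x - P) \<bullet> a" and "q = (fst x - P) \<bullet> b"
    have n: "norm (fst x - P) \<le> \<bar>R\<bar> + norm P"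
      using R[OF x] norm_triangle_ineq4[of "fst x" P] norm_fst_le[of "fst x" "snd x"] by auto
    have pq: "\<bar>p\<bar> \<le> \<bar>R\<bar> + norm P" "\<bar>q\<bar> \<le> \<bar>R\<bar> + norm P"
      using Cauchy_Schwarz_ineq2[of "fst x - P" a] Cauchy_Schwarz_ineq2[of "fst x - P" b] n ab by (auto simp: p_def q_def)
    have ct: "\<bar>cos t - 1\<bar> \<le> \<bar>t\<bar>" "\<bar>sin t\<bar> \<le> \<bar>t\<bar>"
    proof -
      show "\<bar>sin t\<bar> \<le> \<bar>t\<bar>" by (rule abs_sin_x_le_abs_x)
      have "\<bar>cos t - 1\<bar> = 2 * (sin (t / 2))\<^sup>2" using cos_double_sin[of "t / 2"] by simp
      also have "\<dots> = 2 * (\<bar>sin (t / 2)\<bar> * \<bar>sin (t / 2)\<bar>)" by (simp add: power2_eq_square abs_mult_self_eq)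
      also have "\<dots> \<le> 2 * (\<bar>t / 2\<bar> * 1)"
        using abs_sin_x_le_abs_x[of "t / 2"] by (intro mult_left_mono mult_mono) auto
      finally show "\<bar>cos t - 1\<bar> \<le> \<bar>t\<bar>" by simp
    qed
    have bd: "\<bar>c * p'\<bar> \<le> \<bar>t\<bar> * (\<bar>R\<bar> + norm P)" if "\<bar>c\<bar> \<le> \<bar>t\<bar>" "\<bar>p'\<bar> \<le> \<bar>R\<bar> + norm P" for c p' :: real
      unfolding abs_mult using that by (intro mult_mono) auto
    have "rotation_about P a b t x - x = (((cos t - 1) * p - sin t * q) *\<^sub>R a + (sin t * p + (cos t - 1) * q) *\<^sub>R b, 0)"
      by (cases x) (simp add: rotation_about_def rotate_plane_def p_def q_def)
    then have "norm (rotation_about P a b t x - x) = norm (((cos t - 1) * p - sin t * q) *\<^sub>R a + (sin t * p + (cos t - 1) * q) *\<^sub>R b)"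
      by (simp add: norm_prod_def)
    also have "\<dots> \<le> \<bar>(cos t - 1) * p - sin t * q\<bar> + \<bar>sin t * p + (cos t - 1) * q\<bar>"
      using norm_triangle_ineq[of "((cos t - 1) * p - sin t * q) *\<^sub>R a" "(sin t * p + (cos t - 1) * q) *\<^sub>R b"] ab by simp
    also have "\<dots> \<le> 4 * (\<bar>t\<bar> * (\<bar>R\<bar> + norm P))"
      using bd[OF ct(1) pq(1)] bd[OF ct(2) pq(2)] bd[OF ct(2) pq(1)] bd[OF ct(1) pq(2)] by linarith
    finally show ?thesis by (simp add: mult_ac)
  qed
  then show "\<exists>C\<ge>0. \<forall>x\<in>S. \<forall>t. \<bar>t\<bar> \<le> 1 \<longrightarrow> norm (rotation_about P a b t x - x) \<le> C * \<bar>t\<bar>"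
    by (intro exI[of _ "4 * (\<bar>R\<bar> + norm P)"]) auto
qed

end

section \<open>Borel representatives and null sets\<close>

lemma integral_lebesgue_on_eq:
  fixes f g :: "'a::euclidean_space \<Rightarrow> real"
  assumes S: "S \<in> sets lebesgue" and f: "f \<in> borel_measurable (lebesgue_on S)" and g: "g \<in> borel_measurable borel"
    and ae: "AE x in lborel. x \<in> S \<longrightarrow> f x = g x" and out: "\<And>x. x \<notin> S \<Longrightarrow> g x = 0"
  shows "(LINT x|lebesgue_on S. f x) = (LBINT x. g x)"
proof -
  have fS: "(\<lambda>x. indicator S x *\<^sub>R f x) \<in> borel_measurable lebesgue"
    using f S borel_measurable_restrict_space_iff[of S lebesgue f] by simp
  have gl: "g \<in> borel_measurable lebesgue" using g by (simp add: measurable_completion)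
  have "(LINT x|lebesgue_on S. f x) = (LINT x|lebesgue. indicator S x *\<^sub>R f x)"
    by (rule integral_restrict_space) (use S in simp)
  also have "\<dots> = (LINT x|lebesgue. g x)"
  proof (rule integral_cong_AE[OF fS gl])
    have "AE x in lebesgue. x \<in> S \<longrightarrow> f x = g x" using ae by (rule AE_completion)
    then show "AE x in lebesgue. indicator S x *\<^sub>R f x = g x"
      by eventually_elim (auto simp: indicator_def out)
  qed
  also have "\<dots> = (LBINT x. g x)" by (rule integral_completion) (use g in simp)
  finally show ?thesis .
qed

text \<open>Lebesgue measurable functions are almost everywhere limits of continuous functions, and
pointwise limits of sequences of Borel functions are Borel where they exist.\<close>

lemma borel_representative:
  fixes u :: "'a::euclidean_space \<Rightarrow> 'b::euclidean_space"
  assumes "S \<in> sets lebesgue" "u \<in> borel_measurable (lebesgue_on S)"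
  obtains v where "v \<in> borel_measurable borel" "AE x in lborel. x \<in> S \<longrightarrow> v x = u x"
proof -
  have "u measurable_on S" using assms measurable_on_iff_borel_measurable by blast
  then obtain N g where g: "negligible N" "\<And>n. continuous_on UNIV (g n)"
    "\<And>x. x \<notin> N \<Longrightarrow> (\<lambda>n. g n x) \<longlonglongrightarrow> (if x \<in> S then u x else 0)"
    unfolding measurable_on_def by blast
  have [measurable]: "g n \<in> borel_measurable borel" for n by (rule borel_measurable_continuous_onI[OF g(2)])
  have "AE x in lebesgue. x \<notin> N" using g(1) by (rule negligible_iff_null_sets[THEN iffD1, THEN AE_not_in])
  then have "AE x in lborel. x \<notin> N" by (simp add: AE_completion_iff)
  then have "AE x in lborel. x \<in> S \<longrightarrow> lim (\<lambda>n. g n x) = u x"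
    by eventually_elim (use g(3) limI in fastforce)
  moreover have "(\<lambda>x. lim (\<lambda>n. g n x)) \<in> borel_measurable borel" by measurable
  ultimately show ?thesis using that by blast
qed

lemma AE_lborel_negligible: "negligible N \<Longrightarrow> AE x in lborel. x \<notin> N"
  using AE_not_in[of N lebesgue] by (simp add: AE_completion_iff negligible_iff_null_sets)

lemma negligible_of_AE: "AE x in lborel. x \<notin> N \<Longrightarrow> negligible N"
proof -
  assume "AE x in lborel. x \<notin> N"
  then have "AE x in lebesgue. x \<notin> N" by (rule AE_completion)
  then obtain N' where "{x \<in> space lebesgue. \<not> x \<notin> N} \<subseteq> N'" "emeasure lebesgue N' = 0" "N' \<in> sets lebesgue"
    by (rule AE_E)
  then have "N \<subseteq> N'" "negligible N'" by (auto simp: negligible_iff_null_sets)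
  then show "negligible N" using negligible_subset by blast
qed

lemma AE_fst_not_in_hyperplane:
  fixes \<nu> :: "'b::euclidean_space"
  assumes "\<nu> \<noteq> 0"
  shows "AE x in (lborel :: ('b \<times> 'c::euclidean_space) measure). fst x \<bullet> \<nu> \<noteq> c"
proof -
  have "negligible {x :: 'b \<times> 'c. (\<nu>, 0) \<bullet> x = c}"
    using assms by (intro negligible_hyperplane) (auto simp: prod_eq_iff)
  from AE_lborel_negligible[OF this] show ?thesis
    by eventually_elim (auto simp: inner_prod_def inner_commute)
qed

section \<open>Fields tangent to the fibres\<close>

text \<open>The two alternatives for the direction of the horizontal part. Treating them as one kind of
field lets the translations along the planes \<open>w \<bullet> x' = const\<close> and the rotations about \<open>P\<close> be
handled by the same formulas.\<close>

definition direction_field :: "('b::euclidean_space \<times> real \<Rightarrow> 'b) \<Rightarrow> bool" where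
  "direction_field E \<longleftrightarrow> (\<exists>w. norm w = 1 \<and> E = (\<lambda>x. w)) \<or> (\<exists>P. E = (\<lambda>x. fst x - P))"

lemma direction_field_cases:
  assumes "direction_field E"
  obtains w where "norm w = 1" "E = (\<lambda>x. w)" | P where "E = (\<lambda>x. fst x - P)"
  using assms unfolding direction_field_def by blast

lemma direction_field_borel: "direction_field E \<Longrightarrow> E \<in> borel_measurable borel"
  by (erule direction_field_cases) (auto simp: borel_prod[symmetric])

abbreviation tangent_field :: "('b::euclidean_space \<times> real \<Rightarrow> 'b) \<Rightarrow> 'b \<Rightarrow> 'b \<Rightarrow> 'b \<times> real \<Rightarrow> 'b \<times> real" where
  "tangent_field E a b x \<equiv> ((E x \<bullet> a) *\<^sub>R b - (E x \<bullet> b) *\<^sub>R a, 0)"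

lemma direction_field_flow:
  assumes E: "direction_field E" and ab: "norm a = 1" "norm b = 1" "a \<bullet> b = 0"
  shows "\<exists>M. measure_preserving_affine_flow M (tangent_field E a b) \<and> (\<forall>t x. norm (E (M t x)) = norm (E x))"
  using E
proof (cases rule: direction_field_cases)
  case (1 w)
  then show ?thesis using translation_flow[of "((w \<bullet> a) *\<^sub>R b - (w \<bullet> b) *\<^sub>R a, 0::real)"] by auto
next
  case (2 P)
  have "norm (E (rotation_about P a b t x)) = norm (E x)" for t x
    by (simp add: 2 rotation_about_def rotate_plane_norm[OF ab])
  then show ?thesis using rotation_flow[OF ab, of P] 2 by auto
qed

text \<open>The components of \<open>E\<close> are affine functions, so they may multiply test functions, and those
orthogonal to the direction of differentiation are constant in that direction.\<close>

lemma direction_field_component: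
  fixes E :: "'b::euclidean_space \<times> real \<Rightarrow> 'b"
  assumes "direction_field E"
  shows "smooth (\<lambda>x. E x \<bullet> a)" "a \<bullet> b = 0 \<Longrightarrow> dderiv (\<lambda>x. E x \<bullet> a) (b, s) x = 0"
proof -
  obtain A k where eq: "(\<lambda>x. E x \<bullet> a) = (\<lambda>x. A \<bullet> x + k)" and A: "a \<bullet> b = 0 \<Longrightarrow> A \<bullet> (b, s) = 0"
    using assms
  proof (cases rule: direction_field_cases)
    case (1 w)
    show ?thesis by (rule that[of 0 "w \<bullet> a"]) (simp_all add: 1)
  next
    case (2 P)
    show ?thesis
      by (rule that[of "(a, 0)" "- (P \<bullet> a)"]) (auto simp: 2 inner_prod_def inner_diff_left inner_commute[of a])
  qed
  show "smooth (\<lambda>x. E x \<bullet> a)" unfolding eq by (rule smooth_affine)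
  show "dderiv (\<lambda>x. E x \<bullet> a) (b, s) x = 0" if "a \<bullet> b = 0"
    unfolding eq dderiv_affine using A[OF that] .
qed

lemma dderiv_tangent:
  assumes "smooth \<eta>"
  shows "dderiv \<eta> (tangent_field E a b x) x = (E x \<bullet> a) * dderiv \<eta> (b, 0) x - (E x \<bullet> b) * dderiv \<eta> (a, 0) x"
proof -
  note lin = smooth_dderiv_linear[OF assms, of x]
  have "tangent_field E a b x = (E x \<bullet> a) *\<^sub>R (b, 0) - (E x \<bullet> b) *\<^sub>R (a, 0)" by simp
  then show ?thesis using linear_diff[OF lin] linear_scale[OF lin] by (metis real_scaleR_def)
qed

text \<open>The field \<open>(E \<bullet> a) b - (E \<bullet> b) a\<close> is orthogonal to \<open>E\<close> and divergence free. Moving the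
coefficients \<open>E \<bullet> a\<close>, \<open>E \<bullet> b\<close> into the test function leaves the antisymmetric combination
\<open>(W \<bullet> b) (E \<bullet> a) - (W \<bullet> a) (E \<bullet> b)\<close>, which vanishes because \<open>W\<close> is parallel to \<open>E\<close>. The operator
\<open>T\<close> is the vertical derivative when \<open>f\<close> is the vertical component of the field, and minus the
identity when \<open>f\<close> is a potential.\<close>

lemma tangential_weak_derivative:
  fixes W :: "'b::euclidean_space \<times> real \<Rightarrow> 'b"
  assumes E: "direction_field E" and f: "bounded_borel_on B f"
    and W: "W \<in> borel_measurable borel" "\<And>x. x \<notin> B \<Longrightarrow> W x = 0"
    and WE: "AE x in lborel. x \<in> B \<longrightarrow> (\<exists>k. W x = k *\<^sub>R E x)"
    and T: "\<And>\<eta>. \<eta> \<in> test_functions B \<Longrightarrow> T \<eta> \<in> test_functions B"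
      "\<And>\<eta> a x. \<eta> \<in> test_functions B \<Longrightarrow> T (\<lambda>x. (E x \<bullet> a) * \<eta> x) x = (E x \<bullet> a) * T \<eta> x"
    and weak: "\<And>a \<eta>. \<eta> \<in> test_functions B \<Longrightarrow>
      (LBINT x. f x * dderiv \<eta> (a, 0) x) = (LBINT x. (W x \<bullet> a) * T \<eta> x)"
    and ab: "a \<bullet> b = 0"
  shows "\<forall>\<eta>\<in>test_functions B. (LBINT x. f x * dderiv \<eta> (tangent_field E a b x) x) = 0"
proof
  fix \<eta> assume \<eta>: "\<eta> \<in> test_functions B"
  have sm: "smooth \<eta>" using \<eta> by (simp add: test_functions_iff)
  note [measurable] = bounded_borel_on_borel[OF f] W(1)
  obtain C where C: "\<And>x. \<bar>f x\<bar> \<le> C" using bounded_borel_onE[OF f] by metis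
  define \<theta> where "\<theta> p x = (E x \<bullet> p) * \<eta> x" for p x
  have \<theta>: "\<theta> p \<in> test_functions B" for p
    unfolding \<theta>_def[abs_def] by (rule test_functions_mult[OF \<eta> direction_field_component(1)[OF E]])
  have d\<theta>: "dderiv (\<theta> p) (q, 0) x = (E x \<bullet> p) * dderiv \<eta> (q, 0) x" if "p \<bullet> q = 0" for p q x
    unfolding \<theta>_def[abs_def]
    by (simp add: dderiv_mult[OF direction_field_component(1)[OF E] sm] direction_field_component(2)[OF E that])
  have ba: "b \<bullet> a = 0" using ab by (simp add: inner_commute)
  have int: "integrable lborel (\<lambda>x. f x * dderiv (\<theta> p) v x)" for p v
    by (rule integrable_mult_test[OF _ C test_functions_dderiv[OF \<theta>]]) simp
  have [measurable]: "T (\<theta> p) \<in> borel_measurable borel" for p by (rule test_functions_borel[OF T(1)[OF \<theta>]])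
  have "(LBINT x. f x * dderiv \<eta> (tangent_field E a b x) x)
      = (LBINT x. f x * dderiv (\<theta> a) (b, 0) x - f x * dderiv (\<theta> b) (a, 0) x)"
    by (simp only: dderiv_tangent[OF sm] d\<theta>[OF ab] d\<theta>[OF ba] right_diff_distrib)
  also have "\<dots> = (LBINT x. f x * dderiv (\<theta> a) (b, 0) x) - (LBINT x. f x * dderiv (\<theta> b) (a, 0) x)"
    by (rule Bochner_Integration.integral_diff[OF int int])
  also have "\<dots> = (LBINT x. (W x \<bullet> b) * T (\<theta> a) x) - (LBINT x. (W x \<bullet> a) * T (\<theta> b) x)"
    by (simp only: weak[OF \<theta>])
  also have "(LBINT x. (W x \<bullet> b) * T (\<theta> a) x) = (LBINT x. (W x \<bullet> a) * T (\<theta> b) x)"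
  proof (rule integral_cong_AE)
    show "AE x in lborel. (W x \<bullet> b) * T (\<theta> a) x = (W x \<bullet> a) * T (\<theta> b) x"
      using WE
    proof eventually_elim
      case (elim x)
      show ?case
      proof (cases "x \<in> B")
        case True
        then obtain k where "W x = k *\<^sub>R E x" using elim by blast
        then show ?thesis unfolding \<theta>_def[abs_def] T(2)[OF \<eta>] by simp
      qed (simp add: W(2))
    qed
  qed measurable
  finally show "(LBINT x. f x * dderiv \<eta> (tangent_field E a b x) x) = 0" by simp
qed

text \<open>Since \<open>fst U = \<plusminus>\<bar>fst U\<bar> E / \<bar>E\<bar>\<close>, the difference of the two sides is \<open>\<plusminus>\<integral> (\<bar>fst U\<bar> / \<bar>E\<bar>) Z \<phi>\<close> with
\<open>Z\<close> tangent to the fibres. The factor \<open>\<bar>fst U\<bar> = sqrt (1 - (snd U)\<^sup>2)\<close> is a function of \<open>snd U\<close>,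
whose derivative along \<open>Z\<close> vanishes by the curl equation, and \<open>\<bar>E\<bar>\<close> is invariant under the flow of
\<open>Z\<close>.\<close>

lemma horizontal_curl_free:
  fixes U :: "'b::euclidean_space \<times> real \<Rightarrow> 'b \<times> real"
  assumes B: "open B" "bounded B" and E: "direction_field E" and \<sigma>: "\<sigma> \<in> {1, - 1 :: real}"
    and U: "U \<in> borel_measurable borel" "\<And>x. x \<in> B \<Longrightarrow> norm (U x) = 1" "\<And>x. x \<notin> B \<Longrightarrow> U x = 0"
    and UE: "AE x in lborel. x \<in> B \<longrightarrow> E x \<noteq> 0 \<and> fst (U x) = (\<sigma> * (norm (fst (U x)) / norm (E x))) *\<^sub>R E x"
    and curl: "\<And>a \<eta>. \<eta> \<in> test_functions B \<Longrightarrow>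
      (LBINT x. snd (U x) * dderiv \<eta> (a, 0) x) = (LBINT x. (fst (U x) \<bullet> a) * dderiv \<eta> (0, 1) x)"
    and ab: "norm a = 1" "norm b = 1" "a \<bullet> b = 0" and \<phi>: "\<phi> \<in> test_functions B"
  shows "(LBINT x. (fst (U x) \<bullet> a) * dderiv \<phi> (b, 0) x) = (LBINT x. (fst (U x) \<bullet> b) * dderiv \<phi> (a, 0) x)"
proof -
  have [measurable]: "(\<lambda>x. fst (U x)) \<in> borel_measurable borel" "(\<lambda>x. snd (U x)) \<in> borel_measurable borel"
    using U(1) by (simp_all add: borel_prod[symmetric])
  have [measurable]: "B \<in> sets borel" using B by simp
  note direction_field_borel[OF E, measurable]
  have sm: "smooth \<phi>" using \<phi> by (simp add: test_functions_iff)
  have [measurable]: "dderiv \<phi> v \<in> borel_measurable borel" for v by (intro smooth_borel smooth_dderiv sm)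
  define h where "h x = snd (U x)" for x
  have hb: "\<bar>h x\<bar> \<le> 1" for x
    using norm_snd_le[of "snd (U x)" "fst (U x)"] U(2)[of x] U(3)[of x] by (cases "x \<in> B") (auto simp: h_def)
  have h: "bounded_borel_on B h"
    unfolding bounded_borel_on_def using B(2) hb U(3) by (auto simp: h_def[abs_def] intro!: exI[of _ 1])
  have Wn: "norm (fst (U x)) = sqrt (1 - (h x)\<^sup>2)" if "x \<in> B" for x
  proof -
    have "(norm (U x))\<^sup>2 = (norm (fst (U x)))\<^sup>2 + (h x)\<^sup>2"
      by (simp add: norm_prod_def h_def)
    then have "(norm (fst (U x)))\<^sup>2 = 1 - (h x)\<^sup>2" using U(2)[OF that] by simp
    then show ?thesis by (metis norm_ge_zero real_sqrt_unique)
  qed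
  have Wb: "norm (fst (U x)) \<le> 1" for x
    using norm_fst_le[of "fst (U x)" "snd (U x)"] U(2)[of x] U(3)[of x] by (cases "x \<in> B") auto
  have WE: "AE x in lborel. x \<in> B \<longrightarrow> (\<exists>k. fst (U x) = k *\<^sub>R E x)"
    using UE by eventually_elim blast
  have weak: "\<forall>\<eta>\<in>test_functions B. (LBINT x. h x * dderiv \<eta> (tangent_field E a b x) x) = 0"
  proof (rule tangential_weak_derivative[where W = "\<lambda>x. fst (U x)" and T = "\<lambda>\<eta>. dderiv \<eta> (0, 1)", OF E h _ _ WE])
    show "dderiv (\<lambda>x. (E x \<bullet> p) * \<eta> x) (0, 1) x = (E x \<bullet> p) * dderiv \<eta> (0, 1) x"
      if "\<eta> \<in> test_functions B" for \<eta> p x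
      using that by (simp add: dderiv_mult[OF direction_field_component(1)[OF E]] direction_field_component(2)[OF E] test_functions_iff)
  qed (auto simp: U(3) h_def curl test_functions_dderiv ab(3))
  obtain M where M: "measure_preserving_affine_flow M (tangent_field E a b)" "\<And>t x. norm (E (M t x)) = norm (E x)"
    using direction_field_flow[OF E ab] by blast
  (* The weight 1 / norm (E x) is unbounded near a zero of E. Truncation makes it bounded, and
     since the tangent field has norm at most 2 * norm (E x), the limit is dominated. *)
  define \<kappa> where "\<kappa> n x = 1 / max (1 / real (Suc n)) (norm (E x))" for n x
  define G where "G n x = indicator B x * (sqrt (1 - (h x)\<^sup>2) * \<kappa> n x)" for n x
  have \<kappa>pos: "0 < max (1 / real (Suc n)) (norm (E x))" for n x by (simp add: less_max_iff_disj)
  have \<kappa>b: "0 \<le> \<kappa> n x" "\<kappa> n x \<le> real (Suc n)" "\<kappa> n x * norm (E x) \<le> 1" for n x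
  proof -
    show "0 \<le> \<kappa> n x" using \<kappa>pos[of n x] by (simp add: \<kappa>_def)
    have "1 / max (1 / real (Suc n)) (norm (E x)) \<le> 1 / (1 / real (Suc n))"
      by (intro divide_left_mono mult_pos_pos \<kappa>pos) auto
    then show "\<kappa> n x \<le> real (Suc n)" by (simp add: \<kappa>_def)
    show "\<kappa> n x * norm (E x) \<le> 1" using \<kappa>pos[of n x] by (simp add: \<kappa>_def divide_le_eq)
  qed
  have sq: "0 \<le> sqrt (1 - (h x)\<^sup>2)" "sqrt (1 - (h x)\<^sup>2) \<le> 1" for x
    using hb[of x] by (auto simp: abs_square_le_1)
  have [measurable]: "h \<in> borel_measurable borel" by (rule bounded_borel_on_borel[OF h])
  have Gm[measurable]: "G n \<in> borel_measurable borel" for n unfolding G_def[abs_def] \<kappa>_def by measurable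
  have G: "bounded_borel_on B (G n)" for n
    unfolding bounded_borel_on_def
  proof (intro conjI B Gm exI[of _ "real (Suc n)"] allI impI)
    fix x
    have "\<bar>sqrt (1 - (h x)\<^sup>2) * \<kappa> n x\<bar> \<le> 1 * real (Suc n)"
      using sq[of x] \<kappa>b[of n x] unfolding abs_mult by (intro mult_mono) auto
    then show "\<bar>G n x\<bar> \<le> real (Suc n)" by (simp add: G_def indicator_def)
    show "x \<notin> B \<Longrightarrow> G n x = 0" by (simp add: G_def)
  qed
  have zero: "(LBINT x. G n x * dderiv \<phi> (tangent_field E a b x) x) = 0" for n
  proof (rule measure_preserving_affine_flow.flow_invariant_weak_derivative[OF M(1) h weak B(1) G _ \<phi>])
    fix x t assume "x \<in> B" "M t x \<in> B" "h (M t x) = h x"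
    then show "G n (M t x) = G n x" by (simp add: G_def \<kappa>_def M(2))
  qed
  obtain C where C: "C \<ge> 0" "\<And>x v. \<bar>dderiv \<phi> v x\<bar> \<le> C * norm v" using dderiv_bound[OF \<phi>] by metis
  define F where "F x = \<sigma> * ((fst (U x) \<bullet> a) * dderiv \<phi> (b, 0) x - (fst (U x) \<bullet> b) * dderiv \<phi> (a, 0) x)" for x
  have Bi: "integrable lborel (\<lambda>x. indicator B x * (2 * C))"
    by (rule integrable_bounded_support[OF _ B(2), of _ "2 * C"]) (use C in \<open>auto simp: indicator_def\<close>)
  have "(\<lambda>n. LBINT x. G n x * dderiv \<phi> (tangent_field E a b x) x) \<longlonglongrightarrow> (LBINT x. F x)"
  proof (rule integral_dominated_convergence[OF _ _ Bi])
    show "F \<in> borel_measurable lborel" unfolding F_def[abs_def] by measurable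
    show "(\<lambda>x. G n x * dderiv \<phi> (tangent_field E a b x) x) \<in> borel_measurable lborel" for n
      unfolding dderiv_tangent[OF sm] by measurable
    show "AE x in lborel. (\<lambda>n. G n x * dderiv \<phi> (tangent_field E a b x) x) \<longlonglongrightarrow> F x"
      using UE
    proof eventually_elim
      case (elim x)
      show ?case
      proof (cases "x \<in> B")
        case True
        then have Ex: "E x \<noteq> 0" and W: "fst (U x) = (\<sigma> * (norm (fst (U x)) / norm (E x))) *\<^sub>R E x" using elim by auto
        have "(\<lambda>n. max (1 / real (Suc n)) (norm (E x))) \<longlonglongrightarrow> max 0 (norm (E x))"
          by (intro tendsto_max tendsto_const LIMSEQ_Suc[OF lim_1_over_n])
        then have "(\<lambda>n. \<kappa> n x) \<longlonglongrightarrow> 1 / max 0 (norm (E x))"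
          unfolding \<kappa>_def using Ex by (intro tendsto_divide tendsto_const) (auto simp: max_def)
        then have "(\<lambda>n. G n x * dderiv \<phi> (tangent_field E a b x) x) \<longlonglongrightarrow>
            indicator B x * (sqrt (1 - (h x)\<^sup>2) * (1 / max 0 (norm (E x)))) * dderiv \<phi> (tangent_field E a b x) x"
          unfolding G_def by (intro tendsto_mult tendsto_const)
        also have "indicator B x * (sqrt (1 - (h x)\<^sup>2) * (1 / max 0 (norm (E x)))) * dderiv \<phi> (tangent_field E a b x) x = F x"
        proof -
          define k where "k = norm (fst (U x)) / norm (E x)"
          have ip: "fst (U x) \<bullet> p = \<sigma> * k * (E x \<bullet> p)" for p
            unfolding k_def by (subst W) simp
          have "\<sigma> * \<sigma> = 1" using \<sigma> by auto
          moreover have "F x = (\<sigma> * \<sigma>) * (k * dderiv \<phi> (tangent_field E a b x) x)"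
            unfolding F_def ip dderiv_tangent[OF sm] by (simp add: algebra_simps)
          ultimately have "F x = k * dderiv \<phi> (tangent_field E a b x) x" by simp
          then show ?thesis using True Wn[OF True] by (simp add: k_def)
        qed
        finally show ?thesis .
      next
        case False
        then show ?thesis by (simp add: G_def F_def U(3))
      qed
    qed
    show "AE x in lborel. norm (G n x * dderiv \<phi> (tangent_field E a b x) x) \<le> indicator B x * (2 * C)" for n
    proof (rule AE_I2)
      fix x
      show "norm (G n x * dderiv \<phi> (tangent_field E a b x) x) \<le> indicator B x * (2 * C)"
      proof (cases "x \<in> B")
        case True
        have "norm (tangent_field E a b x) = norm ((E x \<bullet> a) *\<^sub>R b - (E x \<bullet> b) *\<^sub>R a)" by (simp add: norm_prod_def)
        also have "\<dots> \<le> \<bar>E x \<bullet> a\<bar> + \<bar>E x \<bullet> b\<bar>"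
          using norm_triangle_ineq4[of "(E x \<bullet> a) *\<^sub>R b" "(E x \<bullet> b) *\<^sub>R a"] ab by simp
        also have "\<dots> \<le> 2 * norm (E x)"
          using Cauchy_Schwarz_ineq2[of "E x" a] Cauchy_Schwarz_ineq2[of "E x" b] ab by simp
        finally have "C * norm (tangent_field E a b x) \<le> C * (2 * norm (E x))" using C(1) by (rule mult_left_mono)
        then have "\<bar>dderiv \<phi> (tangent_field E a b x) x\<bar> \<le> C * (2 * norm (E x))"
          using C(2)[of x "tangent_field E a b x"] by linarith
        then have "\<kappa> n x * \<bar>dderiv \<phi> (tangent_field E a b x) x\<bar> \<le> \<kappa> n x * (C * (2 * norm (E x)))"
          using \<kappa>b(1) by (rule mult_left_mono)
        also have "\<dots> = (\<kappa> n x * norm (E x)) * (2 * C)" by simp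
        also have "\<dots> \<le> 1 * (2 * C)" using C(1) \<kappa>b(3) by (intro mult_right_mono) auto
        finally have "sqrt (1 - (h x)\<^sup>2) * (\<kappa> n x * \<bar>dderiv \<phi> (tangent_field E a b x) x\<bar>) \<le> 1 * (1 * (2 * C))"
          by (rule mult_mono[OF sq(2)]) (use \<kappa>b(1)[of n x] in auto)
        then show ?thesis using True sq(1)[of x] \<kappa>b(1)[of n x] by (simp add: G_def abs_mult mult.assoc)
      qed (simp add: G_def)
    qed
  qed
  then have "(LBINT x. F x) = 0" by (simp only: zero LIMSEQ_const_iff)
  moreover have "(LBINT x. F x) = \<sigma> * ((LBINT x. (fst (U x) \<bullet> a) * dderiv \<phi> (b, 0) x) - (LBINT x. (fst (U x) \<bullet> b) * dderiv \<phi> (a, 0) x))"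
  proof -
    have i: "integrable lborel (\<lambda>x. (fst (U x) \<bullet> p) * dderiv \<phi> (q, 0) x)" if "norm p = 1" for p q
    proof (rule integrable_mult_test[OF _ _ test_functions_dderiv[OF \<phi>]])
      show "\<bar>fst (U x) \<bullet> p\<bar> \<le> 1" for x using Cauchy_Schwarz_ineq2[of "fst (U x)" p] Wb[of x] that by simp
    qed measurable
    show ?thesis unfolding F_def using i[OF ab(1)] i[OF ab(2)] by simp
  qed
  ultimately show ?thesis using \<sigma> by auto
qed

text \<open>The path is compact, so one short time step works at all of its points, and continuity upgrades
invariance almost everywhere to invariance.\<close>

lemma (in measure_preserving_affine_flow) constant_along_flow:
  assumes \<Phi>: "continuous_on UNIV \<Phi>" and f: "bounded_borel_on B f" "\<And>x. x \<in> B \<Longrightarrow> f x = \<Phi> x" and B: "open B"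
    and weak: "\<forall>\<eta>\<in>test_functions B. (LBINT x. f x * dderiv \<eta> (X x) x) = 0"
    and path: "\<And>t. 0 \<le> t \<Longrightarrow> t \<le> T \<Longrightarrow> M t x \<in> B" and T: "T \<ge> 0"
  shows "\<Phi> (M T x) = \<Phi> x"
proof -
  have Mc: "continuous_on S (\<lambda>t. M t x)" for S
  proof (intro continuous_at_imp_continuous_on ballI)
    fix t
    have "((\<lambda>s. M s (M t x)) has_vector_derivative X (M t x)) (at 0)" by (rule generator)
    then have "isCont (\<lambda>s. M (s + t) x) 0"
      using has_vector_derivative_continuous by (simp add: group)
    then show "isCont (\<lambda>t. M t x) t"
      using isCont_o2[where a = t and f = "\<lambda>u. u - t" and g = "\<lambda>s. M (s + t) x"] by simp
  qed
  define S where "S = (\<lambda>t. M t x) ` {0..T}"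
  have "compact S" unfolding S_def by (intro compact_continuous_image Mc) simp
  moreover have "S \<subseteq> B" using path by (auto simp: S_def)
  ultimately have ex: "\<exists>V \<delta>. open V \<and> S \<subseteq> V \<and> \<delta> > 0 \<and>
    (\<forall>t. \<bar>t\<bar> \<le> \<delta> \<longrightarrow> (AE x in lborel. x \<in> V \<longrightarrow> x \<in> B \<and> M t x \<in> B \<and> f (M t x) = f x))"
    by (rule flow_invariant_near_compact[OF f(1) weak B])
  obtain V \<delta> where V: "open V" "S \<subseteq> V" "\<delta> > 0" and inv: "\<forall>t. \<bar>t\<bar> \<le> \<delta> \<longrightarrow>
      (AE x in lborel. x \<in> V \<longrightarrow> x \<in> B \<and> M t x \<in> B \<and> f (M t x) = f x)"
    using ex by (elim exE conjE) (rule that)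
  have loc: "\<Phi> (M t y) = \<Phi> y" if t: "\<bar>t\<bar> \<le> \<delta>" and y: "y \<in> V" for t y
  proof (rule ccontr)
    assume ne: "\<Phi> (M t y) \<noteq> \<Phi> y"
    let ?O = "{z. \<Phi> (M t z) \<noteq> \<Phi> z}"
    have "continuous_on UNIV (\<lambda>z. \<Phi> (M t z))"
      using continuous_on_compose2[OF \<Phi> continuous_flow] by simp
    then have "open ?O" using \<Phi> by (intro open_Collect_neq)
    then have "open (V \<inter> ?O)" "V \<inter> ?O \<noteq> {}" using V(1) y ne by auto
    from AE_imp_dense[OF this inv[THEN spec, THEN mp, OF t]]
    obtain z where z: "z \<in> V" "\<Phi> (M t z) \<noteq> \<Phi> z" "z \<in> V \<longrightarrow> z \<in> B \<and> M t z \<in> B \<and> f (M t z) = f z" by blast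
    then show False using f(2)[of z] f(2)[of "M t z"] by simp
  qed
  obtain n :: nat where n: "T / \<delta> < real n" using reals_Archimedean2 by blast
  have npos: "0 < real n" using n T V(3) by (meson divide_nonneg_pos order_le_less_trans)
  have step: "T / real n \<le> \<delta>" using n npos V(3) by (simp add: field_simps)
  have "\<Phi> (M (real k * (T / real n)) x) = \<Phi> x" if "k \<le> n" for k
    using that
  proof (induction k)
    case 0
    then show ?case by (simp add: zero)
  next
    case (Suc k)
    have "M (real (Suc k) * (T / real n)) x = M (T / real n) (M (real k * (T / real n)) x)"
    proof -
      have "real (Suc k) * (T / real n) = T / real n + real k * (T / real n)" by (simp add: algebra_simps add_divide_distrib)
      then show ?thesis by (simp only: group)
    qed
    moreover have "M (real k * (T / real n)) x \<in> V"
    proof -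
      have "real k * (T / real n) \<le> real n * (T / real n)" using Suc T by (intro mult_right_mono) auto
      then have "real k * (T / real n) \<in> {0..T}" using T npos by simp
      then show ?thesis using V(2) by (auto simp: S_def)
    qed
    ultimately show ?case using loc[of "T / real n"] step T npos Suc by simp
  qed
  from this[of n] show ?thesis using npos by simp
qed

section \<open>The planar eikonal equation\<close>

lemma loc_integrable_bounded:
  assumes S: "open S" and f: "f \<in> borel_measurable (lebesgue_on S)" and C: "AE x in lebesgue_on S. \<bar>f x\<bar> \<le> C"
  shows "loc_integrable S f"
  unfolding loc_integrable_def
proof (intro allI impI)
  fix K assume K: "compact K \<and> K \<subseteq> S"
  then have Km: "K \<in> lmeasurable" by (simp add: lmeasurable_compact)
  have Sm: "S \<in> sets lebesgue" using S by (simp add: borel_open)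
  interpret finite_measure "lebesgue_on K" using Km by (rule finite_measure_lebesgue_on)
  have "AE x in lebesgue. x \<in> S \<longrightarrow> \<bar>f x\<bar> \<le> C" using C Sm by (simp add: AE_restrict_space_iff)
  then have "AE x in lebesgue. x \<in> K \<longrightarrow> \<bar>f x\<bar> \<le> C" using K by (auto elim: eventually_mono)
  then have "AE x in lebesgue_on K. \<bar>f x\<bar> \<le> C" using Km by (simp add: AE_restrict_space_iff fmeasurableD)
  moreover have "f \<in> borel_measurable (lebesgue_on K)"
    by (rule measurable_restrict_mono[OF f]) (use K in simp)
  ultimately show "integrable (lebesgue_on K) f"
    by (intro integrable_const_bound[of _ C]) auto
qed

lemma test_integral_lebesgue_on:
  fixes f g :: "'a::euclidean_space \<Rightarrow> real"
  assumes S: "S \<in> sets lebesgue" and f: "f \<in> borel_measurable (lebesgue_on S)" and g: "g \<in> borel_measurable borel"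
    and ae: "AE x in lborel. x \<in> V \<longrightarrow> f x = g x" and V: "V \<subseteq> S" and \<eta>: "\<eta> \<in> test_functions V"
  shows "(LINT x|lebesgue_on S. f x * \<eta> x) = (LBINT x. g x * \<eta> x)"
proof (rule integral_lebesgue_on_eq[OF S])
  obtain K where K: "smooth \<eta>" "K \<subseteq> V" "\<And>x. x \<notin> K \<Longrightarrow> \<eta> x = 0" using test_functionsE[OF \<eta>] by metis
  note \<eta>m = smooth_borel[OF K(1)]
  have "\<eta> \<in> borel_measurable lebesgue" using \<eta>m by (simp add: measurable_completion)
  then show "(\<lambda>x. f x * \<eta> x) \<in> borel_measurable (lebesgue_on S)"
    by (rule borel_measurable_times[OF f measurable_restrict_space1])
  show "(\<lambda>x. g x * \<eta> x) \<in> borel_measurable borel" using g \<eta>m by simp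
  show "AE x in lborel. x \<in> S \<longrightarrow> f x * \<eta> x = g x * \<eta> x"
    using ae
  proof eventually_elim
    case (elim x)
    then show ?case using K(2,3) by (cases "x \<in> K") auto
  qed
  show "g x * \<eta> x = 0" if "x \<notin> S" for x using K(2,3) V that by (metis mult_zero_right subsetD)
qed

lemma lipschitz_1_continuous:
  fixes \<Phi> :: "'a::euclidean_space \<Rightarrow> real"
  shows "(\<And>x y. \<bar>\<Phi> x - \<Phi> y\<bar> \<le> norm (x - y)) \<Longrightarrow> continuous_on S \<Phi>"
  by (rule lipschitz_on_continuous_on[of 1]) (auto simp: lipschitz_on_def dist_norm)

text \<open>Move the difference quotient from \<open>\<psi>\<close> to the test function. Only a sequence of step sizes is used,
so differentiability of \<open>\<psi>\<close> is not at issue.\<close>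

lemma weak_gradient_of_lipschitz_limit:
  fixes \<psi> :: "'a::euclidean_space \<Rightarrow> real"
  assumes \<psi>: "\<And>x y. \<bar>\<psi> x - \<psi> y\<bar> \<le> norm (x - y)" and D: "open D"
    and a: "filterlim a at_top sequentially" and b: "norm b = 1"
    and g: "g \<in> borel_measurable borel"
    and lim: "AE z in lborel. z \<in> D \<longrightarrow> (\<lambda>j. a j * (\<psi> (z + b /\<^sub>R a j) - \<psi> z)) \<longlonglongrightarrow> g z"
    and \<phi>: "\<phi> \<in> test_functions D"
  shows "(LBINT z. \<psi> z * dderiv \<phi> b z) = - (LBINT z. g z * \<phi> z)"
proof -
  obtain K where K: "smooth \<phi>" "compact K" "K \<subseteq> D" "\<And>x. x \<notin> K \<Longrightarrow> \<phi> x = 0" using test_functionsE[OF \<phi>] by metis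
  obtain C where C: "C \<ge> 0" "\<And>x. \<bar>\<phi> x\<bar> \<le> C" using test_functions_bounded[OF \<phi>] by metis
  obtain R where R: "\<And>x. x \<in> K \<Longrightarrow> norm x \<le> R" using compact_imp_bounded[OF K(2)] by (auto simp: bounded_iff)
  note [measurable] = smooth_borel[OF K(1)] g borel_measurable_continuous_onI[OF lipschitz_1_continuous[OF \<psi>]]
  interpret T: measure_preserving_affine_flow "\<lambda>t x. x + t *\<^sub>R (- b)" "\<lambda>x. - b" by (rule translation_flow)
  (* A cutoff of psi that is invisible to phi and to its translates by vectors of length at most 1. *)
  define B where "B = cball (0::'a) (R + 1)"
  define f where "f z = indicator B z * \<psi> z" for z
  have [measurable]: "B \<in> sets borel" by (simp add: B_def)
  have f: "bounded_borel_on B f"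
    unfolding bounded_borel_on_def
  proof (intro conjI allI impI exI[of _ "\<bar>\<psi> 0\<bar> + \<bar>R + 1\<bar>"])
    show "f \<in> borel_measurable borel" unfolding f_def[abs_def] by measurable
    show "bounded B" by (simp add: B_def)
    show "\<bar>f z\<bar> \<le> \<bar>\<psi> 0\<bar> + \<bar>R + 1\<bar>" for z
      using \<psi>[of z 0] by (cases "z \<in> B") (auto simp: f_def B_def)
  qed (simp add: f_def)
  note [measurable] = bounded_borel_on_borel[OF f]
  have pos: "eventually (\<lambda>j. a j \<ge> 1) sequentially" using a by (simp add: filterlim_at_top)
  then obtain j0 where j0: "\<And>j. j \<ge> j0 \<Longrightarrow> a j \<ge> 1" by (auto simp: eventually_sequentially)
  define F where "F t = (LBINT z. f z * \<phi> (z + t *\<^sub>R (- b)))" for t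
  have "(F has_real_derivative (LBINT z. f z * dderiv \<phi> (- b) z)) (at 0)"
    unfolding F_def[abs_def] by (rule T.flow_integral_derivative_0[OF f \<phi>])
  then have dF: "((\<lambda>t. (F t - F 0) / (t - 0)) \<longlongrightarrow> (LBINT z. f z * dderiv \<phi> (- b) z)) (at 0)"
    by (simp add: has_field_derivative_iff)
  have "filterlim (\<lambda>j. 1 / a j) (at 0) sequentially"
  proof -
    have "((\<lambda>j. inverse (a j)) \<longlongrightarrow> 0) sequentially" by (rule tendsto_inverse_0_at_top[OF a])
    moreover have "eventually (\<lambda>j. inverse (a j) \<noteq> 0) sequentially" using pos by eventually_elim auto
    ultimately show ?thesis by (simp add: filterlim_at inverse_eq_divide)
  qed
  from filterlim_compose[OF dF this]
  have l1: "(\<lambda>j. (F (1 / a j) - F 0) / (1 / a j - 0)) \<longlonglongrightarrow> (LBINT z. f z * dderiv \<phi> (- b) z)" .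
  have fi: "integrable lborel (\<lambda>z. f (z + v) * \<phi> z)" for v
  proof -
    obtain Cf where Cf: "\<And>x. \<bar>f x\<bar> \<le> Cf" using bounded_borel_onE[OF f] by metis
    show ?thesis by (rule integrable_mult_test[OF _ Cf \<phi>]) measurable
  qed
  have eq: "(F (1 / a j) - F 0) / (1 / a j - 0) = (LBINT z. (a j * (\<psi> (z + b /\<^sub>R a j) - \<psi> z)) * \<phi> z)" if j: "j \<ge> j0" for j
  proof -
    have "F t = (LBINT z. f (z + t *\<^sub>R b) * \<phi> z)" for t
      unfolding F_def using T.integral_flow[of "\<lambda>z. f z * \<phi> (z + t *\<^sub>R (- b))" "- t"] by simp
    then have "F (1 / a j) - F 0 = (LBINT z. f (z + (1 / a j) *\<^sub>R b) * \<phi> z - f (z + 0) * \<phi> z)"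
      using fi[of "(1 / a j) *\<^sub>R b"] fi[of 0] by simp
    also have "\<dots> = (LBINT z. (\<psi> (z + b /\<^sub>R a j) - \<psi> z) * \<phi> z)"
    proof (intro Bochner_Integration.integral_cong refl)
      fix z
      show "f (z + (1 / a j) *\<^sub>R b) * \<phi> z - f (z + 0) * \<phi> z = (\<psi> (z + b /\<^sub>R a j) - \<psi> z) * \<phi> z"
      proof (cases "z \<in> K")
        case True
        have "norm (b /\<^sub>R a j) \<le> 1" using b j0[OF j] by (simp add: inverse_le_1_iff)
        then have "z \<in> B" "z + b /\<^sub>R a j \<in> B"
          using R[OF True] norm_triangle_ineq[of z "b /\<^sub>R a j"] by (auto simp: B_def)
        then show ?thesis by (simp add: f_def left_diff_distrib inverse_eq_divide)
      qed (simp add: K(4))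
    qed
    finally show ?thesis using j0[OF j]
      by (simp add: mult.assoc mult.commute[of "LBINT z. _ z"] del: integral_mult_right_zero)
         (simp add: integral_mult_right_zero[symmetric] del: integral_mult_right_zero)
  qed
  have "(\<lambda>j. LBINT z. (a (j + j0) * (\<psi> (z + b /\<^sub>R a (j + j0)) - \<psi> z)) * \<phi> z) \<longlonglongrightarrow> (LBINT z. g z * \<phi> z)"
  proof (rule integral_dominated_convergence[where w = "\<lambda>z. \<bar>\<phi> z\<bar>"])
    show "integrable lborel (\<lambda>z. \<bar>\<phi> z\<bar>)"
      by (rule integrable_bounded_support[OF _ compact_imp_bounded[OF K(2)], of _ C]) (use C K(4) in auto)
    show "AE z in lborel. (\<lambda>j. (a (j + j0) * (\<psi> (z + b /\<^sub>R a (j + j0)) - \<psi> z)) * \<phi> z) \<longlonglongrightarrow> g z * \<phi> z"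
      using lim
    proof eventually_elim
      case (elim z)
      show ?case
      proof (cases "z \<in> K")
        case True
        then have "(\<lambda>j. a j * (\<psi> (z + b /\<^sub>R a j) - \<psi> z)) \<longlonglongrightarrow> g z" using elim K(3) by blast
        from LIMSEQ_ignore_initial_segment[OF this, of j0] show ?thesis by (intro tendsto_mult tendsto_const)
      qed (simp add: K(4))
    qed
    show "AE z in lborel. norm ((a (j + j0) * (\<psi> (z + b /\<^sub>R a (j + j0)) - \<psi> z)) * \<phi> z) \<le> \<bar>\<phi> z\<bar>" for j
    proof (rule AE_I2)
      fix z
      let ?a = "a (j + j0)"
      have "?a \<ge> 1" by (rule j0) simp
      have "\<bar>\<psi> (z + b /\<^sub>R ?a) - \<psi> z\<bar> \<le> inverse ?a" using \<psi>[of "z + b /\<^sub>R ?a" z] b \<open>?a \<ge> 1\<close> by simp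
      then have "?a * \<bar>\<psi> (z + b /\<^sub>R ?a) - \<psi> z\<bar> \<le> ?a * inverse ?a" using \<open>?a \<ge> 1\<close> by (intro mult_left_mono) auto
      then have "\<bar>?a * (\<psi> (z + b /\<^sub>R ?a) - \<psi> z)\<bar> \<le> 1" using \<open>?a \<ge> 1\<close> by (simp add: abs_mult)
      then show "norm ((?a * (\<psi> (z + b /\<^sub>R ?a) - \<psi> z)) * \<phi> z) \<le> \<bar>\<phi> z\<bar>"
        by (simp only: real_norm_def abs_mult[of "_ * _" "\<phi> z"] mult_left_le_one_le abs_ge_zero)
    qed
  qed measurable
  then have "(\<lambda>j. (F (1 / a (j + j0)) - F 0) / (1 / a (j + j0) - 0)) \<longlonglongrightarrow> (LBINT z. g z * \<phi> z)"
    by (simp only: eq[OF le_add2])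
  then have "(\<lambda>j. (F (1 / a j) - F 0) / (1 / a j - 0)) \<longlonglongrightarrow> (LBINT z. g z * \<phi> z)"
    by (rule LIMSEQ_offset)
  from LIMSEQ_unique[OF l1 this] have "(LBINT z. f z * dderiv \<phi> (- b) z) = (LBINT z. g z * \<phi> z)" .
  moreover have "f z * dderiv \<phi> (- b) z = - (\<psi> z * dderiv \<phi> b z)" for z
  proof (cases "z \<in> K")
    case True
    then have "z \<in> B" using R[OF True] by (simp add: B_def)
    then show ?thesis using linear_neg[OF smooth_dderiv_linear[OF K(1)]] by (simp add: f_def)
  next
    case False
    then show ?thesis using dderiv_eq_0_outside[OF K(2,4) False] by simp
  qed
  ultimately show ?thesis by simp
qed

text \<open>Both alternatives at once: \<open>\<alpha>\<close> grows with unit speed in the direction \<open>\<omega> = E / \<bar>E\<bar>\<close>, as long as its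
values stay in \<open>A\<close>, which is \<open>{0<..}\<close> for the distance to a point and \<open>UNIV\<close> for a linear
function. So the difference quotient of \<open>\<Phi>\<close> at \<open>x\<close> in the direction \<open>\<omega> x\<close> is a difference quotient
of \<open>\<psi>\<close> in its first variable at \<open>p x\<close>.

The bad set \<open>Z\<close> in the plane has a null preimage under \<open>p\<close>. To see that \<open>Z\<close> is null without
polar coordinates, shift \<open>x\<close> by \<open>\<tau> x z\<close> along its ray and vertically, so that \<open>p\<close> moves by \<open>z\<close>.
For each \<open>z\<close> the points that are shifted into the preimage of \<open>Z\<close> form a null set, so by Fubini
almost every \<open>x\<close> is shifted into it only for a null set of \<open>z\<close>; that is, \<open>Z\<close> is null near \<open>p x\<close>.
Countably many such \<open>x\<close> cover \<open>Z\<close>.\<close>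

lemma eikonal_of_fibred_potential:
  fixes E :: "'b::euclidean_space \<times> real \<Rightarrow> 'b" and U :: "'b \<times> real \<Rightarrow> 'b \<times> real" and \<alpha> :: "'b \<Rightarrow> real"
    and \<Phi> :: "'b \<times> real \<Rightarrow> real" and \<psi> :: "real \<times> real \<Rightarrow> real"
  defines "\<omega> \<equiv> \<lambda>x. E x /\<^sub>R norm (E x)" and "p \<equiv> \<lambda>x::'b \<times> real. (\<alpha> (fst x), snd x)"
  assumes B: "open B" "bounded B" and \<sigma>: "\<sigma> \<in> {1, - 1 :: real}"
    and U: "\<And>x. x \<in> B \<Longrightarrow> norm (U x) = 1"
    and UE: "AE x in lborel. x \<in> B \<longrightarrow> E x \<noteq> 0 \<and> fst (U x) = (\<sigma> * (norm (fst (U x)) / norm (E x))) *\<^sub>R E x"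
    and r: "strict_mono r" and dd: "AE x in lborel. x \<in> B \<longrightarrow> (\<forall>v. norm v < 2 \<longrightarrow>
      (\<lambda>j. real (Suc (r j)) * (\<Phi> (x + v /\<^sub>R real (Suc (r j))) - \<Phi> x)) \<longlonglongrightarrow> U x \<bullet> v)"
    and \<Phi>: "\<And>x y. \<bar>\<Phi> x - \<Phi> y\<bar> \<le> norm (x - y)"
    and \<psi>: "\<And>x y. \<bar>\<psi> x - \<psi> y\<bar> \<le> norm (x - y)" and \<Phi>\<psi>: "\<And>x. x \<in> B \<Longrightarrow> \<Phi> x = \<psi> (p x)"
    and A: "open A" "\<And>x. E x \<noteq> 0 \<longleftrightarrow> \<alpha> (fst x) \<in> A" and \<alpha>: "continuous_on UNIV \<alpha>"
    and ray: "\<And>x s b. E x \<noteq> 0 \<Longrightarrow> \<alpha> (fst x) + s \<in> A \<Longrightarrow>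
      \<alpha> (fst x + s *\<^sub>R \<omega> x) = \<alpha> (fst x) + s \<and> \<omega> (fst x + s *\<^sub>R \<omega> x, b) = \<omega> x"
    and E: "\<And>x. E differentiable (at x)"
    and D: "interior (p ` B) \<subseteq> A \<times> UNIV"
  shows "eikonal_2d (interior (p ` B)) \<psi>"
proof -
  define D where "D = interior (p ` B)"
  have Do: "open D" by (simp add: D_def)
  have Ec: "continuous_on UNIV E" using E by (intro differentiable_imp_continuous_on) (simp add: differentiable_on_def differentiable_at_withinI)
  have [measurable]: "E \<in> borel_measurable borel" by (rule borel_measurable_continuous_onI[OF Ec])
  have \<omega>m [measurable]: "\<omega> \<in> borel_measurable borel" unfolding \<omega>_def by measurable
  have [measurable]: "\<alpha> \<in> borel_measurable borel" by (rule borel_measurable_continuous_onI[OF \<alpha>])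
  have \<psi>m [measurable]: "\<psi> \<in> borel_measurable borel" by (rule borel_measurable_continuous_onI[OF lipschitz_1_continuous[OF \<psi>]])
  have fsm [measurable]: "fst \<in> borel_measurable (borel :: ('b \<times> real) measure)" "snd \<in> borel_measurable (borel :: ('b \<times> real) measure)"
    "fst \<in> borel_measurable (borel :: (real \<times> real) measure)" "snd \<in> borel_measurable (borel :: (real \<times> real) measure)"
    by (auto intro!: borel_measurable_continuous_onI continuous_intros)
  have [measurable]: "B \<in> sets borel" "A \<in> sets borel" "D \<in> sets borel" using B A Do by simp_all
  have \<omega>1: "norm (\<omega> x) = 1" if "E x \<noteq> 0" for x using that by (simp add: \<omega>_def)
  define a where "a j = real (Suc (r j))" for j
  have a1: "a j \<ge> 1" for j by (simp add: a_def)
  have atop: "filterlim a at_top sequentially"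
    unfolding a_def
    by (intro filterlim_compose[OF filterlim_real_sequentially] filterlim_compose[OF filterlim_Suc] filterlim_subseq r)
  have inv0: "(\<lambda>j. inverse (a j)) \<longlonglongrightarrow> 0" by (rule tendsto_inverse_0_at_top[OF atop])
  define q where "q e j z = a j * (\<psi> (z + e /\<^sub>R a j) - \<psi> z)" for e j z
  have qm [measurable]: "q e j \<in> borel_measurable borel" for e j unfolding q_def[abs_def] by measurable
  have qb: "\<bar>q e j z\<bar> \<le> 1" if "norm e = 1" for e j z
  proof -
    have "\<bar>\<psi> (z + e /\<^sub>R a j) - \<psi> z\<bar> \<le> inverse (a j)" using \<psi>[of "z + e /\<^sub>R a j" z] that a1[of j] by simp
    then have "a j * \<bar>\<psi> (z + e /\<^sub>R a j) - \<psi> z\<bar> \<le> a j * inverse (a j)" using a1[of j] by (intro mult_left_mono) auto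
    then show ?thesis using a1[of j] by (simp add: q_def abs_mult)
  qed
  let ?e1 = "(1, 0) :: real \<times> real" and ?e2 = "(0, 1) :: real \<times> real"
  define l where "l e z = lim (\<lambda>j. q e j z)" for e z
  have lm [measurable]: "l e \<in> borel_measurable borel" for e unfolding l_def[abs_def] by measurable
  (* Convergence is expressed as the Cauchy property, which is a measurable condition. *)
  define Z where "Z = {z \<in> D. \<not> (Cauchy (\<lambda>j. q ?e1 j z) \<and> Cauchy (\<lambda>j. q ?e2 j z) \<and> (l ?e1 z)\<^sup>2 + (l ?e2 z)\<^sup>2 = 1)}"
  have Zm [measurable]: "Z \<in> sets borel"
  proof -
    have "{z \<in> space borel. z \<in> D \<and> \<not> (Cauchy (\<lambda>j. q ?e1 j z) \<and> Cauchy (\<lambda>j. q ?e2 j z) \<and> (l ?e1 z)\<^sup>2 + (l ?e2 z)\<^sup>2 = 1)} \<in> sets borel"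
      by measurable
    then show ?thesis by (simp add: Z_def)
  qed
  have aeZ: "AE x in lborel. x \<in> B \<longrightarrow> E x \<noteq> 0 \<and> p x \<notin> Z"
    using UE dd
  proof (eventually_elim, intro impI)
    fix x assume 1: "x \<in> B \<longrightarrow> E x \<noteq> 0 \<and> fst (U x) = (\<sigma> * (norm (fst (U x)) / norm (E x))) *\<^sub>R E x"
      and 2: "x \<in> B \<longrightarrow> (\<forall>v. norm v < 2 \<longrightarrow> (\<lambda>j. real (Suc (r j)) * (\<Phi> (x + v /\<^sub>R real (Suc (r j))) - \<Phi> x)) \<longlonglongrightarrow> U x \<bullet> v)"
      and x: "x \<in> B"
    have Ex: "E x \<noteq> 0" using 1 x by blast
    define k where "k = norm (fst (U x))"
    have W: "fst (U x) = (\<sigma> * (k / norm (E x))) *\<^sub>R E x" using 1 x by (simp add: k_def)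
    have lim: "(\<lambda>j. a j * (\<Phi> (x + v /\<^sub>R a j) - \<Phi> x)) \<longlonglongrightarrow> U x \<bullet> v" if "norm v < 2" for v
      using 2[THEN mp, OF x, THEN spec, THEN mp, OF that] unfolding a_def .
    have inB: "eventually (\<lambda>j. x + v /\<^sub>R a j \<in> B) sequentially" for v
    proof -
      have "(\<lambda>j. x + inverse (a j) *\<^sub>R v) \<longlonglongrightarrow> x + 0 *\<^sub>R v" by (intro tendsto_intros inv0)
      then show ?thesis using topological_tendstoD[OF _ B(1)] x by fastforce
    qed
    have q1: "(\<lambda>j. q ?e1 j (p x)) \<longlonglongrightarrow> \<sigma> * k"
    proof -
      have "(\<lambda>j. a j * (\<Phi> (x + (\<omega> x, 0) /\<^sub>R a j) - \<Phi> x)) \<longlonglongrightarrow> U x \<bullet> (\<omega> x, 0)"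
        by (rule lim) (simp add: norm_prod_def \<omega>1[OF Ex])
      also have "U x \<bullet> (\<omega> x, 0) = \<sigma> * k"
      proof -
        have "U x \<bullet> (\<omega> x, 0) = fst (U x) \<bullet> \<omega> x" by (simp add: inner_prod_def)
        also have "\<dots> = \<sigma> * k" unfolding W \<omega>_def using Ex by (simp add: dot_square_norm power2_eq_square)
        finally show ?thesis .
      qed
      finally have L: "(\<lambda>j. a j * (\<Phi> (x + (\<omega> x, 0) /\<^sub>R a j) - \<Phi> x)) \<longlonglongrightarrow> \<sigma> * k" .
      have "(\<lambda>j. \<alpha> (fst x) + inverse (a j)) \<longlonglongrightarrow> \<alpha> (fst x) + 0" by (intro tendsto_intros inv0)
      then have "eventually (\<lambda>j. \<alpha> (fst x) + inverse (a j) \<in> A) sequentially"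
        using topological_tendstoD[OF _ A(1)] A(2)[of x] Ex by fastforce
      with inB[of "(\<omega> x, 0)"]
      have "eventually (\<lambda>j. a j * (\<Phi> (x + (\<omega> x, 0) /\<^sub>R a j) - \<Phi> x) = q ?e1 j (p x)) sequentially"
      proof eventually_elim
        case (elim j)
        have "p (x + (\<omega> x, 0) /\<^sub>R a j) = p x + ?e1 /\<^sub>R a j"
          using ray[OF Ex elim(2), of 0] by (simp add: p_def)
        then show ?case using \<Phi>\<psi>[OF elim(1)] \<Phi>\<psi>[OF x] by (simp add: q_def)
      qed
      then show ?thesis by (rule Lim_transform_eventually[OF L])
    qed
    have q2: "(\<lambda>j. q ?e2 j (p x)) \<longlonglongrightarrow> snd (U x)"
    proof -
      have "(\<lambda>j. a j * (\<Phi> (x + (0, 1) /\<^sub>R a j) - \<Phi> x)) \<longlonglongrightarrow> U x \<bullet> (0, 1)"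
        by (rule lim) (simp add: norm_prod_def)
      then have L: "(\<lambda>j. a j * (\<Phi> (x + (0, 1) /\<^sub>R a j) - \<Phi> x)) \<longlonglongrightarrow> snd (U x)" by (simp add: inner_prod_def)
      have "eventually (\<lambda>j. a j * (\<Phi> (x + (0, 1) /\<^sub>R a j) - \<Phi> x) = q ?e2 j (p x)) sequentially"
        using inB[of "(0, 1)"]
      proof eventually_elim
        case (elim j)
        have "p (x + (0, 1) /\<^sub>R a j) = p x + ?e2 /\<^sub>R a j" by (simp add: p_def)
        then show ?case using \<Phi>\<psi>[OF elim] \<Phi>\<psi>[OF x] by (simp add: q_def)
      qed
      then show ?thesis by (rule Lim_transform_eventually[OF L])
    qed
    have "(norm (U x))\<^sup>2 = k\<^sup>2 + (snd (U x))\<^sup>2" by (simp add: norm_prod_def k_def)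
    then have "k\<^sup>2 + (snd (U x))\<^sup>2 = 1" using U[OF x] by simp
    moreover have "(\<sigma> * k)\<^sup>2 = k\<^sup>2" using \<sigma> by auto
    ultimately have "(l ?e1 (p x))\<^sup>2 + (l ?e2 (p x))\<^sup>2 = 1"
      using limI[OF q1] limI[OF q2] by (simp add: l_def)
    then show "E x \<noteq> 0 \<and> p x \<notin> Z" using Ex q1 q2 by (auto simp: Z_def intro: LIMSEQ_imp_Cauchy)
  qed
  define N where "N = {x \<in> B. E x \<noteq> 0 \<and> p x \<in> Z}"
  have Nn: "negligible N" by (rule negligible_of_AE) (use aeZ in \<open>auto simp: N_def elim!: eventually_mono\<close>)
  define \<tau> where "\<tau> x z = (fst x + fst z *\<^sub>R \<omega> x, snd x + snd z)" for x :: "'b \<times> real" and z :: "real \<times> real"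
  define T where "T x z \<longleftrightarrow> E x \<noteq> 0 \<and> \<alpha> (fst x) + fst z \<in> A \<and> \<tau> x z \<in> B \<and> p x + z \<in> Z" for x z
  have \<tau>p: "p (\<tau> x z) = p x + z" and \<tau>E: "E (\<tau> x z) \<noteq> 0" and \<tau>\<omega>: "\<omega> (\<tau> x z) = \<omega> x"
    if "E x \<noteq> 0" "\<alpha> (fst x) + fst z \<in> A" for x z
  proof -
    show "p (\<tau> x z) = p x + z" using ray[OF that] by (cases z) (simp add: p_def \<tau>_def)
    show "\<omega> (\<tau> x z) = \<omega> x" using ray[OF that] by (simp add: \<tau>_def)
    show "E (\<tau> x z) \<noteq> 0" using ray[OF that, of 0] that A(2)[of "\<tau> x z"] by (simp add: \<tau>_def)
  qed
  have Tn: "AE x in lborel. \<not> T x z" for z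
  proof -
    have sub: "{x. T x z} \<subseteq> (\<lambda>y. \<tau> y (- z)) ` N"
    proof
      fix x assume "x \<in> {x. T x z}"
      then have t: "E x \<noteq> 0" "\<alpha> (fst x) + fst z \<in> A" "\<tau> x z \<in> B" "p x + z \<in> Z" by (auto simp: T_def)
      have "\<tau> x z \<in> N" using t \<tau>p[OF t(1,2)] \<tau>E[OF t(1,2)] by (simp add: N_def)
      moreover have "\<tau> (\<tau> x z) (- z) = x"
        unfolding \<tau>_def[of "\<tau> x z"] \<tau>\<omega>[OF t(1,2)] by (simp add: \<tau>_def prod_eq_iff)
      ultimately show "x \<in> (\<lambda>y. \<tau> y (- z)) ` N" by (metis imageI)
    qed
    have "(\<lambda>y. \<tau> y (- z)) differentiable_on N"
      unfolding differentiable_on_def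
    proof (rule ballI, rule differentiable_at_withinI)
      fix x assume "x \<in> N"
      then have "E x \<noteq> 0" by (simp add: N_def)
      then have nd: "(\<lambda>x. norm (E x)) differentiable (at x)"
        using differentiable_chain_at[OF E differentiable_norm_at[of "E x"]] by (simp add: comp_def)
      have fd: "fst differentiable (at x)" "snd differentiable (at x)"
        by (simp_all add: linear_imp_differentiable linear_fst linear_snd)
      have od: "\<omega> differentiable (at x)"
        unfolding \<omega>_def using \<open>E x \<noteq> 0\<close> by (intro differentiable_scaleR differentiable_inverse nd E) simp
      have "(\<lambda>y. (fst y + fst (- z) *\<^sub>R \<omega> y, snd y + snd (- z))) differentiable (at x)"
        by (intro differentiable_Pair differentiable_add differentiable_scaleR differentiable_const fd od)
      then show "(\<lambda>y. \<tau> y (- z)) differentiable (at x)" by (simp add: \<tau>_def)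
    qed
    from negligible_differentiable_image_negligible[OF _ Nn this] have "negligible ((\<lambda>y. \<tau> y (- z)) ` N)" by simp
    from AE_lborel_negligible[OF negligible_subset[OF this sub]] show ?thesis by simp
  qed
  have aeT: "AE x in lborel. AE z in lborel. \<not> T x z"
  proof -
    have pm: "(\<lambda>w. p (fst w) + snd w) \<in> borel_measurable (borel \<Otimes>\<^sub>M borel)"
      unfolding p_def by measurable
    have "Measurable.pred (borel \<Otimes>\<^sub>M borel) (\<lambda>w. \<not> T (fst w) (snd w))"
      unfolding T_def \<tau>_def using pm by measurable
    then have "{w \<in> space (lborel \<Otimes>\<^sub>M lborel). \<not> T (fst w) (snd w)} \<in> sets (lborel \<Otimes>\<^sub>M lborel)"
      unfolding pred_def by (simp add: space_pair_measure cong: sets_pair_measure_cong)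
    from lborel_pair.AE_commute[OF this] show ?thesis using Tn by simp
  qed
  obtain Q where Q: "countable Q" "Q \<subseteq> {x. AE z in lborel. \<not> T x z}" "{x. AE z in lborel. \<not> T x z} \<subseteq> closure Q"
    using separable[of "{x. AE z in lborel. \<not> T x z}"] by blast
  have Zsub: "Z \<subseteq> (\<Union>x\<in>Q. (\<lambda>z. p x + z) ` {z. T x z})"
  proof
    fix z0 assume z0: "z0 \<in> Z"
    then have "z0 \<in> D" by (simp add: Z_def)
    then obtain x0 where x0: "x0 \<in> B" "z0 = p x0" unfolding D_def using interior_subset by blast
    have z0A: "fst z0 \<in> A" using \<open>z0 \<in> D\<close> D by (auto simp: D_def)
    then have Ex0: "E x0 \<noteq> 0" using A(2)[of x0] x0 by (simp add: p_def)
    define G where "G x = \<tau> x (z0 - p x)" for x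
    have "continuous (at x0) G"
    proof -
      have ac: "continuous_on UNIV (\<lambda>x::'b \<times> real. \<alpha> (fst x))"
        by (rule continuous_on_compose2[OF \<alpha>]) (auto intro: continuous_on_fst continuous_on_id)
      have "continuous (at x0) E" "continuous (at x0) (\<lambda>x. \<alpha> (fst x))"
        using Ec ac unfolding continuous_on_eq_continuous_at[OF open_UNIV] by blast+
      then show ?thesis unfolding G_def \<tau>_def \<omega>_def p_def using Ex0
        by (intro continuous_intros) auto
    qed
    then have "(G \<longlongrightarrow> G x0) (nhds x0)" by (simp add: isCont_def tendsto_at_iff_tendsto_nhds)
    moreover have "G x0 = x0" by (simp add: G_def \<tau>_def x0)
    ultimately have "eventually (\<lambda>x. G x \<in> B) (nhds x0)"
      using topological_tendstoD[of G x0 "nhds x0" B] B(1) x0(1) by simp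
    moreover have "eventually (\<lambda>x. E x \<noteq> 0) (nhds x0)"
      using Ec Ex0 by (intro eventually_nhds_in_open[of "{x. E x \<noteq> 0}", THEN eventually_mono] open_Collect_neq) auto
    ultimately obtain V where V: "open V" "x0 \<in> V" "\<And>x. x \<in> V \<Longrightarrow> G x \<in> B \<and> E x \<noteq> 0"
      unfolding eventually_nhds by (metis (no_types, lifting) IntE IntI open_Int)
    obtain y where y: "y \<in> V" "AE z in lborel. \<not> T y z" using AE_imp_dense[OF V(1) _ aeT] V(2) by blast
    then have "V \<inter> closure Q \<noteq> {}" using Q(3) by blast
    then obtain x where x: "x \<in> Q" "x \<in> V" using V(1) open_Int_closure_eq_empty by blast
    have "T x (z0 - p x)" using V(3)[OF x(2)] z0 z0A by (simp add: T_def G_def p_def)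
    then have "z0 \<in> (\<lambda>z. p x + z) ` {z. T x z}" by (intro image_eqI[of _ _ "z0 - p x"]) auto
    then show "z0 \<in> (\<Union>x\<in>Q. (\<lambda>z. p x + z) ` {z. T x z})" using x(1) by blast
  qed
  have "negligible (\<Union>x\<in>Q. (\<lambda>z. p x + z) ` {z. T x z})"
  proof (rule negligible_countable_Union[of "(\<lambda>x. (\<lambda>z. p x + z) ` {z. T x z}) ` Q"])
    show "countable ((\<lambda>x. (\<lambda>z. p x + z) ` {z. T x z}) ` Q)" using Q(1) by simp
    fix S assume "S \<in> (\<lambda>x. (\<lambda>z. p x + z) ` {z. T x z}) ` Q"
    then obtain x where x: "x \<in> Q" "S = (\<lambda>z. p x + z) ` {z. T x z}" by blast
    have "negligible {z. T x z}" by (rule negligible_of_AE) (use x(1) Q(2) in auto)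
    then show "negligible S" unfolding x(2) by (rule negligible_translation)
  qed
  then have Zn: "negligible Z" using negligible_subset Zsub by blast
  have aeD: "AE z in lborel. z \<notin> Z" by (rule AE_lborel_negligible[OF Zn])
  (* The limits are in [-1, 1] where they exist; clipping makes the gradient bounded everywhere. *)
  define g where "g e z = max (- 1) (min 1 (l e z))" for e z
  have gm [measurable]: "g e \<in> borel_measurable borel" for e unfolding g_def[abs_def] by measurable
  have gb: "\<bar>g e z\<bar> \<le> 1" for e z by (auto simp: g_def)
  have lims: "(\<lambda>j. q e j z) \<longlonglongrightarrow> g e z \<and> g e z = l e z" if "z \<in> D" "z \<notin> Z" "e = ?e1 \<or> e = ?e2" for e z
  proof -
    have "Cauchy (\<lambda>j. q e j z)" using that by (auto simp: Z_def)
    then have L: "(\<lambda>j. q e j z) \<longlonglongrightarrow> l e z" unfolding l_def by (simp add: Cauchy_convergent_iff convergent_LIMSEQ_iff)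
    have "norm e = 1" using that(3) by (auto simp: norm_prod_def)
    then have "\<bar>l e z\<bar> \<le> 1" using qb by (intro tendsto_upperbound[OF tendsto_rabs[OF L]]) auto
    then have "g e z = l e z" by (auto simp: g_def)
    then show ?thesis using L by simp
  qed
  define Gr where "Gr z = (g ?e1 z, g ?e2 z)" for z
  have Dl: "D \<in> sets lebesgue" using Do by (simp add: borel_open)
  have lebm: "f \<in> borel_measurable (lebesgue_on D)" if "f \<in> borel_measurable borel" for f :: "real \<times> real \<Rightarrow> real"
    using that by (intro measurable_restrict_space1) (simp add: measurable_completion)
  show ?thesis unfolding eikonal_2d_def D_def[symmetric]
  proof (intro exI[of _ Gr] conjI)
    show "AE z in lebesgue_on D. (fst (Gr z))\<^sup>2 + (snd (Gr z))\<^sup>2 = 1"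
    proof -
      have "AE z in lebesgue. z \<notin> Z" using aeD by (rule AE_completion)
      then have "AE z in lebesgue. z \<in> D \<longrightarrow> (fst (Gr z))\<^sup>2 + (snd (Gr z))\<^sup>2 = 1"
      proof (eventually_elim, intro impI)
        fix z assume z: "z \<notin> Z" "z \<in> D"
        then have "(l ?e1 z)\<^sup>2 + (l ?e2 z)\<^sup>2 = 1" by (auto simp: Z_def)
        then show "(fst (Gr z))\<^sup>2 + (snd (Gr z))\<^sup>2 = 1" using lims[OF z(2,1)] by (simp add: Gr_def)
      qed
      then show ?thesis using Dl by (simp add: AE_restrict_space_iff)
    qed
    show "has_weak_gradient D \<psi> Gr"
      unfolding has_weak_gradient_def
    proof (intro conjI ballI)
      show "loc_integrable D \<psi>"
      proof -
        obtain R where R: "\<And>x. x \<in> B \<Longrightarrow> norm x \<le> R" using B(2) by (auto simp: bounded_iff)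
        have "\<bar>\<psi> z\<bar> \<le> \<bar>\<Phi> 0\<bar> + R" if zD: "z \<in> D" for z
        proof -
          obtain x where x: "x \<in> B" "z = p x" using zD interior_subset unfolding D_def by blast
          then show ?thesis using \<Phi>[of x 0] R[OF x(1)] \<Phi>\<psi>[OF x(1)] by simp
        qed
        then show ?thesis using Dl
          by (intro loc_integrable_bounded[OF Do lebm[OF \<psi>m], of "\<bar>\<Phi> 0\<bar> + R"]) (simp add: AE_restrict_space_iff)
      qed
      fix b :: "real \<times> real" assume "b \<in> Basis"
      then have b: "b = ?e1 \<or> b = ?e2" by (auto simp: Basis_prod_def)
      have Grb: "Gr z \<bullet> b = g b z" for z using b by (auto simp: Gr_def inner_prod_def)
      show "loc_integrable D (\<lambda>z. Gr z \<bullet> b)"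
        unfolding Grb by (rule loc_integrable_bounded[OF Do lebm[OF gm], of _ 1]) (simp add: gb)
      show "distr_eq D (distr_deriv b (distr_of D \<psi>)) (distr_of D (\<lambda>z. Gr z \<bullet> b))"
        unfolding distr_eq_def distr_deriv_def distr_of_def Grb
      proof
        fix \<phi> assume \<phi>: "\<phi> \<in> test_functions D"
        have "(LBINT z. \<psi> z * dderiv \<phi> b z) = - (LBINT z. g b z * \<phi> z)"
        proof (rule weak_gradient_of_lipschitz_limit[OF \<psi> Do atop _ gm _ \<phi>])
          show "norm b = 1" using b by (auto simp: norm_prod_def)
          show "AE z in lborel. z \<in> D \<longrightarrow> (\<lambda>j. a j * (\<psi> (z + b /\<^sub>R a j) - \<psi> z)) \<longlonglongrightarrow> g b z"
            using aeD
          proof (eventually_elim, intro impI)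
            fix z assume z: "z \<notin> Z" "z \<in> D"
            show "(\<lambda>j. a j * (\<psi> (z + b /\<^sub>R a j) - \<psi> z)) \<longlonglongrightarrow> g b z"
              using lims[OF z(2,1) b] unfolding q_def by (rule conjunct1)
          qed
        qed
        moreover have "(LINT z|lebesgue_on D. \<psi> z * dderiv \<phi> b z) = (LBINT z. \<psi> z * dderiv \<phi> b z)"
          by (rule test_integral_lebesgue_on[OF Dl lebm[OF \<psi>m] \<psi>m _ order_refl test_functions_dderiv[OF \<phi>]]) simp
        moreover have "(LINT z|lebesgue_on D. g b z * \<phi> z) = (LBINT z. g b z * \<phi> z)"
          by (rule test_integral_lebesgue_on[OF Dl lebm[OF gm] gm _ order_refl \<phi>]) simp
        ultimately show "- (LINT z|lebesgue_on D. \<psi> z * dderiv \<phi> b z) = (LINT z|lebesgue_on D. g b z * \<phi> z)" by simp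
      qed
    qed
  qed
qed

section \<open>The potential and its fibres\<close>

text \<open>Since \<open>\<bar>U\<bar> \<le> 1\<close>, increments of the radial potential are bounded by the length of the step.\<close>

lemma lipschitz_potential:
  fixes U :: "'a::euclidean_space \<Rightarrow> 'a" and c :: 'a and r :: real
  defines "B \<equiv> ball c r"
  assumes r: "r > 0" and U: "U \<in> borel_measurable borel" "\<And>x. norm (U x) \<le> 1" "\<And>x. x \<notin> B \<Longrightarrow> U x = 0"
    and curl: "\<forall>b\<in>Basis. \<forall>b'\<in>Basis. \<forall>\<eta>\<in>test_functions B.
      (LBINT x. (U x \<bullet> b) * dderiv \<eta> b' x) = (LBINT x. (U x \<bullet> b') * dderiv \<eta> b x)"
  obtains \<Phi> where "\<And>x y. \<bar>\<Phi> x - \<Phi> y\<bar> \<le> norm (x - y)"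
    "\<And>v \<eta>. \<eta> \<in> test_functions B \<Longrightarrow> (LBINT x. (indicator B x * \<Phi> x) * dderiv \<eta> v x) = - (LBINT x. (U x \<bullet> v) * \<eta> x)"
    "\<And>v. AE x in lborel. x \<in> B \<and> x + v \<in> B \<longrightarrow> \<Phi> (x + v) - \<Phi> x = (LINT t:{0..1}|lborel. U (x + t *\<^sub>R v) \<bullet> v)"
proof -
  note U(1)[measurable]
  have Bo: "open B" "bounded B" "convex B" by (auto simp: B_def)
  have [measurable]: "B \<in> sets borel" using Bo by simp
  have Uv: "\<bar>U x \<bullet> v\<bar> \<le> norm v" for x v
    using Cauchy_Schwarz_ineq2[of "U x" v] mult_right_mono[OF U(2)[of x] norm_ge_zero[of v]] by simp
  have avg: "\<bar>LINT t:{0..1}|lborel. U (x + t *\<^sub>R v) \<bullet> w\<bar> \<le> norm w" for x v w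
  proof -
    have i: "integrable lborel (\<lambda>t. indicator {0..1} t *\<^sub>R (U (x + t *\<^sub>R v) \<bullet> w) :: real)"
      by (rule integrable_bounded_support[of _ "{0..1}" "norm w"]) (use Uv in \<open>auto simp: indicator_def\<close>)
    have "\<bar>LINT t:{0..1}|lborel. U (x + t *\<^sub>R v) \<bullet> w\<bar> \<le> (LBINT t. \<bar>indicator {0..1} t *\<^sub>R (U (x + t *\<^sub>R v) \<bullet> w)\<bar>)"
      unfolding set_lebesgue_integral_def by (rule integral_abs_bound)
    also have "\<dots> \<le> (LBINT t. norm w * indicator {0..1::real} t)"
    proof (rule integral_mono[OF integrable_abs[OF i]])
      show "integrable lborel (\<lambda>t. norm w * indicator {0..1::real} t)"
        by (rule integrable_bounded_support[of _ "{0..1}" "norm w"]) (auto simp: indicator_def)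
    qed (use Uv in \<open>auto simp: indicator_def\<close>)
    finally show ?thesis by simp
  qed
  define \<Phi>0 where "\<Phi>0 x = (LINT t:{0..1}|lborel. U (c + t *\<^sub>R (x - c)) \<bullet> (x - c))" for x
  define f0 where "f0 x = indicator B x * \<Phi>0 x" for x
  have [measurable]: "\<Phi>0 \<in> borel_measurable borel"
    unfolding \<Phi>0_def[abs_def] set_lebesgue_integral_def by measurable
  have f0: "bounded_borel_on B f0"
    unfolding bounded_borel_on_def
  proof (intro conjI allI impI exI[of _ r] Bo(2))
    show "f0 \<in> borel_measurable borel" unfolding f0_def[abs_def] by measurable
    show "\<bar>f0 x\<bar> \<le> r" for x
      using avg[of c "x - c" "x - c"] r
      by (cases "x \<in> B") (auto simp: f0_def \<Phi>0_def B_def dist_norm norm_minus_commute)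
  qed (simp add: f0_def)
  note [measurable] = bounded_borel_on_borel[OF f0]
  obtain C where C: "\<And>x. \<bar>f0 x\<bar> \<le> C" using bounded_borel_onE[OF f0] by metis
  have weakb: "(LBINT x. f0 x * dderiv \<eta> b x) = - (LBINT x. (U x \<bullet> b) * \<eta> x)"
    if b: "b \<in> Basis" and \<eta>: "\<eta> \<in> test_functions B" for b \<eta>
  proof -
    obtain K where K: "K \<subseteq> B" "\<And>x. x \<notin> K \<Longrightarrow> dderiv \<eta> b x = 0"
      using test_functionsE[OF test_functions_dderiv[OF \<eta>, of b]] by metis
    have "(LBINT x. f0 x * dderiv \<eta> b x) = (LBINT x. \<Phi>0 x * dderiv \<eta> b x)"
    proof (intro Bochner_Integration.integral_cong refl)
      fix x show "f0 x * dderiv \<eta> b x = \<Phi>0 x * dderiv \<eta> b x"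
        using K by (cases "x \<in> B") (auto simp: f0_def)
    qed
    also have "\<dots> = - (LBINT x. (U x \<bullet> b) * \<eta> x)"
      unfolding \<Phi>0_def
      by (rule weak_poincare_lemma[OF U[unfolded B_def] curl[unfolded B_def] b \<eta>[unfolded B_def]])
    finally show ?thesis .
  qed
  have weak0: "(LBINT x. f0 x * dderiv \<eta> v x) = - (LBINT x. (U x \<bullet> v) * \<eta> x)"
    if \<eta>: "\<eta> \<in> test_functions B" for v \<eta>
  proof -
    have sm: "smooth \<eta>" using \<eta> by (simp add: test_functions_iff)
    have i1: "integrable lborel (\<lambda>x. f0 x * dderiv \<eta> b x)" for b
      by (rule integrable_mult_test[OF _ C test_functions_dderiv[OF \<eta>]]) simp
    have i2: "integrable lborel (\<lambda>x. (U x \<bullet> b) * \<eta> x)" for b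
      by (rule integrable_mult_test[OF _ Uv \<eta>]) simp
    have "(LBINT x. f0 x * dderiv \<eta> v x) = (LBINT x. (\<Sum>b\<in>Basis. (v \<bullet> b) * (f0 x * dderiv \<eta> b x)))"
    proof (intro Bochner_Integration.integral_cong refl)
      fix x
      have "dderiv \<eta> v x = (\<Sum>b\<in>Basis. (v \<bullet> b) * dderiv \<eta> b x)"
        by (rule dderiv_basis[OF sm])
      then show "f0 x * dderiv \<eta> v x = (\<Sum>b\<in>Basis. (v \<bullet> b) * (f0 x * dderiv \<eta> b x))"
        by (simp add: sum_distrib_left mult_ac)
    qed
    also have "\<dots> = (\<Sum>b\<in>Basis. (v \<bullet> b) * (LBINT x. f0 x * dderiv \<eta> b x))"
      using i1 by (subst Bochner_Integration.integral_sum) auto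
    also have "\<dots> = (\<Sum>b\<in>Basis. (v \<bullet> b) * - (LBINT x. (U x \<bullet> b) * \<eta> x))"
      by (intro sum.cong refl) (simp add: weakb \<eta>)
    also have "\<dots> = - (\<Sum>b\<in>Basis. LBINT x. (v \<bullet> b) * ((U x \<bullet> b) * \<eta> x))"
      by (simp add: sum_negf)
    also have "(\<Sum>b\<in>Basis. LBINT x. (v \<bullet> b) * ((U x \<bullet> b) * \<eta> x)) = (LBINT x. (\<Sum>b\<in>Basis. (v \<bullet> b) * ((U x \<bullet> b) * \<eta> x)))"
      using i2 by (subst Bochner_Integration.integral_sum) auto
    also have "\<dots> = (LBINT x. (U x \<bullet> v) * \<eta> x)"
      by (intro Bochner_Integration.integral_cong refl)
         (simp add: euclidean_inner[of "U _" v] sum_distrib_right sum_distrib_left mult_ac)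
    finally show ?thesis .
  qed
  have Ubb: "bounded_borel_on B (\<lambda>x. U x \<bullet> v)" for v
    unfolding bounded_borel_on_def using Bo U(3) Uv by auto
  have inc0: "AE x in lborel. x \<in> B \<and> x + v \<in> B \<longrightarrow> f0 (x + v) - f0 x = (LINT t:{0..1}|lborel. U (x + t *\<^sub>R v) \<bullet> v)" for v
    by (rule weak_derivative_increment[OF f0 Ubb Bo(1,3)]) (use weak0 in blast)
  have "AE x in lborel. x \<in> B \<and> x + v \<in> B \<longrightarrow> \<bar>f0 (x + v) - f0 x\<bar> \<le> norm v" for v
    using inc0[of v]
  proof (eventually_elim, intro impI)
    fix x assume "x \<in> B \<and> x + v \<in> B \<longrightarrow> f0 (x + v) - f0 x = (LINT t:{0..1}|lborel. U (x + t *\<^sub>R v) \<bullet> v)" "x \<in> B \<and> x + v \<in> B"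
    then show "\<bar>f0 (x + v) - f0 x\<bar> \<le> norm v" using avg[of x v v] by simp
  qed
  moreover have "B \<noteq> {}" using r by (simp add: B_def)
  ultimately obtain \<Phi> where \<Phi>: "\<And>x y. \<bar>\<Phi> x - \<Phi> y\<bar> \<le> norm (x - y)" and eq: "AE x in lborel. x \<in> B \<longrightarrow> f0 x = \<Phi> x"
    using lipschitz_representative[OF bounded_borel_on_borel[OF f0] Bo(1)] by metis
  have [measurable]: "\<Phi> \<in> borel_measurable borel"
    by (rule borel_measurable_continuous_onI[OF lipschitz_1_continuous[OF \<Phi>]])
  show ?thesis
  proof (rule that[OF \<Phi>])
    fix v and \<eta> :: "'a \<Rightarrow> real" assume \<eta>: "\<eta> \<in> test_functions B"
    have [measurable]: "dderiv \<eta> v \<in> borel_measurable borel"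
      by (rule test_functions_borel[OF test_functions_dderiv[OF \<eta>]])
    have "(LBINT x. (indicator B x * \<Phi> x) * dderiv \<eta> v x) = (LBINT x. f0 x * dderiv \<eta> v x)"
      by (rule integral_cong_AE) (use eq in \<open>auto simp: f0_def indicator_def elim!: eventually_mono\<close>)
    then show "(LBINT x. (indicator B x * \<Phi> x) * dderiv \<eta> v x) = - (LBINT x. (U x \<bullet> v) * \<eta> x)"
      using weak0[OF \<eta>] by simp
  next
    fix v
    have "AE x in distr lborel borel (\<lambda>x. x + v). x \<in> B \<longrightarrow> f0 x = \<Phi> x"
      unfolding lborel_distr_translation by (rule eq)
    then have "AE x in lborel. x + v \<in> B \<longrightarrow> f0 (x + v) = \<Phi> (x + v)"
      by (subst (asm) AE_distr_iff) auto
    then show "AE x in lborel. x \<in> B \<and> x + v \<in> B \<longrightarrow> \<Phi> (x + v) - \<Phi> x = (LINT t:{0..1}|lborel. U (x + t *\<^sub>R v) \<bullet> v)"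
      using eq inc0[of v] by eventually_elim auto
  qed
qed

text \<open>The case of \<open>tangential_weak_derivative\<close> in which \<open>f\<close> is a potential of \<open>U\<close>.\<close>

lemma potential_tangential:
  fixes U :: "'b::euclidean_space \<times> real \<Rightarrow> 'b \<times> real"
  assumes B: "open B" "bounded B" and E: "direction_field E"
    and U: "U \<in> borel_measurable borel" "\<And>x. x \<notin> B \<Longrightarrow> U x = 0"
    and UE: "AE x in lborel. x \<in> B \<longrightarrow> (\<exists>k. fst (U x) = k *\<^sub>R E x)"
    and f: "bounded_borel_on B f"
    and weak: "\<And>v \<eta>. \<eta> \<in> test_functions B \<Longrightarrow> (LBINT x. f x * dderiv \<eta> v x) = - (LBINT x. (U x \<bullet> v) * \<eta> x)"
    and ab: "a \<bullet> b = 0"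
  shows "\<forall>\<eta>\<in>test_functions B. (LBINT x. f x * dderiv \<eta> (tangent_field E a b x) x) = 0"
proof (rule tangential_weak_derivative[where W = "\<lambda>x. fst (U x)" and T = "\<lambda>\<eta> x. - 1 * \<eta> x", OF E f _ _ UE])
  show "(\<lambda>x. fst (U x)) \<in> borel_measurable borel" using U(1) by (simp add: borel_prod[symmetric])
  show "(\<lambda>x. - 1 * \<eta> x) \<in> test_functions B" if "\<eta> \<in> test_functions B" for \<eta>
    by (rule test_functions_mult[OF that smooth_const])
  show "(LBINT x. f x * dderiv \<eta> (p, 0) x) = (LBINT x. (fst (U x) \<bullet> p) * (- 1 * \<eta> x))"
    if "\<eta> \<in> test_functions B" for p \<eta>
    using weak[OF that, of "(p, 0)"] by (simp add: inner_prod_def)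
qed (auto simp: U(2) ab)

text \<open>The nearest point of the plane through the centre spanned by \<open>w\<close> and the vertical is reached by
a translation orthogonal to \<open>w\<close>. It is closer to the centre, so the segment stays in the ball.\<close>

lemma potential_constant_on_fibres_parallel:
  fixes \<Phi> :: "'b::euclidean_space \<times> real \<Rightarrow> real"
  assumes \<Phi>: "continuous_on UNIV \<Phi>" and f: "bounded_borel_on (ball c r) f" "\<And>x. x \<in> ball c r \<Longrightarrow> f x = \<Phi> x"
    and tan: "\<And>a b. a \<bullet> b = 0 \<Longrightarrow> \<forall>\<eta>\<in>test_functions (ball c r).
      (LBINT x. f x * dderiv \<eta> (tangent_field (\<lambda>x. w) a b x) x) = 0"
    and w: "norm w = 1" and x: "x \<in> ball c r"
  shows "(fst c - (w \<bullet> fst c) *\<^sub>R w + (w \<bullet> fst x) *\<^sub>R w, snd x) \<in> ball c r \<and>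
    \<Phi> (fst c - (w \<bullet> fst c) *\<^sub>R w + (w \<bullet> fst x) *\<^sub>R w, snd x) = \<Phi> x"
proof -
  define d where "d = fst c - (w \<bullet> fst c) *\<^sub>R w + (w \<bullet> fst x) *\<^sub>R w - fst x"
  have ww: "w \<bullet> w = 1" using w by (simp add: dot_square_norm)
  have dw: "w \<bullet> d = 0" by (simp add: d_def inner_diff_right inner_add_right ww)
  let ?y = "(fst c - (w \<bullet> fst c) *\<^sub>R w + (w \<bullet> fst x) *\<^sub>R w, snd x)"
  have y: "?y = x + 1 *\<^sub>R (d, 0)" by (simp add: d_def prod_eq_iff)
  have yB: "?y \<in> ball c r"
  proof -
    have "norm (?y - c) \<le> norm (x - c)"
    proof -
      have "fst ?y - fst c = (w \<bullet> (fst x - fst c)) *\<^sub>R w" by (simp add: inner_diff_right algebra_simps)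
      then have "norm (fst ?y - fst c) = \<bar>w \<bullet> (fst x - fst c)\<bar>" using w by simp
      also have "\<dots> \<le> norm (fst x - fst c)" using Cauchy_Schwarz_ineq2[of w "fst x - fst c"] w by simp
      finally have "(norm (fst ?y - fst c))\<^sup>2 \<le> (norm (fst x - fst c))\<^sup>2" by (intro power_mono) auto
      then show ?thesis by (simp add: norm_prod_def)
    qed
    then show ?thesis using x by (simp add: dist_norm norm_minus_commute[of c])
  qed
  have "\<Phi> ?y = \<Phi> x"
  proof -
    interpret T: measure_preserving_affine_flow "\<lambda>t x. x + t *\<^sub>R (d, 0 :: real)" "\<lambda>x. (d, 0)" by (rule translation_flow)
    have weak: "\<forall>\<eta>\<in>test_functions (ball c r). (LBINT x. f x * dderiv \<eta> (d, 0) x) = 0"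
      using tan[OF dw] by (simp add: ww dw)
    have "\<Phi> (x + 1 *\<^sub>R (d, 0)) = \<Phi> x"
    proof (rule T.constant_along_flow[OF \<Phi> f open_ball weak])
      fix t :: real assume t: "0 \<le> t" "t \<le> 1"
      have "(1 - t) *\<^sub>R x + t *\<^sub>R ?y \<in> ball c r" using t x yB by (intro convexD[OF convex_ball]) auto
      then show "x + t *\<^sub>R (d, 0) \<in> ball c r" unfolding y by (simp add: algebra_simps)
    qed simp_all
    then show ?thesis by (simp only: y)
  qed
  then show ?thesis using yB by blast
qed

text \<open>Rotate \<open>x' - P\<close> towards the direction \<open>e\<close> of the centre, in the plane spanned by \<open>e\<close> and
\<open>x' - P\<close>. The angle to \<open>e\<close> decreases, so the distance to the centre decreases and the path stays
in the ball, even when \<open>P\<close> lies inside it.\<close>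

lemma potential_constant_on_fibres_radial:
  fixes \<Phi> :: "'b::euclidean_space \<times> real \<Rightarrow> real"
  assumes \<Phi>: "continuous_on UNIV \<Phi>" and f: "bounded_borel_on (ball c r) f" "\<And>x. x \<in> ball c r \<Longrightarrow> f x = \<Phi> x"
    and tan: "\<And>a b. a \<bullet> b = 0 \<Longrightarrow> \<forall>\<eta>\<in>test_functions (ball c r).
      (LBINT x. f x * dderiv \<eta> (tangent_field (\<lambda>x. fst x - P) a b x) x) = 0"
    and dim: "DIM('b) \<ge> 2" and e: "norm e = 1" "fst c - P = norm (fst c - P) *\<^sub>R e" and x: "x \<in> ball c r"
  shows "(P + norm (fst x - P) *\<^sub>R e, snd x) \<in> ball c r \<and> \<Phi> (P + norm (fst x - P) *\<^sub>R e, snd x) = \<Phi> x"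
proof -
  define y where "y = fst x - P"
  define \<rho> where "\<rho> = norm y"
  define m where "m = norm (fst c - P)"
  have ee: "e \<bullet> e = 1" using e by (simp add: dot_square_norm)
  obtain f' \<theta> where f': "norm f' = 1" "f' \<bullet> e = 0" and \<theta>: "0 \<le> \<theta>" "\<theta> \<le> pi"
    and y: "y = (\<rho> * sin \<theta>) *\<^sub>R f' + (\<rho> * cos \<theta>) *\<^sub>R e"
  proof (cases "y = 0")
    case True
    obtain g where "norm g = 1" "g \<bullet> e = 0" using exists_unit_orthogonal[OF dim] by blast
    then show ?thesis using True by (intro that[of g 0]) (auto simp: \<rho>_def)
  next
    case False
    then have \<rho>: "\<rho> > 0" by (simp add: \<rho>_def)
    define q where "q = (y \<bullet> e) / \<rho>"
    define z where "z = y - (y \<bullet> e) *\<^sub>R e"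
    have "\<bar>y \<bullet> e\<bar> \<le> \<rho>" using Cauchy_Schwarz_ineq2[of y e] e by (simp add: \<rho>_def)
    then have q: "- 1 \<le> q" "q \<le> 1" using \<rho> by (auto simp: q_def field_simps abs_le_iff)
    have ze: "z \<bullet> e = 0" by (simp add: z_def inner_diff_left ee)
    have "z \<bullet> z = y \<bullet> y - (y \<bullet> e)\<^sup>2"
      by (simp add: z_def inner_diff_left inner_diff_right ee inner_commute[of e y] power2_eq_square)
    also have "y \<bullet> y = \<rho>\<^sup>2" by (simp add: \<rho>_def dot_square_norm)
    also have "(y \<bullet> e)\<^sup>2 = \<rho>\<^sup>2 * q\<^sup>2" using \<rho> by (simp add: q_def power_divide)
    finally have "z \<bullet> z = \<rho>\<^sup>2 * (1 - q\<^sup>2)" by (simp add: right_diff_distrib)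
    then have "(norm z)\<^sup>2 = (\<rho> * sqrt (1 - q\<^sup>2))\<^sup>2"
      using q by (simp add: power_mult_distrib abs_square_le_1 abs_le_iff power2_norm_eq_inner)
    then have nz: "norm z = \<rho> * sin (arccos q)"
      using \<rho> q by (subst (asm) power2_eq_iff_nonneg) (auto simp: sin_arccos abs_square_le_1 abs_le_iff)
    have yz: "y = z + (\<rho> * cos (arccos q)) *\<^sub>R e" using q \<rho> by (simp add: z_def q_def)
    obtain g where g: "norm g = 1" "g \<bullet> e = 0" "z = norm z *\<^sub>R g"
    proof (cases "z = 0")
      case True
      obtain g where "norm g = 1" "g \<bullet> e = 0" using exists_unit_orthogonal[OF dim] by blast
      then show ?thesis using True by (intro that[of g]) auto
    next
      case False
      show ?thesis by (rule that[of "z /\<^sub>R norm z"]) (use False ze in auto)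
    qed
    show ?thesis
    proof (rule that[OF g(1,2), of "arccos q"])
      show "0 \<le> arccos q" "arccos q \<le> pi" using q by (auto intro: arccos_lbound arccos_ubound)
      have "z = (\<rho> * sin (arccos q)) *\<^sub>R g" using g(3) nz by simp
      then show "y = (\<rho> * sin (arccos q)) *\<^sub>R g + (\<rho> * cos (arccos q)) *\<^sub>R e" using yz by simp
    qed
  qed
  have ff: "f' \<bullet> f' = 1" "e \<bullet> f' = 0" using f' by (simp_all add: dot_square_norm inner_commute)
  (* The point with angle t to the axis e: x is at t = theta, the section at t = 0. *)
  define X where "X t = (P + ((\<rho> * sin t) *\<^sub>R f' + (\<rho> * cos t) *\<^sub>R e), snd x)" for t
  have XB: "X t \<in> ball c r" if t: "0 \<le> t" "t \<le> \<theta>" for t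
  proof -
    have nX: "(norm (fst (X t) - fst c))\<^sup>2 = \<rho>\<^sup>2 + m\<^sup>2 - 2 * m * \<rho> * cos t" for t
    proof -
      have "fst (X t) - fst c = (\<rho> * sin t) *\<^sub>R f' + (\<rho> * cos t - m) *\<^sub>R e"
        using e(2) unfolding m_def[symmetric] by (simp add: X_def algebra_simps)
      then have "(norm (fst (X t) - fst c))\<^sup>2 = (\<rho> * sin t)\<^sup>2 + (\<rho> * cos t - m)\<^sup>2"
        unfolding power2_norm_eq_inner by (simp add: inner_add_left inner_add_right ff f' ee power2_eq_square)
      also have "\<dots> = \<rho>\<^sup>2 * ((sin t)\<^sup>2 + (cos t)\<^sup>2) + m\<^sup>2 - 2 * m * \<rho> * cos t"
        by algebra
      finally show ?thesis by simp
    qed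
    have "cos \<theta> \<le> cos t" using t \<theta> by (intro cos_monotone_0_pi_le) auto
    then have "2 * m * \<rho> * cos \<theta> \<le> 2 * m * \<rho> * cos t" by (intro mult_left_mono) (auto simp: m_def \<rho>_def)
    then have le: "(norm (fst (X t) - fst c))\<^sup>2 \<le> (norm (fst (X \<theta>) - fst c))\<^sup>2" by (simp add: nX)
    have "X \<theta> = x" unfolding X_def y[symmetric] by (simp add: y_def)
    then have "norm (X t - c) \<le> norm (x - c)" using le by (simp add: norm_prod_def X_def)
    then show ?thesis using x by (simp add: dist_norm norm_minus_commute[of c])
  qed
  have X0: "X 0 = (P + norm (fst x - P) *\<^sub>R e, snd x)" by (simp add: X_def \<rho>_def y_def)
  have rot: "rotation_about P f' e t x = X (\<theta> - t)" for t
  proof -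
    have ip: "y \<bullet> f' = \<rho> * sin \<theta>" "y \<bullet> e = \<rho> * cos \<theta>"
      by (subst y, simp add: inner_add_left ff f' ee)+
    have "rotate_plane f' e t y = (\<rho> * sin (\<theta> - t)) *\<^sub>R f' + (\<rho> * cos (\<theta> - t)) *\<^sub>R e"
      unfolding rotate_plane_def ip by (subst y) (simp add: sin_diff cos_diff algebra_simps)
    then show ?thesis by (simp add: rotation_about_def X_def y_def)
  qed
  interpret T: measure_preserving_affine_flow "rotation_about P f' e" "tangent_field (\<lambda>x. fst x - P) f' e"
    by (rule rotation_flow[OF f'(1) e(1) f'(2)])
  have "\<Phi> (rotation_about P f' e \<theta> x) = \<Phi> x"
    by (rule T.constant_along_flow[OF \<Phi> f open_ball tan[OF f'(2)]]) (use XB \<theta> in \<open>auto simp: rot\<close>)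
  then have "\<Phi> (X 0) = \<Phi> x" by (simp add: rot)
  moreover have "X 0 \<in> ball c r" using XB[of 0] \<theta> by simp
  ultimately show ?thesis by (simp only: X0)
qed

section \<open>The stream function\<close>

text \<open>Every fibre of \<open>(\<alpha>, \<beta>)\<close> in the ball meets the plane, or half plane, through the centre spanned
by \<open>w\<close>, respectively \<open>e\<close>, and the vertical. Parametrised by \<open>(\<alpha>, \<beta>)\<close>, this section is isometric,
so the restriction \<open>\<psi>\<close> of \<open>\<Phi>\<close> to it is 1-Lipschitz.\<close>

lemma potential_stream_function:
  fixes U :: "'b::euclidean_space \<times> real \<Rightarrow> 'b \<times> real" and c :: "'b \<times> real" and r :: real
  defines "B \<equiv> ball c r"
  assumes r: "r > 0" and dim: "DIM('b) \<ge> 2" and E: "direction_field E" and \<sigma>: "\<sigma> \<in> {1, - 1 :: real}"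
    and U: "U \<in> borel_measurable borel" "\<And>x. x \<in> B \<Longrightarrow> norm (U x) = 1" "\<And>x. x \<notin> B \<Longrightarrow> U x = 0"
    and UE: "AE x in lborel. x \<in> B \<longrightarrow> E x \<noteq> 0 \<and> fst (U x) = (\<sigma> * (norm (fst (U x)) / norm (E x))) *\<^sub>R E x"
    and curl: "\<And>a \<eta>. \<eta> \<in> test_functions B \<Longrightarrow>
      (LBINT x. snd (U x) * dderiv \<eta> (a, 0) x) = (LBINT x. (fst (U x) \<bullet> a) * dderiv \<eta> (0, 1) x)"
  shows "\<exists>\<Phi> \<psi>. (\<forall>x y. \<bar>\<Phi> x - \<Phi> y\<bar> \<le> norm (x - y)) \<and>
    (\<forall>v. \<forall>\<eta>\<in>test_functions B. (LBINT x. (indicator B x * \<Phi> x) * dderiv \<eta> v x) = - (LBINT x. (U x \<bullet> v) * \<eta> x)) \<and>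
    ((\<exists>P. eikonal_2d (interior ((\<lambda>x. (norm (fst x - P), snd x)) ` B)) \<psi> \<and> (\<forall>x\<in>B. \<Phi> x = \<psi> (norm (fst x - P), snd x))) \<or>
     (\<exists>w\<in>sphere 0 1. eikonal_2d (interior ((\<lambda>x. (w \<bullet> fst x, snd x)) ` B)) \<psi> \<and> (\<forall>x\<in>B. \<Phi> x = \<psi> (w \<bullet> fst x, snd x))))"
proof -
  have Bo: "open B" "bounded B" by (auto simp: B_def)
  have [measurable]: "B \<in> sets borel" using Bo by simp
  have Un: "norm (U x) \<le> 1" for x using U(2)[of x] U(3)[of x] by (cases "x \<in> B") auto
  have curl': "\<forall>b\<in>Basis. \<forall>b'\<in>Basis. \<forall>\<eta>\<in>test_functions B.
      (LBINT x. (U x \<bullet> b) * dderiv \<eta> b' x) = (LBINT x. (U x \<bullet> b') * dderiv \<eta> b x)"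
  proof (intro ballI)
    fix b b' :: "'b \<times> real" and \<eta> assume b: "b \<in> Basis" "b' \<in> Basis" and \<eta>: "\<eta> \<in> test_functions B"
    have mixed: "(LBINT x. (U x \<bullet> (a, 0)) * dderiv \<eta> (0, 1) x) = (LBINT x. (U x \<bullet> (0, 1)) * dderiv \<eta> (a, 0) x)" for a
      using curl[OF \<eta>, of a] by (simp add: inner_prod_def)
    consider "b = b'" | a where "b = (a, 0)" "b' = (0, 1)" | a where "b = (0, 1)" "b' = (a, 0)"
      | a a' where "b = (a, 0)" "b' = (a', 0)" "a \<in> Basis" "a' \<in> Basis" "a \<noteq> a'"
      using b by (auto simp: Basis_prod_def)
    then show "(LBINT x. (U x \<bullet> b) * dderiv \<eta> b' x) = (LBINT x. (U x \<bullet> b') * dderiv \<eta> b x)"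
    proof cases
      case (4 a a')
      have "(LBINT x. (fst (U x) \<bullet> a) * dderiv \<eta> (a', 0) x) = (LBINT x. (fst (U x) \<bullet> a') * dderiv \<eta> (a, 0) x)"
        by (rule horizontal_curl_free[OF Bo E \<sigma> U UE curl _ _ _ \<eta>]) (use 4 in \<open>auto simp: inner_not_same_Basis\<close>)
      then show ?thesis using 4 by (simp add: inner_prod_def)
    qed (use mixed in auto)
  qed
  obtain \<Phi> where \<Phi>: "\<And>x y. \<bar>\<Phi> x - \<Phi> y\<bar> \<le> norm (x - y)"
    and weak: "\<And>v \<eta>. \<eta> \<in> test_functions B \<Longrightarrow> (LBINT x. (indicator B x * \<Phi> x) * dderiv \<eta> v x) = - (LBINT x. (U x \<bullet> v) * \<eta> x)"
    and inc: "\<And>v. AE x in lborel. x \<in> B \<and> x + v \<in> B \<longrightarrow> \<Phi> (x + v) - \<Phi> x = (LINT t:{0..1}|lborel. U (x + t *\<^sub>R v) \<bullet> v)"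
    using lipschitz_potential[OF r U(1) Un U(3)[unfolded B_def] curl'[unfolded B_def]] unfolding B_def by blast
  have \<Phi>c: "continuous_on UNIV \<Phi>" by (rule lipschitz_1_continuous[OF \<Phi>])
  note [measurable] = borel_measurable_continuous_onI[OF \<Phi>c]
  define f where "f x = indicator B x * \<Phi> x" for x
  have f: "bounded_borel_on B f"
    unfolding bounded_borel_on_def
  proof (intro conjI allI impI exI[of _ "\<bar>\<Phi> c\<bar> + r"] Bo(2))
    show "f \<in> borel_measurable borel" unfolding f_def[abs_def] by measurable
    show "\<bar>f x\<bar> \<le> \<bar>\<Phi> c\<bar> + r" for x
      using \<Phi>[of x c] r by (cases "x \<in> B") (auto simp: f_def B_def dist_norm norm_minus_commute)
  qed (simp add: f_def)
  have f\<Phi>: "f x = \<Phi> x" if "x \<in> B" for x using that by (simp add: f_def)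
  have UE': "AE x in lborel. x \<in> B \<longrightarrow> (\<exists>k. fst (U x) = k *\<^sub>R E x)"
    using UE by eventually_elim blast
  have weakf: "(LBINT x. f x * dderiv \<eta> v x) = - (LBINT x. (U x \<bullet> v) * \<eta> x)"
    if "\<eta> \<in> test_functions B" for v \<eta>
    unfolding f_def by (rule weak[OF that])
  have tan: "\<forall>\<eta>\<in>test_functions B. (LBINT x. f x * dderiv \<eta> (tangent_field E a b x) x) = 0" if "a \<bullet> b = 0" for a b
    by (rule potential_tangential[OF Bo E U(1,3) UE' f weakf that])
  obtain R where R: "strict_mono R" "AE x in lborel. x \<in> B \<longrightarrow> (\<forall>v. norm v < 2 \<longrightarrow>
    (\<lambda>j. real (Suc (R j)) * (\<Phi> (x + v /\<^sub>R real (Suc (R j))) - \<Phi> x)) \<longlonglongrightarrow> U x \<bullet> v)"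
    using AE_directional_derivatives[OF \<Phi> U(1) Un Bo inc] by (elim exE conjE) (rule that)
  have section_lip: "\<bar>\<Phi> (Q + fst y *\<^sub>R e, snd y) - \<Phi> (Q + fst z *\<^sub>R e, snd z)\<bar> \<le> norm (y - z)"
    if "norm e = 1" for Q e and y z :: "real \<times> real"
  proof -
    have "(Q + fst y *\<^sub>R e, snd y) - (Q + fst z *\<^sub>R e, snd z) = ((fst y - fst z) *\<^sub>R e, snd y - snd z)"
      by (simp add: scaleR_left_diff_distrib)
    then have "norm ((Q + fst y *\<^sub>R e, snd y) - (Q + fst z *\<^sub>R e, snd z)) = norm (y - z)"
      using that by (simp add: norm_prod_def)
    then show ?thesis using \<Phi> by metis
  qed
  show ?thesis
    using E
  proof (cases rule: direction_field_cases)
    case (1 w)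
    define Q where "Q = fst c - (w \<bullet> fst c) *\<^sub>R w"
    define \<psi> where "\<psi> z = \<Phi> (Q + fst z *\<^sub>R w, snd z)" for z
    have fib: "\<Phi> x = \<psi> (w \<bullet> fst x, snd x)" if "x \<in> B" for x
      using potential_constant_on_fibres_parallel[OF \<Phi>c f[unfolded B_def] _ _ 1(1) that[unfolded B_def]] f\<Phi> tan
      unfolding 1(2) B_def \<psi>_def Q_def by simp
    have "eikonal_2d (interior ((\<lambda>x. (w \<bullet> fst x, snd x)) ` B)) \<psi>"
    proof (rule eikonal_of_fibred_potential[where A = UNIV, OF Bo \<sigma> U(2) UE R \<Phi>])
      show "\<bar>\<psi> y - \<psi> z\<bar> \<le> norm (y - z)" for y z unfolding \<psi>_def by (rule section_lip[OF 1(1)])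
      show "E x \<noteq> 0 \<longleftrightarrow> w \<bullet> fst x \<in> UNIV" for x using 1 by auto
      show "w \<bullet> (fst x + s *\<^sub>R (E x /\<^sub>R norm (E x))) = w \<bullet> fst x + s \<and>
          E (fst x + s *\<^sub>R (E x /\<^sub>R norm (E x)), b) /\<^sub>R norm (E (fst x + s *\<^sub>R (E x /\<^sub>R norm (E x)), b)) = E x /\<^sub>R norm (E x)"
        for x s b using 1 by (simp add: inner_add_right dot_square_norm)
    qed (use fib 1 in \<open>auto intro!: continuous_intros\<close>)
    then show ?thesis using \<Phi> weak fib 1(1) by (intro exI[of _ \<Phi>] exI[of _ \<psi>]) auto
  next
    case (2 P)
    obtain e where e: "norm e = 1" "fst c - P = norm (fst c - P) *\<^sub>R e"
    proof (cases "fst c = P")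
      case True
      obtain b :: 'b where "b \<in> Basis" using nonempty_Basis by blast
      then show ?thesis using that[of b] True by simp
    next
      case False
      then show ?thesis using that[of "(fst c - P) /\<^sub>R norm (fst c - P)"] by simp
    qed
    define \<psi> where "\<psi> z = \<Phi> (P + fst z *\<^sub>R e, snd z)" for z
    have fib: "\<Phi> x = \<psi> (norm (fst x - P), snd x)" if "x \<in> B" for x
      using potential_constant_on_fibres_radial[OF \<Phi>c f[unfolded B_def] _ _ dim e that[unfolded B_def]] f\<Phi> tan
      unfolding 2 B_def \<psi>_def by simp
    have "eikonal_2d (interior ((\<lambda>x. (norm (fst x - P), snd x)) ` B)) \<psi>"
    proof (rule eikonal_of_fibred_potential[where A = "{0<..}", OF Bo \<sigma> U(2) UE R \<Phi>])
      show "\<bar>\<psi> y - \<psi> z\<bar> \<le> norm (y - z)" for y z unfolding \<psi>_def by (rule section_lip[OF e(1)])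
      show "norm (fst x + s *\<^sub>R (E x /\<^sub>R norm (E x)) - P) = norm (fst x - P) + s \<and>
          E (fst x + s *\<^sub>R (E x /\<^sub>R norm (E x)), b) /\<^sub>R norm (E (fst x + s *\<^sub>R (E x /\<^sub>R norm (E x)), b)) = E x /\<^sub>R norm (E x)"
        if "E x \<noteq> 0" "norm (fst x - P) + s \<in> {0<..}" for x s b
      proof -
        define y where "y = fst x - P"
        have y: "y \<noteq> 0" "norm y + s > 0" using that by (auto simp: y_def 2)
        have "(norm y + s) / norm y = 1 + s * inverse (norm y)" using y(1) by (simp add: field_simps)
        then have "y + s *\<^sub>R (y /\<^sub>R norm y) = ((norm y + s) / norm y) *\<^sub>R y"
          by (simp only: scaleR_left_distrib scaleR_one scaleR_scaleR)
        moreover have "fst x + s *\<^sub>R (y /\<^sub>R norm y) - P = y + s *\<^sub>R (y /\<^sub>R norm y)" by (simp add: y_def)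
        ultimately have eq: "fst x + s *\<^sub>R (y /\<^sub>R norm y) - P = ((norm y + s) / norm y) *\<^sub>R y" by simp
        have n: "norm (((norm y + s) / norm y) *\<^sub>R y) = norm y + s" using y by simp
        have "(((norm y + s) / norm y) *\<^sub>R y) /\<^sub>R (norm y + s) = y /\<^sub>R norm y" using y by (simp add: divide_inverse)
        then show ?thesis unfolding 2 y_def[symmetric] fst_conv eq n by simp
      qed
      show "interior ((\<lambda>x. (norm (fst x - P), snd x)) ` B) \<subseteq> {0<..} \<times> UNIV"
      proof
        (* The image has points with first coordinate 0 if P is below the ball, but no points to the
           left of them, so these are not interior. *)
        fix z assume "z \<in> interior ((\<lambda>x. (norm (fst x - P), snd x)) ` B)"
        then obtain \<epsilon> where \<epsilon>: "\<epsilon> > 0" "ball z \<epsilon> \<subseteq> (\<lambda>x. (norm (fst x - P), snd x)) ` B"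
          by (meson mem_interior)
        have "z - (\<epsilon> / 2, 0) \<in> ball z \<epsilon>" using \<epsilon>(1) by (simp add: dist_norm norm_prod_def)
        then obtain x where "z - (\<epsilon> / 2, 0) = (norm (fst x - P), snd x)" using \<epsilon>(2) by blast
        then have "fst z - \<epsilon> / 2 = norm (fst x - P)" by (cases z) simp
        then have "fst z > 0" using \<epsilon>(1) norm_ge_zero[of "fst x - P"] by linarith
        then show "z \<in> {0<..} \<times> UNIV" by (cases z) auto
      qed
      show "E differentiable (at x)" for x
        unfolding 2 by (intro differentiable_diff differentiable_const linear_imp_differentiable linear_fst)
    qed (use fib 2 in \<open>auto intro!: continuous_intros\<close>)
    then show ?thesis using \<Phi> weak fib by (intro exI[of _ \<Phi>] exI[of _ \<psi>]) auto
  qed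
qed

text \<open>Returns from integrals of Borel representatives over the whole space to Lebesgue integrals over
the ball.\<close>

lemma has_weak_gradient_of_potential:
  fixes U u :: "'a::euclidean_space \<Rightarrow> 'a" and c :: 'a and r :: real
  defines "B \<equiv> ball c r"
  assumes u: "u \<in> borel_measurable (lebesgue_on B)" and U: "U \<in> borel_measurable borel" "\<And>x. norm (U x) \<le> 1"
    and eq: "AE x in lborel. x \<in> B \<longrightarrow> U x = u x"
    and \<Phi>: "\<And>x y. \<bar>\<Phi> x - \<Phi> y\<bar> \<le> norm (x - y)"
    and weak: "\<And>v \<eta>. \<eta> \<in> test_functions B \<Longrightarrow> (LBINT x. (indicator B x * \<Phi> x) * dderiv \<eta> v x) = - (LBINT x. (U x \<bullet> v) * \<eta> x)"
    and g: "\<And>x. x \<in> B \<Longrightarrow> g x = \<Phi> x"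
  shows "has_weak_gradient B g u"
proof -
  have Bo: "open B" and Bl: "B \<in> sets lebesgue" by (auto simp: B_def)
  have [measurable]: "B \<in> sets borel" using Bo by simp
  note [measurable] = U(1) borel_measurable_continuous_onI[OF lipschitz_1_continuous[OF \<Phi>]]
  have gm: "g \<in> borel_measurable (lebesgue_on B)"
  proof -
    have "\<Phi> \<in> borel_measurable (lebesgue_on B)" by (intro measurable_restrict_space1) (simp add: measurable_completion)
    then show ?thesis by (subst measurable_cong[where g = \<Phi>]) (auto simp: g)
  qed
  have ub: "(\<lambda>x. u x \<bullet> b) \<in> borel_measurable (lebesgue_on B)" for b using u by (intro borel_measurable_inner) auto
  have Uv: "\<bar>U x \<bullet> v\<bar> \<le> norm v" for x v
    using Cauchy_Schwarz_ineq2[of "U x" v] mult_right_mono[OF U(2)[of x] norm_ge_zero[of v]] by simp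
  show ?thesis
    unfolding has_weak_gradient_def
  proof (intro conjI ballI)
    show "loc_integrable B g"
    proof (rule loc_integrable_bounded[OF Bo gm])
      have "\<bar>g x\<bar> \<le> \<bar>\<Phi> c\<bar> + r" if "x \<in> B" for x
        using \<Phi>[of x c] that by (simp add: g B_def dist_norm norm_minus_commute)
      then show "AE x in lebesgue_on B. \<bar>g x\<bar> \<le> \<bar>\<Phi> c\<bar> + r" using Bl by (simp add: AE_restrict_space_iff)
    qed
    fix b :: 'a assume b: "b \<in> Basis"
    show "loc_integrable B (\<lambda>x. u x \<bullet> b)"
    proof (rule loc_integrable_bounded[OF Bo ub])
      have "AE x in lebesgue. x \<in> B \<longrightarrow> U x = u x" using eq by (rule AE_completion)
      then have "AE x in lebesgue. x \<in> B \<longrightarrow> \<bar>u x \<bullet> b\<bar> \<le> norm b"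
        by eventually_elim (use Uv in metis)
      then show "AE x in lebesgue_on B. \<bar>u x \<bullet> b\<bar> \<le> norm b" using Bl by (simp add: AE_restrict_space_iff)
    qed
    show "distr_eq B (distr_deriv b (distr_of B g)) (distr_of B (\<lambda>x. u x \<bullet> b))"
      unfolding distr_eq_def distr_deriv_def distr_of_def
    proof
      fix \<eta> assume \<eta>: "\<eta> \<in> test_functions B"
      have "(LINT x|lebesgue_on B. g x * dderiv \<eta> b x) = (LBINT x. (indicator B x * \<Phi> x) * dderiv \<eta> b x)"
        by (rule test_integral_lebesgue_on[OF Bl gm _ _ order_refl test_functions_dderiv[OF \<eta>]]) (auto simp: g)
      moreover have "(LINT x|lebesgue_on B. (u x \<bullet> b) * \<eta> x) = (LBINT x. (U x \<bullet> b) * \<eta> x)"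
        by (rule test_integral_lebesgue_on[OF Bl ub _ _ order_refl \<eta>]) (use eq in \<open>auto elim!: eventually_mono\<close>)
      ultimately show "- (LINT x|lebesgue_on B. g x * dderiv \<eta> b x) = (LINT x|lebesgue_on B. (u x \<bullet> b) * \<eta> x)"
        using weak[OF \<eta>, of b] by simp
    qed
  qed
qed

theorem theorem10:
  fixes \<Omega> :: "((real ^ 'm) \<times> real) set"
    and u :: "(real ^ 'm) \<times> real \<Rightarrow> (real ^ 'm) \<times> real"
  assumes dim: "DIM((real ^ 'm) \<times> real) \<ge> 4"
    and open_domain: "open \<Omega>"
    and measurable_u: "u \<in> borel_measurable (lebesgue_on \<Omega>)"
    and unit_u: "AE x in lebesgue_on \<Omega>. norm (u x) = 1"
    and kinetic: "\<And>\<xi> v. \<xi> \<in> equator \<Longrightarrow> v \<bullet> \<xi> = 0 \<Longrightarrow>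
      distr_eq \<Omega> (distr_deriv v (distr_of \<Omega> (\<lambda>x. chi u x \<xi>))) (\<lambda>\<phi>. 0)"
    and curl: "\<And>k. distr_eq \<Omega> (distr_deriv (axis k 1, 0) (distr_of \<Omega> (\<lambda>x. snd (u x))))
      (distr_deriv e_N (distr_of \<Omega> (\<lambda>x. fst (u x) $ k)))"
  shows "\<forall>c r. 0 < r \<and> ball c r \<subseteq> {x \<in> \<Omega>. u x \<noteq> e_N \<and> u x \<noteq> - e_N} \<longrightarrow>
    (\<exists>\<psi>. (\<exists>P'. stream_function u (ball c r) (\<lambda>x. norm (fst x - P')) (\<lambda>x. snd x) \<psi>) \<or>
         (\<exists>w'\<in>sphere 0 1. stream_function u (ball c r) (\<lambda>x. w' \<bullet> fst x) (\<lambda>x. snd x) \<psi>))"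
proof (intro allI impI, elim conjE)
  fix c :: "(real ^ 'm) \<times> real" and r :: real
  assume r: "0 < r" and sub: "ball c r \<subseteq> {x \<in> \<Omega>. u x \<noteq> e_N \<and> u x \<noteq> - e_N}"
  define B where "B = ball c r"
  have B\<Omega>: "B \<subseteq> \<Omega>" using sub by (auto simp: B_def)
  have Bo: "open B" "bounded B" "convex B" "B \<noteq> {}" using r by (auto simp: B_def)
  have [measurable]: "B \<in> sets borel" using Bo by simp
  have \<Omega>l: "\<Omega> \<in> sets lebesgue" using open_domain by (simp add: borel_open)
  have fsm [measurable]: "fst \<in> borel_measurable (borel :: ((real ^ 'm) \<times> real) measure)"
    "snd \<in> borel_measurable (borel :: ((real ^ 'm) \<times> real) measure)"
    by (auto intro!: borel_measurable_continuous_onI continuous_intros)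
  have d3: "DIM(real ^ 'm) \<ge> 3" using dim by simp
  obtain e :: "real ^ 'm" where e: "norm e = 1" using vector_choose_size[of 1] by auto
  obtain u' where u' [measurable]: "u' \<in> borel_measurable borel" and u'u: "AE x in lborel. x \<in> \<Omega> \<longrightarrow> u' x = u x"
    using borel_representative[OF \<Omega>l measurable_u] by blast
  (* The default value (e, 0) makes U a unit vector with nonzero horizontal part at every point
     of B, not only at almost every point. *)
  define U where "U x = (if x \<in> B then (if norm (u' x) = 1 \<and> fst (u' x) \<noteq> 0 then u' x else (e, 0)) else 0)" for x
  have Um [measurable]: "U \<in> borel_measurable borel" unfolding U_def[abs_def] by measurable
  have U1: "norm (U x) = 1" and U2: "fst (U x) \<noteq> 0" if "x \<in> B" for x
    using that e by (auto simp: U_def norm_prod_def)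
  have U0: "U x = 0" if "x \<notin> B" for x using that by (simp add: U_def)
  have Un: "norm (U x) \<le> 1" for x using U1[of x] U0[of x] by (cases "x \<in> B") auto
  have Uu: "AE x in lborel. x \<in> B \<longrightarrow> U x = u x"
  proof -
    have "AE x in lebesgue. x \<in> \<Omega> \<longrightarrow> norm (u x) = 1" using unit_u \<Omega>l by (simp add: AE_restrict_space_iff)
    then have "AE x in lebesgue. x \<in> \<Omega> \<longrightarrow> u' x = u x \<and> norm (u' x) = 1"
      using AE_completion[OF u'u] by eventually_elim auto
    then have "AE x in lebesgue. x \<in> B \<longrightarrow> U x = u x"
    proof (eventually_elim, intro impI)
      fix x assume *: "x \<in> \<Omega> \<longrightarrow> u' x = u x \<and> norm (u' x) = 1" "x \<in> B"
      then have x: "u' x = u x" "norm (u' x) = 1" "u x \<noteq> e_N" "u x \<noteq> - e_N" using sub by (auto simp: B_def)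
      have "fst (u' x) \<noteq> 0"
      proof
        assume 0: "fst (u' x) = 0"
        then have "\<bar>snd (u' x)\<bar> = 1" using x(2) by (simp add: norm_prod_def)
        then have "u' x = (0, 1) \<or> u' x = (0, - 1)" using 0 by (auto simp: prod_eq_iff abs_if split: if_splits)
        then show False using x by (auto simp: e_N_def)
      qed
      then show "U x = u x" using x *(2) by (simp add: U_def)
    qed
    then show ?thesis
      by (subst (asm) AE_completion_iff) auto
  qed
  have transfer: "(LINT x|lebesgue_on \<Omega>. F (u x) * \<eta> x) = (LBINT x. (indicator B x * F (U x)) * \<eta> x)"
    if [measurable]: "F \<in> borel_measurable borel" and \<eta>: "\<eta> \<in> test_functions B" for F :: "(real ^ 'm) \<times> real \<Rightarrow> real" and \<eta>
  proof (rule test_integral_lebesgue_on[OF \<Omega>l _ _ _ B\<Omega> \<eta>])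
    show "(\<lambda>x. F (u x)) \<in> borel_measurable (lebesgue_on \<Omega>)"
      using measurable_compose[OF measurable_u that(1)] .
    show "(\<lambda>x. indicator B x * F (U x)) \<in> borel_measurable borel" by measurable
    show "AE x in lborel. x \<in> B \<longrightarrow> F (u x) = indicator B x * F (U x)"
      using Uu by eventually_elim auto
  qed
  have curlB: "(LBINT x. snd (U x) * dderiv \<eta> (a, 0) x) = (LBINT x. (fst (U x) \<bullet> a) * dderiv \<eta> (0, 1) x)"
    if \<eta>: "\<eta> \<in> test_functions B" for a \<eta>
  proof -
    have sm: "smooth \<eta>" using \<eta> by (simp add: test_functions_iff)
    note d\<eta> = test_functions_dderiv[OF \<eta>]
    have [simp]: "indicator B x * snd (U x) = snd (U x)" "indicator B x * (fst (U x) $ k) = fst (U x) $ k" for x k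
      using U0[of x] by (cases "x \<in> B"; simp)+
    have km: "(\<lambda>z::(real ^ 'm) \<times> real. fst z $ k) \<in> borel_measurable borel" for k
      by (intro borel_measurable_continuous_onI continuous_intros)
    have ax: "(LBINT x. snd (U x) * dderiv \<eta> (axis k 1, 0) x) = (LBINT x. (fst (U x) $ k) * dderiv \<eta> (0, 1) x)" for k
    proof -
      have "(LINT x|lebesgue_on \<Omega>. snd (u x) * dderiv \<eta> (axis k 1, 0) x) = (LINT x|lebesgue_on \<Omega>. (fst (u x) $ k) * dderiv \<eta> (0, 1) x)"
        using curl[of k] test_functions_mono[OF \<eta> B\<Omega>] by (simp add: distr_eq_def distr_deriv_def distr_of_def e_N_def)
      then show ?thesis using transfer[OF fsm(2) d\<eta>] transfer[OF km d\<eta>] by simp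
    qed
    have b1: "\<bar>snd (U x)\<bar> \<le> 1" for x using norm_snd_le[of "snd (U x)" "fst (U x)"] Un[of x] by simp
    have b2: "\<bar>fst (U x) $ k\<bar> \<le> 1" for x k
      using component_le_norm_cart[of "fst (U x)" k] norm_fst_le[of "fst (U x)" "snd (U x)"] Un[of x] by simp
    have i1: "integrable lborel (\<lambda>x. snd (U x) * dderiv \<eta> v x)" for v
      by (rule integrable_mult_test[OF _ b1 d\<eta>]) measurable
    have i2: "integrable lborel (\<lambda>x. (fst (U x) $ k) * dderiv \<eta> v x)" for k v
      by (rule integrable_mult_test[OF _ b2 d\<eta>]) (rule measurable_compose[OF Um km])
    have "(LBINT x. snd (U x) * dderiv \<eta> (a, 0) x) = (LBINT x. (\<Sum>k\<in>UNIV. (a $ k) * (snd (U x) * dderiv \<eta> (axis k 1, 0) x)))"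
    proof (intro Bochner_Integration.integral_cong refl)
      fix x
      have "(a, 0) = (\<Sum>k\<in>UNIV. (a $ k) *\<^sub>R (axis k 1, 0 :: real))"
        using basis_expansion[of a] by (simp add: prod_eq_iff fst_sum snd_sum scalar_mult_eq_scaleR)
      then have "dderiv \<eta> (a, 0) x = (\<Sum>k\<in>UNIV. (a $ k) * dderiv \<eta> (axis k 1, 0) x)"
        by (simp only: linear_sum[OF smooth_dderiv_linear[OF sm]] linear_scale[OF smooth_dderiv_linear[OF sm]] real_scaleR_def)
      then show "snd (U x) * dderiv \<eta> (a, 0) x = (\<Sum>k\<in>UNIV. (a $ k) * (snd (U x) * dderiv \<eta> (axis k 1, 0) x))"
        by (simp add: sum_distrib_left mult_ac)
    qed
    also have "\<dots> = (\<Sum>k\<in>UNIV. (a $ k) * (LBINT x. snd (U x) * dderiv \<eta> (axis k 1, 0) x))"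
      using i1 by (subst Bochner_Integration.integral_sum) auto
    also have "\<dots> = (\<Sum>k\<in>UNIV. LBINT x. (a $ k) * ((fst (U x) $ k) * dderiv \<eta> (0, 1) x))"
      by (simp add: ax)
    also have "\<dots> = (LBINT x. (\<Sum>k\<in>UNIV. (a $ k) * ((fst (U x) $ k) * dderiv \<eta> (0, 1) x)))"
      using i2 by (subst Bochner_Integration.integral_sum) auto
    also have "\<dots> = (LBINT x. (fst (U x) \<bullet> a) * dderiv \<eta> (0, 1) x)"
      by (intro Bochner_Integration.integral_cong refl) (simp add: inner_vec_def sum_distrib_right sum_distrib_left mult_ac)
    finally show ?thesis .
  qed
  (* The default value e keeps W free of zeros on the whole space. *)
  define W where "W x = (if x \<in> B then fst (U x) else e)" for x
  have Wm [measurable]: "W \<in> borel_measurable borel" unfolding W_def[abs_def] by measurable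
  have W0: "W x \<noteq> 0" for x using U2[of x] e by (auto simp: W_def)
  have comp: "AE x in lborel. AE y in lborel. x \<in> B \<and> y \<in> B \<longrightarrow> compatible (fst y - fst x) (W x) (W y)"
  proof (rule kinetic_compatible[OF Wm linear_fst Bo(1-3)])
    fix \<xi> :: "real ^ 'm" and v :: "(real ^ 'm) \<times> real" assume \<xi>: "norm \<xi> = 1" "fst v \<bullet> \<xi> = 0"
    show "\<forall>\<eta>\<in>test_functions B. (LBINT x. (indicator B x * (if W x \<bullet> \<xi> > 0 then 1 else 0)) * dderiv \<eta> v x) = 0"
    proof
      fix \<eta> assume \<eta>: "\<eta> \<in> test_functions B"
      define F where "F z = (if z \<bullet> (\<xi>, 0) > 0 then 1 else 0 :: real)" for z :: "(real ^ 'm) \<times> real"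
      have Fm: "F \<in> borel_measurable borel" unfolding F_def[abs_def] by measurable
      have "(\<xi>, 0) \<in> equator" using \<xi> by (simp add: equator_def norm_prod_def)
      moreover have "v \<bullet> (\<xi>, 0) = 0" using \<xi> by (simp add: inner_prod_def)
      ultimately have "(LINT x|lebesgue_on \<Omega>. F (u x) * dderiv \<eta> v x) = 0"
        using kinetic[of "(\<xi>, 0)" v] test_functions_mono[OF \<eta> B\<Omega>]
        by (simp add: distr_eq_def distr_deriv_def distr_of_def chi_def F_def)
      then have "(LBINT x. (indicator B x * F (U x)) * dderiv \<eta> v x) = 0"
        by (simp add: transfer[OF Fm test_functions_dderiv[OF \<eta>]])
      moreover have "indicator B x * F (U x) = indicator B x * (if W x \<bullet> \<xi> > 0 then 1 else 0)" for x
        by (simp add: F_def W_def inner_prod_def indicator_def)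
      ultimately show "(LBINT x. (indicator B x * (if W x \<bullet> \<xi> > 0 then 1 else 0)) * dderiv \<eta> v x) = 0" by simp
    qed
  qed
  obtain E where E: "direction_field E" "AE x in lborel. x \<in> B \<longrightarrow> (\<exists>k. W x = k *\<^sub>R E x)"
    using compatible_field_direction[OF d3 AE_fst_not_in_hyperplane W0 Bo(1,4) comp] unfolding direction_field_def by blast
  have "DIM(real ^ 'm) \<ge> 2" using d3 by linarith
  from compatible_field_sign[OF this AE_fst_not_in_hyperplane W0 comp E(1)[unfolded direction_field_def] E(2)]
  obtain \<sigma> where \<sigma>: "\<sigma> \<in> {1, - 1 :: real}"
    "AE x in lborel. x \<in> B \<longrightarrow> E x \<noteq> 0 \<and> W x = (\<sigma> * (norm (W x) / norm (E x))) *\<^sub>R E x" by blast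
  have UE: "AE x in lborel. x \<in> B \<longrightarrow> E x \<noteq> 0 \<and> fst (U x) = (\<sigma> * (norm (fst (U x)) / norm (E x))) *\<^sub>R E x"
    using \<sigma>(2) by eventually_elim (simp add: W_def)
  obtain \<Phi> \<psi> where \<Phi>: "\<And>x y. \<bar>\<Phi> x - \<Phi> y\<bar> \<le> norm (x - y)"
    and weak: "\<And>v \<eta>. \<eta> \<in> test_functions B \<Longrightarrow> (LBINT x. (indicator B x * \<Phi> x) * dderiv \<eta> v x) = - (LBINT x. (U x \<bullet> v) * \<eta> x)"
    and cases: "(\<exists>P. eikonal_2d (interior ((\<lambda>x. (norm (fst x - P), snd x)) ` B)) \<psi> \<and> (\<forall>x\<in>B. \<Phi> x = \<psi> (norm (fst x - P), snd x))) \<or>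
     (\<exists>w\<in>sphere 0 1. eikonal_2d (interior ((\<lambda>x. (w \<bullet> fst x, snd x)) ` B)) \<psi> \<and> (\<forall>x\<in>B. \<Phi> x = \<psi> (w \<bullet> fst x, snd x)))"
    using potential_stream_function[OF r \<open>DIM(real ^ 'm) \<ge> 2\<close> E(1) \<sigma>(1) Um U1[unfolded B_def] U0[unfolded B_def] UE[unfolded B_def] curlB[unfolded B_def]]
    unfolding B_def by blast
  have uB: "u \<in> borel_measurable (lebesgue_on (ball c r))"
    by (rule measurable_restrict_mono[OF measurable_u]) (use B\<Omega> in \<open>simp add: B_def\<close>)
  have grad: "has_weak_gradient (ball c r) g u" if "\<And>x. x \<in> B \<Longrightarrow> g x = \<Phi> x" for g
    by (rule has_weak_gradient_of_potential[OF uB Um Un Uu[unfolded B_def] \<Phi> weak[unfolded B_def] that[unfolded B_def]])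
  from cases show "\<exists>\<psi>. (\<exists>P'. stream_function u (ball c r) (\<lambda>x. norm (fst x - P')) (\<lambda>x. snd x) \<psi>) \<or>
         (\<exists>w'\<in>sphere 0 1. stream_function u (ball c r) (\<lambda>x. w' \<bullet> fst x) (\<lambda>x. snd x) \<psi>)"
  proof (elim disjE exE bexE conjE)
    fix P assume P: "eikonal_2d (interior ((\<lambda>x. (norm (fst x - P), snd x)) ` B)) \<psi>" "\<forall>x\<in>B. \<Phi> x = \<psi> (norm (fst x - P), snd x)"
    then have "stream_function u (ball c r) (\<lambda>x. norm (fst x - P)) (\<lambda>x. snd x) \<psi>"
      unfolding stream_function_def B_def[symmetric] using grad[unfolded B_def[symmetric]] by simp
    then show ?thesis by blast
  next
    fix w :: "real ^ 'm" assume w: "w \<in> sphere 0 1" "eikonal_2d (interior ((\<lambda>x. (w \<bullet> fst x, snd x)) ` B)) \<psi>" "\<forall>x\<in>B. \<Phi> x = \<psi> (w \<bullet> fst x, snd x)"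
    then have "stream_function u (ball c r) (\<lambda>x. w \<bullet> fst x) (\<lambda>x. snd x) \<psi>"
      unfolding stream_function_def B_def[symmetric] using grad[unfolded B_def[symmetric]] by simp
    then show ?thesis using w(1) by blast
  qed
qed

end
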